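(* Let $X\in L^\Phi(\mathfrak P)$ be a limited liability claim (i.e. $X\succeq0$) with $\mathcal F=\sigma(\{f: f\in X\})$. Suppose $X$ has topological spanning power in that $\mathcal C_X$ is an ideal of $L^\Phi(\mathfrak P)$. Let $\mathbb P^*\in\mathbf{ca}_+^1(L^\Phi(\mathfrak P))$ be a probability measure such that the canonical projection $J_{\mathbb P^*}$ is injective on the separable space $\mathcal C_X$ (so that $\mathbb P^*$ is a strictly positive functional on $\mathcal C_X$ and the $\mathfrak P$-q.s. and $\mathbb P^*$-a.s. orders coincide on $\mathcal C_X$). Then the following assertions hold: (1) $\mathcal C_X$ is super Dedekind complete. (2) $\mathbf{ca}(\mathcal C_X)\approx\mathfrak P\approx\mathbb P^*$ and the unit ball of $\mathbf{ca}(\mathcal C_X)$ is weakly compact in $L^1(\mathbb P^* )$. (3) $\mathcal C_X$ is lattice-isomorphic to an ideal of $L^1(\mathbb P^* )$. (4) $X\in\mathrm{cl}(L^\infty(\mathfrak P))=\mathcal C_X$. In particular, unless $\mathfrak P$ is dominated (i.e. $\mathfrak P\ll\mathbb Q$ for a single probability measure $\mathbb Q$), $\mathcal C_X$ is not an ideal of $L^\Phi(\mathfrak P)$ for any such limited liability claim $X$.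
   Context: $(\Omega,\mathcal F)$ is a measurable space, $\mathfrak P$ a nonempty set of probability measures on it. $L^0(\mathfrak P)$ is the space of equivalence classes $[f]$ of measurable $f\colon\Omega\to\mathbb R$ under $f\sim g\iff \mathbb P(f=g)=1$ for all $\mathbb P\in\mathfrak P$ ($f\in X$ means $f$ is a representative of $X$), with the $\mathfrak P$-q.s. order $X\preceq Y$ iff $\mathbb P(f\le g)=1$ for all $\mathbb P\in\mathfrak P$, $f\in X$, $g\in Y$; it is a vector lattice. $L^\infty(\mathfrak P)\subset L^0(\mathfrak P)$ is the space of classes of bounded random variables. An Orlicz function is a lower semicontinuous, nondecreasing, convex $\phi\colon[0,\infty)\to[0,\infty]$ with $\phi(0)=0$ such that there are $x_0,x_1>0$ with $\phi(x_0)<\infty$, $\phi(x_1)>0$. $\Phi=(\phi_{\mathbb P})_{\mathbb P\in\mathfrak P}$ is a family of Orlicz functions; for $X\in L^0(\mathfrak P)$, $\|X\|_{L^\Phi(\mathfrak P)}=\inf\{\lambda>0:\sup_{\mathbb P\in\mathfrak P}\mathbb E_{\mathbb P}[\phi_{\mathbb P}(\lambda^{-1}|X|)]\le1\}$, and $L^\Phi(\mathfrak P)=\{X: \|X\|_{L^\Phi(\mathfrak P)}<\infty\}$; this is a Banach lattice. Closures cl are in this norm. Standing assumption: $L^\infty(\mathfrak P)\subset L^\Phi(\mathfrak P)$. The option space of $X$ is $\mathcal H_X=\mathrm{span}(\{\mathbf 1_\Omega\}\cup\{(X-k\mathbf 1_\Omega)^+: k\in\mathbb R\})$ and $\mathcal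 C_X=\mathrm{cl}(\mathcal H_X)$, a separable Banach sublattice of $L^\Phi(\mathfrak P)$. $\mathbf{ca}$: signed measures on $(\Omega,\mathcal F)$ of finite total variation. For nonempty $\mathfrak Q,\mathfrak R\subset\mathbf{ca}$, $\mathfrak Q\ll\mathfrak R$ means $\sup_{\nu\in\mathfrak R}|\nu|(N)=0$ implies $\sup_{\mu\in\mathfrak Q}|\mu|(N)=0$ for $N\in\mathcal F$; $\mathfrak Q\approx\mathfrak R$ means both $\mathfrak Q\ll\mathfrak R$ and $\mathfrak R\ll\mathfrak Q$; singletons are written without braces. $\mathbf{ca}(\mathfrak P)=\{\mu\in\mathbf{ca}:\mu\ll\mathfrak P\}$. For a normed sublattice $\mathcal X$ of $L^\Phi(\mathfrak P)$, $\mathbf{ca}(\mathcal X)$ is the set of $\mu\in\mathbf{ca}(\mathfrak P)$ such that every $Y\in\mathcal X$ is $|\mu|$-integrable and $Y\mapsto\int Y\,d|\mu|$ is norm continuous on $\mathcal X$; such $\mu$ is identified with the functional $Y\mapsto\int Y\,d\mu$ in the norm dual $\mathcal X^*$. $\mathbf{ca}_+^1(L^\Phi(\mathfrak P))$ is the set of probability measures in $\mathbf{ca}(L^\Phi(\mathfrak P))$. The unit ball of $\mathbf{ca}(\mathcal C_X)$ is $\{\mu\in\mathbf{ca}(\mathcal C_X):\|\mu\|_{\mathcal C_X^*}\le1\}$, regarded as a subset of $L^1(\mathbb P^* )$ via densities $\frac{d\mu}{d\mathbb P^*}$. For $\mathbb Q\in\mathbf{ca}_+^1(L^\Phi(\mathfrak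 P))$, $J_{\mathbb Q}\colon L^\Phi(\mathfrak P)\to L^1(\mathbb Q)$ maps $Y$ to the $\mathbb Q$-a.s. equivalence class of any representative of $Y$. For every separable subspace of $L^\Phi(\mathfrak P)$ a $\mathbb P^*$ with $J_{\mathbb P^*}$ injective on it exists. A vector lattice is Dedekind complete if every subset with an upper bound has a least upper bound; it is super Dedekind complete if moreover suprema are attained by countable subsets. An ideal $I$ in a vector lattice is a vector subspace such that $|Y|\preceq|Z|$, $Z\in I$ imply $Y\in I$. *)

theory Defs
  imports "HOL-Probability.Probability_Measure"
begin

section \<open>Equivalence classes of random variables\<close>

text \<open>
  A measure \<open>M\<close> is used only through \<open>space M\<close> and \<open>sets M\<close>, i.e. as the measurable space
  \<open>(\<Omega>, \<F>)\<close>; its values play no role. A set \<open>P\<close> of probability measures on it is written as an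
  \<open>'a measure set\<close>. An element of \<open>L\<^sup>0(P)\<close> is literally the set of its representatives.
  For a single probability measure \<open>Q\<close>, the space of \<open>Q\<close>-a.s. equivalence classes is the case
  \<open>P = {Q}\<close>.
\<close>

type_synonym 'a rclass = "('a \<Rightarrow> real) set"

definition qs_class :: "'a measure \<Rightarrow> 'a measure set \<Rightarrow> ('a \<Rightarrow> real) \<Rightarrow> 'a rclass" where
  "qs_class M P f = {g \<in> borel_measurable M. \<forall>Q\<in>P. AE x in Q. f x = g x}"

definition L0 :: "'a measure \<Rightarrow> 'a measure set \<Rightarrow> 'a rclass set" where
  "L0 M P = qs_class M P ` borel_measurable M"

definition rep :: "'a rclass \<Rightarrow> 'a \<Rightarrow> real" where
  "rep X = (SOME f. f \<in> X)"

definition qs_le :: "'a measure set \<Rightarrow> 'a rclass \<Rightarrow> 'a rclass \<Rightarrow> bool" where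
  "qs_le P X Y \<longleftrightarrow> (\<forall>f\<in>X. \<forall>g\<in>Y. \<forall>Q\<in>P. AE x in Q. f x \<le> g x)"

definition qs_const :: "'a measure \<Rightarrow> 'a measure set \<Rightarrow> real \<Rightarrow> 'a rclass" where
  "qs_const M P c = qs_class M P (\<lambda>x. c)"

definition qs_map :: "'a measure \<Rightarrow> 'a measure set \<Rightarrow> (real \<Rightarrow> real) \<Rightarrow> 'a rclass \<Rightarrow> 'a rclass" where
  "qs_map M P h X = qs_class M P (\<lambda>x. h (rep X x))"

definition qs_map2 ::
  "'a measure \<Rightarrow> 'a measure set \<Rightarrow> (real \<Rightarrow> real \<Rightarrow> real) \<Rightarrow> 'a rclass \<Rightarrow> 'a rclass \<Rightarrow> 'a rclass" where
  "qs_map2 M P h X Y = qs_class M P (\<lambda>x. h (rep X x) (rep Y x))"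

abbreviation "qs_add M P \<equiv> qs_map2 M P (+)"
abbreviation "qs_diff M P \<equiv> qs_map2 M P (-)"
abbreviation "qs_scale M P c \<equiv> qs_map M P ((*) c)"
abbreviation "qs_sup M P \<equiv> qs_map2 M P max"
abbreviation "qs_inf M P \<equiv> qs_map2 M P min"
abbreviation "qs_abs M P \<equiv> qs_map M P abs"

definition Linf :: "'a measure \<Rightarrow> 'a measure set \<Rightarrow> 'a rclass set" where
  "Linf M P = {X \<in> L0 M P. \<exists>f\<in>X. \<exists>c. \<forall>x\<in>space M. \<bar>f x\<bar> \<le> c}"


section \<open>Linear and order structure\<close>

definition qs_subspace :: "'a measure \<Rightarrow> 'a measure set \<Rightarrow> 'a rclass set \<Rightarrow> bool" where
  "qs_subspace M P V \<longleftrightarrow> V \<subseteq> L0 M P \<and> qs_const M P 0 \<in> V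
     \<and> (\<forall>Y\<in>V. \<forall>Z\<in>V. qs_add M P Y Z \<in> V) \<and> (\<forall>c. \<forall>Y\<in>V. qs_scale M P c Y \<in> V)"

definition qs_span :: "'a measure \<Rightarrow> 'a measure set \<Rightarrow> 'a rclass set \<Rightarrow> 'a rclass set" where
  "qs_span M P S = qs_subspace M P hull S"

definition is_ideal :: "'a measure \<Rightarrow> 'a measure set \<Rightarrow> 'a rclass set \<Rightarrow> 'a rclass set \<Rightarrow> bool" where
  "is_ideal M P L I \<longleftrightarrow> I \<subseteq> L \<and> qs_subspace M P I
     \<and> (\<forall>Y\<in>L. \<forall>Z\<in>I. qs_le P (qs_abs M P Y) (qs_abs M P Z) \<longrightarrow> Y \<in> I)"

text \<open>Suprema are taken within the lattice \<open>C\<close>.\<close>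

definition is_lub :: "'a measure set \<Rightarrow> 'a rclass set \<Rightarrow> 'a rclass set \<Rightarrow> 'a rclass \<Rightarrow> bool" where
  "is_lub P C A S \<longleftrightarrow> S \<in> C \<and> (\<forall>Y\<in>A. qs_le P Y S)
     \<and> (\<forall>T\<in>C. (\<forall>Y\<in>A. qs_le P Y T) \<longrightarrow> qs_le P S T)"

text \<open>As usual, only nonempty subsets are considered: in a nonzero vector lattice the empty set is
  bounded above but has no least upper bound.\<close>

definition Dedekind_complete :: "'a measure set \<Rightarrow> 'a rclass set \<Rightarrow> bool" where
  "Dedekind_complete P C \<longleftrightarrow>
     (\<forall>A\<subseteq>C. A \<noteq> {} \<and> (\<exists>U\<in>C. \<forall>Y\<in>A. qs_le P Y U) \<longrightarrow> (\<exists>S. is_lub P C A S))"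

definition super_Dedekind_complete :: "'a measure set \<Rightarrow> 'a rclass set \<Rightarrow> bool" where
  "super_Dedekind_complete P C \<longleftrightarrow> Dedekind_complete P C
     \<and> (\<forall>A\<subseteq>C. \<forall>S. is_lub P C A S \<longrightarrow> (\<exists>B\<subseteq>A. countable B \<and> is_lub P C B S))"

definition lattice_isomorphism ::
  "'a measure \<Rightarrow> 'a measure set \<Rightarrow> 'a rclass set \<Rightarrow> 'a measure set \<Rightarrow> 'a rclass set
     \<Rightarrow> ('a rclass \<Rightarrow> 'a rclass) \<Rightarrow> bool" where
  "lattice_isomorphism M P C P' I T \<longleftrightarrow> bij_betw T C I
     \<and> (\<forall>Y\<in>C. \<forall>Z\<in>C. T (qs_add M P Y Z) = qs_add M P' (T Y) (T Z))
     \<and> (\<forall>c. \<forall>Y\<in>C. T (qs_scale M P c Y) = qs_scale M P' c (T Y))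
     \<and> (\<forall>Y\<in>C. \<forall>Z\<in>C. T (qs_sup M P Y Z) = qs_sup M P' (T Y) (T Z))
     \<and> (\<forall>Y\<in>C. \<forall>Z\<in>C. T (qs_inf M P Y Z) = qs_inf M P' (T Y) (T Z))"

definition norm_continuous ::
  "'a measure \<Rightarrow> 'a measure set \<Rightarrow> ('a rclass \<Rightarrow> ennreal) \<Rightarrow> 'a rclass set \<Rightarrow> ('a rclass \<Rightarrow> real) \<Rightarrow> bool" where
  "norm_continuous M P N V l \<longleftrightarrow>
     (\<forall>Y\<in>V. \<forall>e>0. \<exists>d>0. \<forall>Z\<in>V. N (qs_diff M P Z Y) < ennreal d \<longrightarrow> \<bar>l Z - l Y\<bar> < e)"


section \<open>Robust Orlicz spaces\<close>

text \<open>Only the values on \<open>[0,\<infinity>)\<close> matter. In \<open>ennreal\<close>, \<open>0 * \<infinity> = 0\<close>.\<close>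

definition Orlicz_function :: "(real \<Rightarrow> ennreal) \<Rightarrow> bool" where
  "Orlicz_function \<phi> \<longleftrightarrow>
     (\<forall>x\<ge>0. \<phi> x \<le> Liminf (at x within {0..}) \<phi>)
     \<and> mono_on {0..} \<phi>
     \<and> (\<forall>x\<ge>0. \<forall>y\<ge>0. \<forall>t\<in>{0..1}. \<phi> (t * x + (1 - t) * y) \<le> ennreal t * \<phi> x + ennreal (1 - t) * \<phi> y)
     \<and> \<phi> 0 = 0 \<and> (\<exists>x>0. \<phi> x < \<infinity>) \<and> (\<exists>x>0. 0 < \<phi> x)"

definition Orlicz_norm ::
  "'a measure set \<Rightarrow> ('a measure \<Rightarrow> real \<Rightarrow> ennreal) \<Rightarrow> 'a rclass \<Rightarrow> ennreal" where
  "Orlicz_norm P \<Phi> X =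
     (INF l\<in>{l. 0 < l \<and> (SUP Q\<in>P. \<integral>\<^sup>+x. \<Phi> Q (inverse l * \<bar>rep X x\<bar>) \<partial>Q) \<le> 1}. ennreal l)"

definition LPhi ::
  "'a measure \<Rightarrow> 'a measure set \<Rightarrow> ('a measure \<Rightarrow> real \<Rightarrow> ennreal) \<Rightarrow> 'a rclass set" where
  "LPhi M P \<Phi> = {X \<in> L0 M P. Orlicz_norm P \<Phi> X < \<infinity>}"

definition Orlicz_closure ::
  "'a measure \<Rightarrow> 'a measure set \<Rightarrow> ('a measure \<Rightarrow> real \<Rightarrow> ennreal) \<Rightarrow> 'a rclass set \<Rightarrow> 'a rclass set" where
  "Orlicz_closure M P \<Phi> A =
     {Y \<in> LPhi M P \<Phi>. \<forall>e>0. \<exists>Z\<in>A. Orlicz_norm P \<Phi> (qs_diff M P Y Z) < ennreal e}"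

definition option_space :: "'a measure \<Rightarrow> 'a measure set \<Rightarrow> 'a rclass \<Rightarrow> 'a rclass set" where
  "option_space M P X =
     qs_span M P ({qs_const M P 1} \<union> (\<lambda>k. qs_map M P (\<lambda>x. max (x - k) 0) X) ` UNIV)"

definition option_closure ::
  "'a measure \<Rightarrow> 'a measure set \<Rightarrow> ('a measure \<Rightarrow> real \<Rightarrow> ennreal) \<Rightarrow> 'a rclass \<Rightarrow> 'a rclass set" where
  "option_closure M P \<Phi> X = Orlicz_closure M P \<Phi> (option_space M P X)"

definition generates_sigma_algebra :: "'a measure \<Rightarrow> 'a rclass \<Rightarrow> bool" where
  "generates_sigma_algebra M X \<longleftrightarrow>
     sets M = sigma_sets (space M) {f -` B \<inter> space M | f B. f \<in> X \<and> B \<in> sets borel}"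


section \<open>Signed measures\<close>

text \<open>
  A signed measure is a real set function, normalised to vanish outside \<open>sets M\<close> (as
  \<^const>\<open>measure\<close> does), so a finite measure \<open>Q\<close> corresponds to the signed measure \<open>measure Q\<close>.
  \<open>pos_part\<close> is \<open>\<mu>\<^sup>+(A) = sup {\<mu>(B) | B \<in> \<F>, B \<subseteq> A}\<close> of the Jordan decomposition, and the total
  variation is \<open>|\<mu>| = \<mu>\<^sup>+ + \<mu>\<^sup>-\<close>.
\<close>

definition pos_part :: "'a measure \<Rightarrow> ('a set \<Rightarrow> real) \<Rightarrow> 'a measure" where
  "pos_part M \<mu> = measure_of (space M) (sets M) (\<lambda>A. SUP B\<in>{B\<in>sets M. B \<subseteq> A}. ennreal (\<mu> B))"

definition neg_part :: "'a measure \<Rightarrow> ('a set \<Rightarrow> real) \<Rightarrow> 'a measure" where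
  "neg_part M \<mu> = pos_part M (\<lambda>A. - \<mu> A)"

definition variation :: "'a measure \<Rightarrow> ('a set \<Rightarrow> real) \<Rightarrow> 'a measure" where
  "variation M \<mu> = measure_of (space M) (sets M)
     (\<lambda>A. emeasure (pos_part M \<mu>) A + emeasure (neg_part M \<mu>) A)"

definition ca :: "'a measure \<Rightarrow> ('a set \<Rightarrow> real) set" where
  "ca M = {\<mu>. (\<forall>A. A \<notin> sets M \<longrightarrow> \<mu> A = 0) \<and> \<mu> {} = 0
     \<and> (\<forall>A. range A \<subseteq> sets M \<and> disjoint_family A \<longrightarrow> (\<lambda>i::nat. \<mu> (A i)) sums \<mu> (\<Union>i. A i))
     \<and> emeasure (variation M \<mu>) (space M) < \<infinity>}"

definition ca_dominated ::
  "'a measure \<Rightarrow> ('a set \<Rightarrow> real) set \<Rightarrow> ('a set \<Rightarrow> real) set \<Rightarrow> bool" where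
  "ca_dominated M A B \<longleftrightarrow>
     (\<forall>N\<in>sets M. (SUP \<nu>\<in>B. emeasure (variation M \<nu>) N) = 0
        \<longrightarrow> (SUP \<mu>\<in>A. emeasure (variation M \<mu>) N) = 0)"

definition ca_equivalent ::
  "'a measure \<Rightarrow> ('a set \<Rightarrow> real) set \<Rightarrow> ('a set \<Rightarrow> real) set \<Rightarrow> bool" where
  "ca_equivalent M A B \<longleftrightarrow> ca_dominated M A B \<and> ca_dominated M B A"

definition signed_integral :: "'a measure \<Rightarrow> ('a set \<Rightarrow> real) \<Rightarrow> ('a \<Rightarrow> real) \<Rightarrow> real" where
  "signed_integral M \<mu> f = (\<integral>x. f x \<partial>pos_part M \<mu>) - (\<integral>x. f x \<partial>neg_part M \<mu>)"

definition ca_on ::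
  "'a measure \<Rightarrow> 'a measure set \<Rightarrow> ('a measure \<Rightarrow> real \<Rightarrow> ennreal) \<Rightarrow> 'a rclass set
     \<Rightarrow> ('a set \<Rightarrow> real) set" where
  "ca_on M P \<Phi> V = {\<mu> \<in> ca M. ca_dominated M {\<mu>} (measure ` P)
     \<and> (\<forall>Y\<in>V. \<forall>f\<in>Y. integrable (variation M \<mu>) f)
     \<and> norm_continuous M P (Orlicz_norm P \<Phi>) V (\<lambda>Y. \<integral>x. rep Y x \<partial>variation M \<mu>)}"

definition ca_prob ::
  "'a measure \<Rightarrow> 'a measure set \<Rightarrow> ('a measure \<Rightarrow> real \<Rightarrow> ennreal) \<Rightarrow> 'a measure set" where
  "ca_prob M P \<Phi> = {Q. prob_space Q \<and> sets Q = sets M \<and> measure Q \<in> ca_on M P \<Phi> (LPhi M P \<Phi>)}"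

definition dual_norm ::
  "'a measure \<Rightarrow> 'a measure set \<Rightarrow> ('a measure \<Rightarrow> real \<Rightarrow> ennreal) \<Rightarrow> 'a rclass set
     \<Rightarrow> ('a set \<Rightarrow> real) \<Rightarrow> ennreal" where
  "dual_norm M P \<Phi> V \<mu> =
     (SUP Y\<in>{Y\<in>V. Orlicz_norm P \<Phi> Y \<le> 1}. ennreal \<bar>signed_integral M \<mu> (rep Y)\<bar>)"

definition ca_unit_ball ::
  "'a measure \<Rightarrow> 'a measure set \<Rightarrow> ('a measure \<Rightarrow> real \<Rightarrow> ennreal) \<Rightarrow> 'a rclass set
     \<Rightarrow> ('a set \<Rightarrow> real) set" where
  "ca_unit_ball M P \<Phi> V = {\<mu> \<in> ca_on M P \<Phi> V. dual_norm M P \<Phi> V \<mu> \<le> 1}"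

definition dominated :: "'a measure \<Rightarrow> 'a measure set \<Rightarrow> bool" where
  "dominated M P \<longleftrightarrow>
     (\<exists>Q. prob_space Q \<and> sets Q = sets M \<and> ca_dominated M (measure ` P) {measure Q})"


section \<open>The space of integrable classes and its weak topology\<close>

definition L1 :: "'a measure \<Rightarrow> 'a measure \<Rightarrow> 'a rclass set" where
  "L1 M Q = {X \<in> L0 M {Q}. \<forall>f\<in>X. integrable Q f}"

definition L1_norm :: "'a measure \<Rightarrow> 'a rclass \<Rightarrow> ennreal" where
  "L1_norm Q X = (\<integral>\<^sup>+x. ennreal \<bar>rep X x\<bar> \<partial>Q)"

definition L1_dual :: "'a measure \<Rightarrow> 'a measure \<Rightarrow> ('a rclass \<Rightarrow> real) set" where
  "L1_dual M Q = {l. (\<forall>Y\<in>L1 M Q. \<forall>Z\<in>L1 M Q. l (qs_add M {Q} Y Z) = l Y + l Z)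
     \<and> (\<forall>c. \<forall>Y\<in>L1 M Q. l (qs_scale M {Q} c Y) = c * l Y)
     \<and> norm_continuous M {Q} (L1_norm Q) (L1 M Q) l}"

definition L1_weak_topology :: "'a measure \<Rightarrow> 'a measure \<Rightarrow> 'a rclass topology" where
  "L1_weak_topology M Q =
     topology_generated_by {{Y \<in> L1 M Q. l Y \<in> U} | l U. l \<in> L1_dual M Q \<and> open U}"

text \<open>The class of all densities of \<open>\<mu>\<close> with respect to \<open>Q\<close>; a single element of \<open>L1 M Q\<close> if
  \<open>\<mu> \<ll> Q\<close>, and empty (hence not in \<open>L1 M Q\<close>) if there is no density.\<close>

definition density_class :: "'a measure \<Rightarrow> 'a measure \<Rightarrow> ('a set \<Rightarrow> real) \<Rightarrow> 'a rclass" where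
  "density_class M Q \<mu> = {f \<in> borel_measurable M. integrable Q f
     \<and> (\<forall>A\<in>sets M. \<mu> A = (\<integral>x. indicator A x * f x \<partial>Q))}"

definition canonical_projection :: "'a measure \<Rightarrow> 'a measure \<Rightarrow> 'a rclass \<Rightarrow> 'a rclass" where
  "canonical_projection M Q Y = qs_class M {Q} (rep Y)"

end

theory Submission
  imports Defs "HOL-Probability.Probability_Mass_Function"
begin

text \<open>
  If \<open>C = C\<^sub>X\<close> is an ideal, it contains all indicators, so injectivity of the projection onto
  \<open>L\<^sup>1(P\<^sup>*)\<close> means that \<open>P\<^sup>*\<close> and the family have the same null sets; hence the two
  spaces of classes coincide, which yields the embedding into \<open>L\<^sup>1(P\<^sup>*)\<close>, and suprema can be
  formed as essential suprema. Separability of \<open>C\<close> makes the norm order continuous: otherwise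
  some element of \<open>C\<close> would have disjoint parts of norm bounded below, and their uncountably many
  partial unions, all of which lie in the ideal, would be uniformly separated. Order continuity
  lets one truncate, so \<open>C\<close> is the closure of the bounded classes; it also turns every continuous
  functional into a signed measure with a \<open>P\<^sup>*\<close>-density, so that the unit ball is the image of
  the weak-* compact dual ball under a map that is weakly continuous because
  \<open>L\<^sup>\<infinity>\<close> is contained in \<open>C\<close>. Finally, a countable subfamily norming a countable dense subset
  norms \<open>C\<close>, and a mixture of it dominates the whole family.
\<close>

section \<open>Signed measures\<close>

text \<open>The norm is a supremum over possibly uncountably many measures, so almost sure
  convergence under domination need not give norm convergence, and a continuous functional need not
  be countably additive. This is the obstacle that order continuity removes; for functionals it is
  applied to the constant 1. The option space has uncountably many generators. It is nevertheless
  separable because moving a strike by a small amount changes the payoff by at most that amount, and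
  constants have finite norm; rational strikes and coefficients therefore suffice. The dual ball is
  realised on bounded functions. They are exactly the test functions of the weak topology of the
  space of integrable classes, and they control a density on all of C: multiply by its sign,
  truncate and pass to the limit monotonically. The final claim comes without a strictly positive
  measure, so domination cannot be read off from an equivalence of null sets. It is derived from
  separability, the presence of indicators in C, and the fact that an indicator of norm 0 belongs to
  a polar set.\<close>

definition signed_measure :: "'a measure \<Rightarrow> ('a set \<Rightarrow> real) \<Rightarrow> bool" where
  "signed_measure M \<mu> \<longleftrightarrow> (\<forall>A. A \<notin> sets M \<longrightarrow> \<mu> A = 0) \<and> \<mu> {} = 0
     \<and> (\<forall>A. range A \<subseteq> sets M \<and> disjoint_family A \<longrightarrow> (\<lambda>i::nat. \<mu> (A i)) sums \<mu> (\<Union>i. A i))"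

lemma signed_measure_empty: "signed_measure M \<mu> \<Longrightarrow> \<mu> {} = 0"
  by (simp add: signed_measure_def)

lemma signed_measure_sums:
  "signed_measure M \<mu> \<Longrightarrow> range A \<subseteq> sets M \<Longrightarrow> disjoint_family A \<Longrightarrow> (\<lambda>i::nat. \<mu> (A i)) sums \<mu> (\<Union>i. A i)"
  by (simp add: signed_measure_def)

text \<open>Countable additivity and finite variation are kept apart, because for the set function
  of a functional they come from different arguments.\<close>

lemma ca_iff: "\<mu> \<in> ca M \<longleftrightarrow> signed_measure M \<mu> \<and> emeasure (variation M \<mu>) (space M) < \<infinity>"
  by (auto simp: ca_def signed_measure_def)

lemma signed_measure_uminus: "signed_measure M \<mu> \<Longrightarrow> signed_measure M (\<lambda>A. - \<mu> A)"
  by (auto simp: signed_measure_def intro: sums_minus)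

lemma signed_measure_Un:
  assumes "signed_measure M \<mu>" "A \<in> sets M" "B \<in> sets M" "A \<inter> B = {}"
  shows "\<mu> (A \<union> B) = \<mu> A + \<mu> B"
proof -
  have "(\<lambda>i. \<mu> (binaryset A B i)) sums \<mu> (\<Union>i. binaryset A B i)"
    using assms by (intro signed_measure_sums) (auto simp: range_binaryset_eq disjoint_family_on_def binaryset_def)
  moreover have "(\<lambda>i. \<mu> (binaryset A B i)) sums (\<mu> A + \<mu> B)"
    by (intro binaryset_sums signed_measure_empty[OF assms(1)])
  ultimately show ?thesis
    using sums_unique2 by (metis UN_binaryset_eq)
qed

section \<open>Jordan parts and total variation\<close>

lemma space_pos_part [simp]: "space (pos_part M \<mu>) = space M"
  and sets_pos_part [simp]: "sets (pos_part M \<mu>) = sets M"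
  and space_neg_part [simp]: "space (neg_part M \<mu>) = space M"
  and sets_neg_part [simp]: "sets (neg_part M \<mu>) = sets M"
  and space_variation [simp]: "space (variation M \<mu>) = space M"
  and sets_variation [simp]: "sets (variation M \<mu>) = sets M"
  by (simp_all add: pos_part_def neg_part_def variation_def)

text \<open>\<open>measure_of\<close> returns the supremum formula only once it is known to be
  countably additive. One inequality cuts a subset of the union into pieces; the other glues subsets
  of disjoint sets together, where a piece of negative value may be dropped because
  \<open>ennreal\<close> sends it to 0.\<close>

lemma emeasure_pos_part:
  assumes \<mu>: "signed_measure M \<mu>" and A: "A \<in> sets M"
  shows "emeasure (pos_part M \<mu>) A = (SUP B\<in>{B\<in>sets M. B \<subseteq> A}. ennreal (\<mu> B))"
proof (rule emeasure_measure_of[OF pos_part_def])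
  let ?v = "\<lambda>A. SUP B\<in>{B\<in>sets M. B \<subseteq> A}. ennreal (\<mu> B)"
  show "positive (sets (pos_part M \<mu>)) ?v"
    using signed_measure_empty[OF \<mu>] by (auto simp: positive_def intro!: antisym SUP_least)
  show "countably_additive (sets (pos_part M \<mu>)) ?v"
  proof (rule countably_additiveI)
    fix A :: "nat \<Rightarrow> 'a set"
    assume A: "range A \<subseteq> sets (pos_part M \<mu>)" "disjoint_family A"
    have Am: "A i \<in> sets M" for i using A by auto
    show "(\<Sum>i. ?v (A i)) = ?v (\<Union>i. A i)"
    proof (rule antisym)
      show "?v (\<Union>i. A i) \<le> (\<Sum>i. ?v (A i))"
      proof (rule SUP_least)
        fix B assume B: "B \<in> {B \<in> sets M. B \<subseteq> (\<Union>i. A i)}"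
        have s: "(\<lambda>i. \<mu> (A i \<inter> B)) sums \<mu> (\<Union>i. A i \<inter> B)"
          using A B by (intro signed_measure_sums[OF \<mu>]) (auto simp: disjoint_family_on_def)
        have *: "(\<Union>i. A i \<inter> B) = B" using B by auto
        have "ennreal (\<Sum>i<n. \<mu> (A i \<inter> B)) \<le> (\<Sum>i. ?v (A i))" for n
        proof -
          \<comment> \<open>Negative terms are cut off first, since \<open>ennreal\<close> commutes
            with sums of nonnegative terms only.\<close>
          have "ennreal (\<Sum>i<n. \<mu> (A i \<inter> B)) \<le> ennreal (\<Sum>i<n. max 0 (\<mu> (A i \<inter> B)))"
            by (intro ennreal_leI sum_mono) auto
          also have "\<dots> = (\<Sum>i<n. ennreal (max 0 (\<mu> (A i \<inter> B))))"
            by (subst sum_ennreal) auto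
          also have "\<dots> \<le> (\<Sum>i<n. ?v (A i))"
          proof (rule sum_mono)
            fix i
            show "ennreal (max 0 (\<mu> (A i \<inter> B))) \<le> ?v (A i)"
              using B Am[of i] by (auto intro!: SUP_upper2[of "A i \<inter> B"] simp: max_def ennreal_neg)
          qed
          also have "\<dots> \<le> (\<Sum>i. ?v (A i))" by (rule sum_le_suminf) auto
          finally show ?thesis .
        qed
        moreover have "(\<lambda>n. ennreal (\<Sum>i<n. \<mu> (A i \<inter> B))) \<longlonglongrightarrow> ennreal (\<mu> B)"
          using s unfolding sums_def * by (rule tendsto_ennrealI)
        ultimately show "ennreal (\<mu> B) \<le> (\<Sum>i. ?v (A i))"
          by (intro LIMSEQ_le_const2) auto
      qed
      show "(\<Sum>i. ?v (A i)) \<le> ?v (\<Union>i. A i)"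
      proof (rule suminf_le_const)
        fix n
        have step: "?v C + ?v D \<le> ?v (C \<union> D)" if "C \<in> sets M" "D \<in> sets M" "C \<inter> D = {}" for C D
        proof -
          have "?v C + ?v D = (SUP B\<in>{B\<in>sets M. B \<subseteq> C}. ennreal (\<mu> B) + ?v D)"
            by (rule ennreal_SUP_add_left[symmetric]) auto
          also have "\<dots> \<le> ?v (C \<union> D)"
          proof (rule SUP_least)
            fix B assume B: "B \<in> {B \<in> sets M. B \<subseteq> C}"
            have "ennreal (\<mu> B) + ?v D = (SUP B'\<in>{B\<in>sets M. B \<subseteq> D}. ennreal (\<mu> B) + ennreal (\<mu> B'))"
              by (rule ennreal_SUP_add_right) auto
            also have "\<dots> \<le> ?v (C \<union> D)"
            proof (rule SUP_least)
              fix B' assume B': "B' \<in> {B \<in> sets M. B \<subseteq> D}"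
              have e: "\<mu> (B \<union> B') = \<mu> B + \<mu> B'"
                using B B' that by (intro signed_measure_Un[OF \<mu>]) auto
              consider "\<mu> B \<ge> 0" "\<mu> B' \<ge> 0" | "\<mu> B < 0" | "\<mu> B' < 0" by linarith
              then show "ennreal (\<mu> B) + ennreal (\<mu> B') \<le> ?v (C \<union> D)"
              proof cases
                case 1
                then show ?thesis using B B'
                  by (intro SUP_upper2[of "B \<union> B'"]) (auto simp: e)
              next
                case 2
                then show ?thesis using B'
                  by (intro SUP_upper2[of B']) (auto simp: ennreal_neg)
              next
                case 3
                then show ?thesis using B
                  by (intro SUP_upper2[of B]) (auto simp: ennreal_neg)
              qed
            qed
            finally show "ennreal (\<mu> B) + ?v D \<le> ?v (C \<union> D)" .
          qed
          finally show ?thesis .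
        qed
        have "(\<Sum>i<n. ?v (A i)) \<le> ?v (\<Union>i<n. A i)"
        proof (induction n)
          case (Suc n)
          have "A i \<inter> A n = {}" if "i < n" for i
            using disjoint_family_onD[OF A(2), of i n] that by auto
          then have "(\<Union>i<n. A i) \<inter> A n = {}" by blast
          then have "?v (\<Union>i<n. A i) + ?v (A n) \<le> ?v ((\<Union>i<n. A i) \<union> A n)"
            using Am by (intro step) auto
          also have "(\<Union>i<n. A i) \<union> A n = (\<Union>i<Suc n. A i)" by (auto simp: lessThan_Suc)
          finally show ?case
            unfolding sum.lessThan_Suc by (rule order_trans[OF add_right_mono[OF Suc]])
        qed simp
        also have "\<dots> \<le> ?v (\<Union>i. A i)"
          by (rule SUP_subset_mono) auto
        finally show "(\<Sum>i<n. ?v (A i)) \<le> ?v (\<Union>i. A i)" .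
      qed auto
    qed
  qed
qed (use A sets.space_closed in auto)

lemma emeasure_neg_part:
  assumes "signed_measure M \<mu>" "A \<in> sets M"
  shows "emeasure (neg_part M \<mu>) A = (SUP B\<in>{B\<in>sets M. B \<subseteq> A}. ennreal (- \<mu> B))"
  unfolding neg_part_def by (rule emeasure_pos_part[OF signed_measure_uminus[OF assms(1)] assms(2)])

lemma emeasure_variation:
  assumes "A \<in> sets M"
  shows "emeasure (variation M \<mu>) A = emeasure (pos_part M \<mu>) A + emeasure (neg_part M \<mu>) A"
proof (rule emeasure_measure_of[OF variation_def])
  show "countably_additive (sets (variation M \<mu>)) (\<lambda>A. emeasure (pos_part M \<mu>) A + emeasure (neg_part M \<mu>) A)"
  proof (rule countably_additiveI)
    fix A :: "nat \<Rightarrow> 'a set"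
    assume A: "range A \<subseteq> sets (variation M \<mu>)" "disjoint_family A"
    then show "(\<Sum>i. emeasure (pos_part M \<mu>) (A i) + emeasure (neg_part M \<mu>) (A i)) =
        emeasure (pos_part M \<mu>) (\<Union>i. A i) + emeasure (neg_part M \<mu>) (\<Union>i. A i)"
      by (subst suminf_add[symmetric]) (auto intro!: arg_cong2[of _ _ _ _ "(+)"] suminf_emeasure)
  qed
qed (use assms sets.space_closed in \<open>auto simp: positive_def\<close>)

text \<open>Complementation inside \<open>A\<close> exchanges the two suprema: a large value on
  \<open>B\<close> is a small value on \<open>A - B\<close>. This gives both inequalities without a
  Hahn decomposition; finiteness of the variation permits the subtraction.\<close>

lemma Jordan_decomposition:
  assumes \<mu>: "signed_measure M \<mu>" and fin: "emeasure (variation M \<mu>) (space M) < \<infinity>" and A: "A \<in> sets M"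
  shows "\<mu> A = measure (pos_part M \<mu>) A - measure (neg_part M \<mu>) A"
proof -
  let ?p = "emeasure (pos_part M \<mu>) A" and ?n = "emeasure (neg_part M \<mu>) A"
  have finA: "emeasure (variation M \<mu>) A < \<infinity>"
    by (rule le_less_trans[OF _ fin]) (use A in \<open>auto intro!: emeasure_mono dest: sets.sets_into_space\<close>)
  then have p: "?p < \<infinity>" and n: "?n < \<infinity>"
    by (auto simp: emeasure_variation[OF A] less_top)
  have split: "\<mu> A = \<mu> B + \<mu> (A - B)" if "B \<in> sets M" "B \<subseteq> A" for B
    using signed_measure_Un[OF \<mu>, of B "A - B"] that A by (auto simp: Un_absorb1)
  have mp: "\<mu> B \<le> enn2real ?p" if "B \<in> sets M" "B \<subseteq> A" for B
  proof -
    have "ennreal (\<mu> B) \<le> ?p" using that by (auto simp: emeasure_pos_part[OF \<mu> A] intro!: SUP_upper)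
    then have "ennreal (\<mu> B) \<le> ennreal (enn2real ?p)" using p by simp
    then show ?thesis by (subst (asm) ennreal_le_iff) auto
  qed
  have mn: "- \<mu> B \<le> enn2real ?n" if "B \<in> sets M" "B \<subseteq> A" for B
  proof -
    have "ennreal (- \<mu> B) \<le> ?n" using that by (auto simp: emeasure_neg_part[OF \<mu> A] intro!: SUP_upper)
    then have "ennreal (- \<mu> B) \<le> ennreal (enn2real ?n)" using n by simp
    then show ?thesis by (subst (asm) ennreal_le_iff) auto
  qed
  have "?p \<le> ennreal (\<mu> A + enn2real ?n)"
    unfolding emeasure_pos_part[OF \<mu> A]
  proof (rule SUP_least)
    fix B assume B: "B \<in> {B \<in> sets M. B \<subseteq> A}"
    then show "ennreal (\<mu> B) \<le> ennreal (\<mu> A + enn2real ?n)"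
      using split[of B] mn[of "A - B"] A by (intro ennreal_leI) auto
  qed
  moreover have "0 \<le> \<mu> A + enn2real ?n" using mn[of A] A by auto
  ultimately have 1: "enn2real ?p \<le> \<mu> A + enn2real ?n"
    using enn2real_mono[of ?p "ennreal (\<mu> A + enn2real ?n)"] by simp
  have "?n \<le> ennreal (enn2real ?p - \<mu> A)"
    unfolding emeasure_neg_part[OF \<mu> A]
  proof (rule SUP_least)
    fix B assume B: "B \<in> {B \<in> sets M. B \<subseteq> A}"
    then show "ennreal (- \<mu> B) \<le> ennreal (enn2real ?p - \<mu> A)"
      using split[of B] mp[of "A - B"] A by (intro ennreal_leI) auto
  qed
  moreover have "0 \<le> enn2real ?p - \<mu> A" using mp[of A] A by auto
  ultimately have 2: "enn2real ?n \<le> enn2real ?p - \<mu> A"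
    using enn2real_mono[of ?n "ennreal (enn2real ?p - \<mu> A)"] by simp
  from 1 2 show ?thesis by (simp add: measure_def)
qed

section \<open>Densities of signed measures\<close>

lemma finite_absolutely_continuous_density:
  assumes Q: "finite_measure Q" "sets Q = sets M"
    and N: "finite_measure N" "sets N = sets M" "absolutely_continuous Q N"
  shows "\<exists>g. integrable Q g \<and> (\<forall>A\<in>sets M. measure N A = (\<integral>x. indicator A x * g x \<partial>Q))"
proof -
  interpret Q: finite_measure Q by fact
  interpret N: finite_measure N by fact
  obtain g where g: "g \<in> borel_measurable Q" "density Q g = N"
    using Q.Radon_Nikodym[OF N(3)] Q N by auto
  \<comment> \<open>The total mass of \<open>N\<close> is finite, so its density is finite almost
    everywhere and may be made real-valued.\<close>
  have AE: "AE x in Q. g x \<noteq> \<infinity>"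
  proof -
    have "(\<integral>\<^sup>+x. g x \<partial>Q) = emeasure N (space Q)"
      using g emeasure_density[of g Q "space Q"] by (auto cong: nn_integral_cong)
    then have "(\<integral>\<^sup>+x. g x \<partial>Q) \<noteq> \<infinity>" using N.emeasure_finite by auto
    then show ?thesis using g nn_integral_PInf_AE by blast
  qed
  have e: "emeasure N A = (\<integral>\<^sup>+x. ennreal (indicator A x * enn2real (g x)) \<partial>Q)" if "A \<in> sets M" for A
  proof -
    have "emeasure N A = (\<integral>\<^sup>+x. g x * indicator A x \<partial>Q)"
      unfolding g(2)[symmetric] using g that Q by (intro emeasure_density) auto
    also have "\<dots> = (\<integral>\<^sup>+x. ennreal (indicator A x * enn2real (g x)) \<partial>Q)"
      by (rule nn_integral_cong_AE) (use AE in \<open>eventually_elim, auto split: split_indicator simp: less_top\<close>)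
    finally show ?thesis .
  qed
  have int: "integrable Q (\<lambda>x. enn2real (g x))"
  proof (rule integrableI_nonneg)
    have "space Q = space M" using Q(2) by (rule sets_eq_imp_space_eq)
    then have "(\<integral>\<^sup>+x. ennreal (enn2real (g x)) \<partial>Q) = emeasure N (space M)"
      by (subst e) (auto intro!: nn_integral_cong)
    then show "(\<integral>\<^sup>+x. ennreal (enn2real (g x)) \<partial>Q) < \<infinity>" using N.emeasure_finite[of "space M"] by (metis infinity_ennreal_def less_top)
  qed (use g in auto)
  moreover have "measure N A = (\<integral>x. indicator A x * enn2real (g x) \<partial>Q)" if "A \<in> sets M" for A
    unfolding measure_def e[OF that] using g that Q
    by (intro integral_eq_nn_integral[symmetric]) auto
  ultimately show ?thesis by blast
qed

text \<open>Null sets of the variation are null for both Jordan parts; their densities are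
  integrable and can be subtracted.\<close>

lemma signed_Radon_Nikodym:
  assumes \<mu>: "signed_measure M \<mu>" and fin: "emeasure (variation M \<mu>) (space M) < \<infinity>"
    and Q: "finite_measure Q" "sets Q = sets M"
    and ac: "\<And>N. N \<in> sets M \<Longrightarrow> emeasure Q N = 0 \<Longrightarrow> emeasure (variation M \<mu>) N = 0"
  shows "\<exists>g. integrable Q g \<and> (\<forall>A\<in>sets M. \<mu> A = (\<integral>x. indicator A x * g x \<partial>Q))"
proof -
  have f: "finite_measure (pos_part M \<mu>)" "finite_measure (neg_part M \<mu>)"
    using fin by (auto intro!: finite_measureI simp: emeasure_variation less_top)
  have "absolutely_continuous Q (pos_part M \<mu>)" "absolutely_continuous Q (neg_part M \<mu>)"
    using ac Q(2) by (auto simp: absolutely_continuous_def null_sets_def emeasure_variation)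
  then obtain g h where g: "integrable Q g" "\<And>A. A \<in> sets M \<Longrightarrow> measure (pos_part M \<mu>) A = (\<integral>x. indicator A x * g x \<partial>Q)"
    and h: "integrable Q h" "\<And>A. A \<in> sets M \<Longrightarrow> measure (neg_part M \<mu>) A = (\<integral>x. indicator A x * h x \<partial>Q)"
    using finite_absolutely_continuous_density[OF Q f(1)] finite_absolutely_continuous_density[OF Q f(2)] by auto
  have "\<mu> A = (\<integral>x. indicator A x * (g x - h x) \<partial>Q)" if A: "A \<in> sets M" for A
  proof -
    have "integrable Q (\<lambda>x. indicator A x * g x)" "integrable Q (\<lambda>x. indicator A x * h x)"
      using integrable_mult_indicator[OF _ g(1), of A] integrable_mult_indicator[OF _ h(1), of A] A Q(2) by auto
    then show ?thesis
      by (simp add: Jordan_decomposition[OF \<mu> fin A] g(2)[OF A] h(2)[OF A] right_diff_distrib)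
  qed
  with g(1) h(1) show ?thesis by (intro exI[of _ "\<lambda>x. g x - h x"]) auto
qed

lemma signed_measure_density:
  assumes Q: "sets Q = sets M" and g: "integrable Q g"
    and \<mu>: "\<And>A. A \<in> sets M \<Longrightarrow> \<mu> A = (\<integral>x. indicator A x * g x \<partial>Q)" "\<And>A. A \<notin> sets M \<Longrightarrow> \<mu> A = 0"
  shows "signed_measure M \<mu>"
  unfolding signed_measure_def
proof (intro conjI allI impI)
  show "\<mu> {} = 0" by (simp add: \<mu>)
  fix A :: "nat \<Rightarrow> 'a set" assume A: "range A \<subseteq> sets M \<and> disjoint_family A"
  then have Am: "A i \<in> sets M" "A i \<in> sets Q" "(\<Union>i. A i) \<in> sets M" "(\<Union>i. A i) \<in> sets Q" and disj: "disjoint_family A" for i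
    using Q by auto
  note [measurable] = borel_measurable_integrable[OF g] Am(2,4)
  have int: "integrable Q (\<lambda>x. indicator (A i) x * g x)" for i
    using integrable_mult_indicator[OF Am(2) g] by simp
  have "(\<lambda>n. \<integral>x. (\<Sum>i<n. indicator (A i) x) * g x \<partial>Q) \<longlonglongrightarrow> (\<integral>x. indicator (\<Union>i. A i) x * g x \<partial>Q)"
  proof (rule integral_dominated_convergence[where w="\<lambda>x. \<bar>g x\<bar>"])
    show "AE x in Q. (\<lambda>n. (\<Sum>i<n. indicator (A i) x) * g x) \<longlonglongrightarrow> indicator (\<Union>i. A i) x * g x"
      using indicator_sums[of A] disj
      by (intro AE_I2 tendsto_mult tendsto_const) (auto simp: sums_def disjoint_family_on_def)
    fix n
    have "(\<Sum>i<n. indicator (A i) x :: real) = indicator (\<Union>i<n. A i) x" for x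
      using disj by (intro indicator_UN_disjoint[symmetric]) (auto simp: disjoint_family_on_def)
    then show "AE x in Q. norm ((\<Sum>i<n. indicator (A i) x) * g x) \<le> \<bar>g x\<bar>"
      by (auto simp: indicator_def)
  qed (use g in auto)
  then show "(\<lambda>i. \<mu> (A i)) sums \<mu> (\<Union>i. A i)"
    unfolding sums_def \<mu>(1)[OF Am(1)] \<mu>(1)[OF Am(3)]
    by (simp only: sum_distrib_right Bochner_Integration.integral_sum[OF int])
qed (use \<mu> in auto)

text \<open>The supremum over subsets of \<open>A\<close> is attained at the part of
  \<open>A\<close> where \<open>g\<close> is positive. On the right-hand side the negative values of
  \<open>g\<close> disappear under \<open>ennreal\<close>.\<close>

lemma pos_part_density:
  assumes Q: "sets Q = sets M" and g: "integrable Q g"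
    and \<mu>: "\<And>A. A \<in> sets M \<Longrightarrow> \<mu> A = (\<integral>x. indicator A x * g x \<partial>Q)" "\<And>A. A \<notin> sets M \<Longrightarrow> \<mu> A = 0"
  shows "pos_part M \<mu> = density Q (\<lambda>x. ennreal (g x))"
proof (rule measure_eqI)
  have sm: "signed_measure M \<mu>" by (rule signed_measure_density[OF assms]) auto
  show "sets (pos_part M \<mu>) = sets (density Q (\<lambda>x. ennreal (g x)))" using Q by simp
  fix A assume "A \<in> sets (pos_part M \<mu>)"
  then have A: "A \<in> sets M" by simp
  note [measurable] = borel_measurable_integrable[OF g] Q
  have int: "integrable Q (\<lambda>x. indicator B x * f x)" if "B \<in> sets M" "integrable Q f" for B and f :: "'a \<Rightarrow> real"
    using integrable_mult_indicator[of B Q f] that Q by auto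
  define P where "P = {x \<in> space Q. 0 < g x}"
  have P: "P \<in> sets M" unfolding P_def Q[symmetric] by measurable
  have "emeasure (density Q (\<lambda>x. ennreal (g x))) A = (\<integral>\<^sup>+x. ennreal (g x) * indicator A x \<partial>Q)"
    using A Q by (intro emeasure_density) auto
  also have "\<dots> = (\<integral>\<^sup>+x. ennreal (indicator (A \<inter> P) x * g x) \<partial>Q)"
    by (rule nn_integral_cong) (auto simp: P_def ennreal_neg split: split_indicator)
  also have "\<dots> = ennreal (\<mu> (A \<inter> P))"
    using A P int[of "A \<inter> P" g] g
    by (subst nn_integral_eq_integral) (auto simp: \<mu> P_def split: split_indicator)
  also have "\<dots> = (SUP B\<in>{B\<in>sets M. B \<subseteq> A}. ennreal (\<mu> B))"
  proof (rule antisym[OF SUP_upper SUP_least])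
    fix B assume B: "B \<in> {B \<in> sets M. B \<subseteq> A}"
    then have "\<mu> B \<le> \<mu> (A \<inter> P)"
      using A P int[of "A \<inter> P" g] int[of B g] g
      by (auto simp: \<mu> P_def intro!: integral_mono split: split_indicator)
    then show "ennreal (\<mu> B) \<le> ennreal (\<mu> (A \<inter> P))" by (rule ennreal_leI)
  qed (use A P in auto)
  finally show "emeasure (pos_part M \<mu>) A = emeasure (density Q (\<lambda>x. ennreal (g x))) A"
    using emeasure_pos_part[OF sm A] by simp
qed

lemma neg_part_density:
  assumes "sets Q = sets M" "integrable Q g"
    and "\<And>A. A \<in> sets M \<Longrightarrow> \<mu> A = (\<integral>x. indicator A x * g x \<partial>Q)" "\<And>A. A \<notin> sets M \<Longrightarrow> \<mu> A = 0"
  shows "neg_part M \<mu> = density Q (\<lambda>x. ennreal (- g x))"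
  unfolding neg_part_def by (rule pos_part_density) (use assms in auto)

lemma variation_density:
  assumes Q: "sets Q = sets M" and g: "integrable Q g"
    and \<mu>: "\<And>A. A \<in> sets M \<Longrightarrow> \<mu> A = (\<integral>x. indicator A x * g x \<partial>Q)" "\<And>A. A \<notin> sets M \<Longrightarrow> \<mu> A = 0"
  shows "variation M \<mu> = density Q (\<lambda>x. ennreal \<bar>g x\<bar>)"
proof (rule measure_eqI)
  note [measurable] = borel_measurable_integrable[OF g]
  fix A assume "A \<in> sets (variation M \<mu>)"
  then have A: "A \<in> sets M" by simp
  then have [measurable]: "A \<in> sets Q" using Q by simp
  have "emeasure (variation M \<mu>) A = (\<integral>\<^sup>+x. ennreal (g x) * indicator A x \<partial>Q) + (\<integral>\<^sup>+x. ennreal (- g x) * indicator A x \<partial>Q)"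
    by (simp add: emeasure_variation[OF A] pos_part_density[OF assms] neg_part_density[OF assms] emeasure_density)
  also have "\<dots> = (\<integral>\<^sup>+x. ennreal \<bar>g x\<bar> * indicator A x \<partial>Q)"
    by (subst nn_integral_add[symmetric])
      (auto intro!: nn_integral_cong simp: abs_real_def ennreal_neg split: split_indicator)
  finally show "emeasure (variation M \<mu>) A = emeasure (density Q (\<lambda>x. ennreal \<bar>g x\<bar>)) A"
    by (simp add: emeasure_density)
qed (use Q in simp)

lemma signed_integral_density:
  assumes Q: "sets Q = sets M" and g: "integrable Q g"
    and \<mu>: "\<And>A. A \<in> sets M \<Longrightarrow> \<mu> A = (\<integral>x. indicator A x * g x \<partial>Q)" "\<And>A. A \<notin> sets M \<Longrightarrow> \<mu> A = 0"
    and f: "f \<in> borel_measurable M" "integrable Q (\<lambda>x. f x * g x)"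
  shows "signed_integral M \<mu> f = (\<integral>x. f x * g x \<partial>Q)"
proof -
  note [measurable] = borel_measurable_integrable[OF g]
  have [measurable]: "f \<in> borel_measurable Q" using f Q by (simp cong: measurable_cong_sets)
  \<comment> \<open>The densities are rewritten with \<open>max 0\<close> because
    \<open>integral_density\<close> asks for a nonnegative real density.\<close>
  have e: "pos_part M \<mu> = density Q (\<lambda>x. ennreal (max 0 (g x)))" "neg_part M \<mu> = density Q (\<lambda>x. ennreal (max 0 (- g x)))"
    using pos_part_density[OF assms(1-4)] neg_part_density[OF assms(1-4)]
    by (auto intro!: density_cong simp: max_def ennreal_neg)
  have i: "integrable Q (\<lambda>x. max 0 (g x) * f x)" "integrable Q (\<lambda>x. max 0 (- g x) * f x)"
    by (rule Bochner_Integration.integrable_bound[OF f(2)];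
        auto simp: abs_mult max_def mult_nonpos_nonneg mult.commute[of "f _"] abs_mult)+
  have "signed_integral M \<mu> f = (\<integral>x. max 0 (g x) * f x \<partial>Q) - (\<integral>x. max 0 (- g x) * f x \<partial>Q)"
    unfolding signed_integral_def e
    by (intro arg_cong2[of _ _ _ _ "(-)"]; subst integral_density) auto
  also have "\<dots> = (\<integral>x. f x * g x \<partial>Q)"
    by (subst Bochner_Integration.integral_diff[OF i, symmetric]) (auto intro!: Bochner_Integration.integral_cong simp: max_def)
  finally show ?thesis .
qed

text \<open>\<open>Q\<close> has density 1 with respect to itself. This turns domination between
  sets of probability measures into a statement about null sets.\<close>

lemma variation_finite_measure:
  assumes "finite_measure Q" "sets Q = sets M"
  shows "variation M (measure Q) = Q"
proof -
  interpret finite_measure Q by fact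
  have "variation M (measure Q) = density Q (\<lambda>x. ennreal \<bar>1\<bar>)"
    by (rule variation_density) (use assms in \<open>auto simp: measure_notin_sets\<close>)
  then show ?thesis by (simp add: density_1)
qed

lemma variation_le_bound:
  assumes \<mu>: "signed_measure M \<mu>" and A: "A \<in> sets M"
    and b: "\<And>B. B \<in> sets M \<Longrightarrow> B \<subseteq> A \<Longrightarrow> \<bar>\<mu> B\<bar> \<le> K"
  shows "emeasure (variation M \<mu>) A \<le> ennreal K + ennreal K"
  unfolding emeasure_variation[OF A] emeasure_pos_part[OF \<mu> A] emeasure_neg_part[OF \<mu> A]
  using b by (intro add_mono SUP_least ennreal_leI) (auto simp: abs_le_iff)

section \<open>The Luxemburg norm of functions\<close>

definition modular_le_1 :: "'a measure set \<Rightarrow> ('a measure \<Rightarrow> real \<Rightarrow> ennreal) \<Rightarrow> real \<Rightarrow> ('a \<Rightarrow> real) \<Rightarrow> bool" where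
  "modular_le_1 P \<Phi> l f \<longleftrightarrow> (\<forall>Q\<in>P. (\<integral>\<^sup>+x. \<Phi> Q (inverse l * \<bar>f x\<bar>) \<partial>Q) \<le> 1)"

text \<open>The norm is moved from classes to functions, where almost sure inequalities apply
  directly. The family remains a parameter because the norm of a countable subfamily is later
  compared with that of the whole family.\<close>

definition Luxemburg :: "'a measure set \<Rightarrow> ('a measure \<Rightarrow> real \<Rightarrow> ennreal) \<Rightarrow> ('a \<Rightarrow> real) \<Rightarrow> ennreal" where
  "Luxemburg P \<Phi> f = (INF l\<in>{l. 0 < l \<and> modular_le_1 P \<Phi> l f}. ennreal l)"

lemma Orlicz_norm_eq_Luxemburg: "Orlicz_norm P \<Phi> X = Luxemburg P \<Phi> (rep X)"
  by (simp add: Orlicz_norm_def Luxemburg_def modular_le_1_def SUP_le_iff)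

lemma Luxemburg_leI: "0 < l \<Longrightarrow> modular_le_1 P \<Phi> l f \<Longrightarrow> Luxemburg P \<Phi> f \<le> ennreal l"
  unfolding Luxemburg_def by (rule INF_lower) simp

lemma Luxemburg_mono_family: "P' \<subseteq> P \<Longrightarrow> Luxemburg P' \<Phi> f \<le> Luxemburg P \<Phi> f"
  unfolding Luxemburg_def modular_le_1_def by (rule INF_superset_mono) auto

lemma ennreal_le_of_forall_gt:
  assumes "\<And>l'. l < l' \<Longrightarrow> x \<le> ennreal l'" and "0 \<le> l"
  shows "x \<le> ennreal l"
proof (rule ennreal_le_epsilon)
  fix e :: real assume "0 < e"
  then show "x \<le> ennreal l + ennreal e"
    using assms(1)[of "l + e"] assms(2) by (simp add: ennreal_plus)
qed

lemma ennreal_eq_0I: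
  assumes "\<And>l. 0 < l \<Longrightarrow> x \<le> ennreal l"
  shows "x = 0"
  using ennreal_le_of_forall_gt[of 0 x] assms by simp

lemma ennreal_less_realE:
  assumes "x < \<infinity>"
  obtains l where "0 < l" "x < ennreal l"
proof -
  obtain r where "x = ennreal r" "0 \<le> r" using assms by (cases x) auto
  then show ?thesis using that[of "r + 1"] by (simp add: ennreal_less_iff)
qed

text \<open>Superlevel sets of a monotone function are intervals.\<close>

lemma mono_real_borel_measurable:
  fixes f :: "real \<Rightarrow> 'b::{linorder_topology, second_countable_topology}"
  assumes "mono f"
  shows "f \<in> borel_measurable borel"
proof (rule borel_measurableI_greater)
  fix y
  have "is_interval {x \<in> space borel. y < f x}"
    unfolding is_interval_1 using assms by (auto dest: monoD intro: less_le_trans)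
  then show "{x \<in> space borel. y < f x} \<in> sets borel"
    by (rule real_interval_borel_measurable)
qed

section \<open>The norm calculus for a family of Orlicz functions\<close>

locale orlicz_family =
  fixes M :: "'a measure" and P :: "'a measure set" and \<Phi> :: "'a measure \<Rightarrow> real \<Rightarrow> ennreal"
  assumes P_prob: "\<forall>Q\<in>P. prob_space Q \<and> sets Q = sets M"
    and Orlicz: "\<forall>Q\<in>P. Orlicz_function (\<Phi> Q)"
begin

abbreviation "N \<equiv> Luxemburg P \<Phi>"

lemma sets_P: "Q \<in> P \<Longrightarrow> sets Q = sets M"
  and space_P: "Q \<in> P \<Longrightarrow> space Q = space M"
  and prob_P: "Q \<in> P \<Longrightarrow> prob_space Q"
  using P_prob sets_eq_imp_space_eq[of Q M] by auto

lemma measurable_P: "Q \<in> P \<Longrightarrow> f \<in> borel_measurable M \<Longrightarrow> f \<in> borel_measurable Q"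
  using sets_P by (simp cong: measurable_cong_sets)

lemma Phi_mono: "Q \<in> P \<Longrightarrow> 0 \<le> x \<Longrightarrow> x \<le> y \<Longrightarrow> \<Phi> Q x \<le> \<Phi> Q y"
  using Orlicz by (auto simp: Orlicz_function_def intro: mono_onD)

lemma Phi_0: "Q \<in> P \<Longrightarrow> \<Phi> Q 0 = 0"
  using Orlicz by (auto simp: Orlicz_function_def)

lemma Phi_convex:
  "Q \<in> P \<Longrightarrow> 0 \<le> x \<Longrightarrow> 0 \<le> y \<Longrightarrow> 0 \<le> t \<Longrightarrow> t \<le> 1 \<Longrightarrow>
    \<Phi> Q (t * x + (1 - t) * y) \<le> ennreal t * \<Phi> Q x + ennreal (1 - t) * \<Phi> Q y"
  using Orlicz by (auto simp: Orlicz_function_def)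

text \<open>An Orlicz function is monotone on the nonnegative half-line; composition with
  \<open>max 0\<close> makes it monotone on the whole line, hence Borel, and keeps the values used
  here.\<close>

lemma Phi_measurable:
  assumes Q: "Q \<in> P" and f: "f \<in> borel_measurable M" and l: "0 < l"
  shows "(\<lambda>x. \<Phi> Q (inverse l * \<bar>f x\<bar>)) \<in> borel_measurable Q"
proof -
  have "mono (\<lambda>y. \<Phi> Q (max 0 y))" by (rule monoI) (auto intro!: Phi_mono[OF Q])
  then have "(\<lambda>y. \<Phi> Q (max 0 y)) \<in> borel_measurable borel" by (rule mono_real_borel_measurable)
  moreover have "(\<lambda>x. inverse l * \<bar>f x\<bar>) \<in> borel_measurable Q" using measurable_P[OF Q f] by simp
  ultimately have "(\<lambda>x. \<Phi> Q (max 0 (inverse l * \<bar>f x\<bar>))) \<in> borel_measurable Q"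
    by (rule measurable_compose_rev)
  then show ?thesis using l by (simp add: max_def)
qed

lemma modular_mono:
  assumes "modular_le_1 P \<Phi> l g" "0 < l" "l \<le> l'" "\<And>Q. Q \<in> P \<Longrightarrow> AE x in Q. \<bar>f x\<bar> \<le> \<bar>g x\<bar>"
  shows "modular_le_1 P \<Phi> l' f"
  unfolding modular_le_1_def
proof
  fix Q assume Q: "Q \<in> P"
  have "(\<integral>\<^sup>+x. \<Phi> Q (inverse l' * \<bar>f x\<bar>) \<partial>Q) \<le> (\<integral>\<^sup>+x. \<Phi> Q (inverse l * \<bar>g x\<bar>) \<partial>Q)"
    by (rule nn_integral_mono_AE, use assms(4)[OF Q] in eventually_elim)
      (use assms in \<open>auto intro!: Phi_mono[OF Q] mult_mono\<close>)
  also have "\<dots> \<le> 1" using assms Q by (auto simp: modular_le_1_def)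
  finally show "(\<integral>\<^sup>+x. \<Phi> Q (inverse l' * \<bar>f x\<bar>) \<partial>Q) \<le> 1" .
qed

text \<open>Strict majorants avoid the question whether the infimum is attained: some admissible
  level lies below \<open>l\<close>, and admissibility is inherited upwards. This is why norm
  estimates are mostly strict.\<close>

lemma N_lessD:
  assumes "N f < ennreal l"
  shows "modular_le_1 P \<Phi> l f"
proof -
  obtain l' where l': "0 < l'" "modular_le_1 P \<Phi> l' f" "ennreal l' < ennreal l"
    using assms unfolding Luxemburg_def INF_less_iff by blast
  have "l' \<le> l" using l'(1,3) by (simp add: ennreal_less_iff)
  from modular_mono[OF l'(2,1) this] show ?thesis by simp
qed

lemma N_mono:
  assumes "\<And>Q. Q \<in> P \<Longrightarrow> AE x in Q. \<bar>f x\<bar> \<le> \<bar>g x\<bar>"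
  shows "N f \<le> N g"
  unfolding Luxemburg_def
  by (rule INF_superset_mono) (auto intro: modular_mono assms)

lemma N_cong:
  assumes "\<And>Q. Q \<in> P \<Longrightarrow> AE x in Q. f x = g x"
  shows "N f = N g"
  by (intro antisym N_mono; drule assms; auto elim: eventually_mono)

lemma N_eq_0:
  assumes "\<And>Q. Q \<in> P \<Longrightarrow> AE x in Q. f x = 0"
  shows "N f = 0"
proof -
  have "modular_le_1 P \<Phi> l (\<lambda>x. 0)" for l by (simp add: modular_le_1_def Phi_0)
  then have "N (\<lambda>x. 0) \<le> ennreal l" if "0 < l" for l using that by (intro Luxemburg_leI)
  then have "N (\<lambda>x. 0) = 0" by (rule ennreal_eq_0I)
  with N_cong[of f "\<lambda>x. 0"] assms show ?thesis by simp
qed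

text \<open>A real majorant \<open>l\<close> in place of the norm itself keeps the arithmetic in the
  reals.\<close>

lemma N_scale:
  assumes "N f < ennreal l" "0 < l"
  shows "N (\<lambda>x. c * f x) \<le> ennreal (\<bar>c\<bar> * l)"
proof (cases "c = 0")
  case True
  then show ?thesis by (simp add: N_eq_0)
next
  case False
  have "modular_le_1 P \<Phi> (\<bar>c\<bar> * l) (\<lambda>x. c * f x)"
    using N_lessD[OF assms(1)] False by (simp add: modular_le_1_def abs_mult field_simps)
  with False assms(2) show ?thesis by (intro Luxemburg_leI) auto
qed

text \<open>The classical convexity argument: \<open>|f + g| / (l + k)\<close> is at most the
  combination of \<open>|f| / l\<close> and \<open>|g| / k\<close> with weights
  \<open>l / (l + k)\<close> and \<open>k / (l + k)\<close>.\<close>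

lemma N_add:
  assumes f: "f \<in> borel_measurable M" and g: "g \<in> borel_measurable M"
    and l: "N f < ennreal l" "0 < l" and k: "N g < ennreal k" "0 < k"
  shows "N (\<lambda>x. f x + g x) \<le> ennreal (l + k)"
proof (rule Luxemburg_leI)
  show "modular_le_1 P \<Phi> (l + k) (\<lambda>x. f x + g x)"
    unfolding modular_le_1_def
  proof
    fix Q assume Q: "Q \<in> P"
    define t where "t = l / (l + k)"
    have t: "0 \<le> t" "t \<le> 1" "1 - t = k / (l + k)" using l k by (auto simp: t_def field_simps)
    have "(\<integral>\<^sup>+x. \<Phi> Q (inverse (l + k) * \<bar>f x + g x\<bar>) \<partial>Q)
      \<le> (\<integral>\<^sup>+x. ennreal t * \<Phi> Q (inverse l * \<bar>f x\<bar>) + ennreal (1 - t) * \<Phi> Q (inverse k * \<bar>g x\<bar>) \<partial>Q)"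
    proof (rule nn_integral_mono)
      fix x
      have "inverse (l + k) * \<bar>f x + g x\<bar> \<le> inverse (l + k) * (\<bar>f x\<bar> + \<bar>g x\<bar>)"
        using l k by (intro mult_left_mono) auto
      also have "\<dots> = t * (inverse l * \<bar>f x\<bar>) + (1 - t) * (inverse k * \<bar>g x\<bar>)"
      proof -
        have "t * (inverse l * \<bar>f x\<bar>) = inverse (l + k) * \<bar>f x\<bar>" using l(2) by (simp add: t_def divide_inverse)
        moreover have "(1 - t) * (inverse k * \<bar>g x\<bar>) = inverse (l + k) * \<bar>g x\<bar>"
          unfolding t(3) using k(2) by (simp add: divide_inverse)
        ultimately show ?thesis by (simp only: distrib_left)
      qed
      finally have "\<Phi> Q (inverse (l + k) * \<bar>f x + g x\<bar>) \<le> \<Phi> Q (t * (inverse l * \<bar>f x\<bar>) + (1 - t) * (inverse k * \<bar>g x\<bar>))"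
        using l k by (intro Phi_mono[OF Q]) auto
      also have "\<dots> \<le> ennreal t * \<Phi> Q (inverse l * \<bar>f x\<bar>) + ennreal (1 - t) * \<Phi> Q (inverse k * \<bar>g x\<bar>)"
        using l k t by (intro Phi_convex[OF Q]) auto
      finally show "\<Phi> Q (inverse (l + k) * \<bar>f x + g x\<bar>)
        \<le> ennreal t * \<Phi> Q (inverse l * \<bar>f x\<bar>) + ennreal (1 - t) * \<Phi> Q (inverse k * \<bar>g x\<bar>)" .
    qed
    also have "\<dots> = ennreal t * (\<integral>\<^sup>+x. \<Phi> Q (inverse l * \<bar>f x\<bar>) \<partial>Q) + ennreal (1 - t) * (\<integral>\<^sup>+x. \<Phi> Q (inverse k * \<bar>g x\<bar>) \<partial>Q)"
      using Phi_measurable[OF Q f l(2)] Phi_measurable[OF Q g k(2)]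
      by (subst nn_integral_add) (auto simp: nn_integral_cmult)
    also have "\<dots> \<le> ennreal t * 1 + ennreal (1 - t) * 1"
      using N_lessD[OF l(1)] N_lessD[OF k(1)] Q
      by (intro add_mono mult_left_mono) (auto simp: modular_le_1_def)
    also have "\<dots> = 1" using t by (simp add: ennreal_plus[symmetric] del: ennreal_plus)
    finally show "(\<integral>\<^sup>+x. \<Phi> Q (inverse (l + k) * \<bar>f x + g x\<bar>) \<partial>Q) \<le> 1" .
  qed
qed (use l k in simp)

lemma N_triangle:
  assumes f: "f \<in> borel_measurable M" and g: "g \<in> borel_measurable M"
  shows "N (\<lambda>x. f x + g x) \<le> N f + N g"
proof (cases "N f < \<infinity> \<and> N g < \<infinity>")
  case True
  then obtain a b where ab: "N f = ennreal a" "0 \<le> a" "N g = ennreal b" "0 \<le> b"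
    by (cases "N f"; cases "N g") auto
  have "N (\<lambda>x. f x + g x) \<le> ennreal (a + b)"
  proof (rule ennreal_le_of_forall_gt)
    fix l' assume l': "a + b < l'"
    define e where "e = (l' - (a + b)) / 2"
    have e: "0 < e" "l' = (a + e) + (b + e)" using l' by (auto simp: e_def)
    show "N (\<lambda>x. f x + g x) \<le> ennreal l'"
      unfolding e(2) using ab e by (intro N_add[OF f g]) (auto simp: ennreal_less_iff)
  qed (use ab in simp)
  then show ?thesis using ab by simp
qed (auto simp: not_less top_unique)

text \<open>Monotone convergence makes the norm lower semicontinuous along an exhaustion of the space.\<close>

lemma N_exhaustion:
  assumes f: "f \<in> borel_measurable M" and A: "\<And>n::nat. A n \<in> sets M" "incseq A" "(\<Union>n. A n) = space M"
    and l: "\<And>n. N (\<lambda>x. f x * indicator (A n) x) < ennreal l" "0 < l"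
  shows "N f \<le> ennreal l"
proof (rule Luxemburg_leI[OF l(2)])
  show "modular_le_1 P \<Phi> l f"
    unfolding modular_le_1_def
  proof
    fix Q assume Q: "Q \<in> P"
    let ?g = "\<lambda>n x. \<Phi> Q (inverse l * \<bar>f x * indicator (A n) x\<bar>)"
    have inc: "incseq ?g"
    proof (rule incseq_SucI, rule le_funI)
      fix n x
      show "?g n x \<le> ?g (Suc n) x"
        using incseq_SucD[OF A(2), of n] l(2) by (auto intro!: Phi_mono[OF Q] split: split_indicator)
    qed
    have "(\<integral>\<^sup>+x. \<Phi> Q (inverse l * \<bar>f x\<bar>) \<partial>Q) \<le> (\<integral>\<^sup>+x. (SUP n. ?g n x) \<partial>Q)"
    proof (rule nn_integral_mono)
      fix x assume "x \<in> space Q"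
      then obtain n where "x \<in> A n" using A(3) space_P[OF Q] by auto
      then show "\<Phi> Q (inverse l * \<bar>f x\<bar>) \<le> (SUP n. ?g n x)" by (intro SUP_upper2[of n]) auto
    qed
    also have "\<dots> = (SUP n. \<integral>\<^sup>+x. ?g n x \<partial>Q)"
      using f A(1) l(2) by (intro nn_integral_monotone_convergence_SUP[OF inc] Phi_measurable[OF Q]) auto
    also have "\<dots> \<le> 1"
      using N_lessD[OF l(1)] Q by (auto intro!: SUP_least simp: modular_le_1_def)
    finally show "(\<integral>\<^sup>+x. \<Phi> Q (inverse l * \<bar>f x\<bar>) \<partial>Q) \<le> 1" .
  qed
qed

text \<open>Convexity and the value 0 at 0 give \<open>\<Phi> Q x \<le> t * \<Phi> Q (x / t)\<close>
  for \<open>t\<close> in (0, 1]. Norm 0 makes every level admissible, so the modular at level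
  \<open>t / x\<close> is at most 1 and \<open>\<Phi> Q x * emeasure Q A \<le> t\<close>. Letting
  \<open>t\<close> tend to 0 with \<open>\<Phi> Q x\<close> positive yields the claim.\<close>

lemma N_indicator_eq_0D:
  assumes A: "A \<in> sets M" and 0: "N (indicator A) = 0" and Q: "Q \<in> P"
  shows "emeasure Q A = 0"
proof -
  obtain x where x: "0 < x" "0 < \<Phi> Q x" using Orlicz Q by (auto simp: Orlicz_function_def)
  have "\<Phi> Q x * emeasure Q A \<le> ennreal l" if l: "0 < l" for l
  proof -
    define t where "t = min l 1"
    have t: "0 < t" "t \<le> 1" "t \<le> l" using l by (auto simp: t_def)
    have "\<Phi> Q (t * (x / t) + (1 - t) * 0) \<le> ennreal t * \<Phi> Q (x / t) + ennreal (1 - t) * \<Phi> Q 0"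
      using t x by (intro Phi_convex[OF Q]) auto
    then have c: "\<Phi> Q x \<le> ennreal t * \<Phi> Q (x / t)" using t by (simp add: Phi_0[OF Q])
    have "N (indicator A) < ennreal (t / x)" using 0 t x by simp
    then have "(\<integral>\<^sup>+y. \<Phi> Q (inverse (t / x) * \<bar>indicator A y\<bar>) \<partial>Q) \<le> 1"
      using N_lessD[unfolded modular_le_1_def] Q by blast
    also have "(\<integral>\<^sup>+y. \<Phi> Q (inverse (t / x) * \<bar>indicator A y\<bar>) \<partial>Q) = (\<integral>\<^sup>+y. \<Phi> Q (x / t) * indicator A y \<partial>Q)"
      by (rule nn_integral_cong) (auto simp: Phi_0[OF Q] split: split_indicator)
    also have "\<dots> = \<Phi> Q (x / t) * emeasure Q A"
      using A sets_P[OF Q] by (simp add: nn_integral_cmult_indicator)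
    finally have "\<Phi> Q (x / t) * emeasure Q A \<le> 1" .
    then have "ennreal t * (\<Phi> Q (x / t) * emeasure Q A) \<le> ennreal t" using mult_left_mono[of _ 1 "ennreal t"] by simp
    moreover have "\<Phi> Q x * emeasure Q A \<le> ennreal t * (\<Phi> Q (x / t) * emeasure Q A)"
      using mult_right_mono[OF c] by (simp add: mult.assoc)
    ultimately show ?thesis using t by (meson ennreal_leI order_trans)
  qed
  then have "\<Phi> Q x * emeasure Q A = 0" by (rule ennreal_eq_0I)
  then show ?thesis using x by auto
qed

text \<open>Each positive rational level that is not admissible for the whole family is refuted by a
  single measure; one such measure per rational gives a countable subfamily. A level
  \<open>l\<close> admissible for it has no refuted rational above it, so the norm for the whole
  family is at most \<open>l\<close>.\<close>

lemma countable_norming_subfamily: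
  "\<exists>P'\<subseteq>P. countable P' \<and> Luxemburg P' \<Phi> f = N f"
proof -
  define B where "B = {q::rat. 0 < q \<and> \<not> modular_le_1 P \<Phi> (of_rat q) f}"
  have "\<exists>Q\<in>P. \<not> (\<integral>\<^sup>+x. \<Phi> Q (inverse (of_rat q) * \<bar>f x\<bar>) \<partial>Q) \<le> 1" if "q \<in> B" for q
    using that by (auto simp: B_def modular_le_1_def)
  then obtain W where W: "\<And>q. q \<in> B \<Longrightarrow> W q \<in> P"
    "\<And>q. q \<in> B \<Longrightarrow> \<not> (\<integral>\<^sup>+x. \<Phi> (W q) (inverse (of_rat q) * \<bar>f x\<bar>) \<partial>W q) \<le> 1"
    by metis
  have "N f \<le> Luxemburg (W ` B) \<Phi> f"
    unfolding Luxemburg_def[of "W ` B"]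
  proof (rule INF_greatest)
    fix l assume "l \<in> {l. 0 < l \<and> modular_le_1 (W ` B) \<Phi> l f}"
    then have l: "0 < l" "modular_le_1 (W ` B) \<Phi> l f" by auto
    show "N f \<le> ennreal l"
    proof (rule ennreal_le_of_forall_gt)
      fix l' assume "l < l'"
      then obtain q where q: "l < of_rat q" "of_rat q < l'" using of_rat_dense by blast
      have "0 < q" using l(1) q(1) by (metis order_less_trans zero_less_of_rat_iff)
      have "q \<notin> B"
      proof
        assume qB: "q \<in> B"
        interpret W: orlicz_family M "W ` B" \<Phi>
          using P_prob Orlicz W(1) by unfold_locales auto
        have "modular_le_1 (W ` B) \<Phi> (of_rat q) f"
          using W.modular_mono[OF l(2,1), of "of_rat q" f] q(1) by simp
        then show False using W(2)[OF qB] qB by (auto simp: modular_le_1_def)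
      qed
      with \<open>0 < q\<close> have "modular_le_1 P \<Phi> (of_rat q) f" by (simp add: B_def)
      then have "N f \<le> ennreal (of_rat q)" using \<open>0 < q\<close> by (intro Luxemburg_leI) auto
      then show "N f \<le> ennreal l'" using q(2) by (meson ennreal_leI less_imp_le order_trans)
    qed (use l in simp)
  qed
  moreover have "W ` B \<subseteq> P" using W(1) by auto
  ultimately show ?thesis
    by (intro exI[of _ "W ` B"]) (auto intro!: antisym Luxemburg_mono_family)
qed

end

section \<open>Equivalence classes and their representatives\<close>

lemma qs_class_cong:
  assumes "\<And>Q. Q \<in> P \<Longrightarrow> AE x in Q. f x = g x"
  shows "qs_class M P f = qs_class M P g"
  unfolding qs_class_def
proof (intro Collect_cong conj_cong refl ball_cong)
  fix h Q assume "Q \<in> P"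
  from assms[OF this] show "(AE x in Q. f x = h x) \<longleftrightarrow> (AE x in Q. g x = h x)"
    by (rule eventually_cong) auto
qed

lemma self_mem_qs_class: "f \<in> borel_measurable M \<Longrightarrow> f \<in> qs_class M P f"
  by (simp add: qs_class_def)

lemma qs_classD:
  "g \<in> qs_class M P f \<Longrightarrow> g \<in> borel_measurable M"
  "g \<in> qs_class M P f \<Longrightarrow> Q \<in> P \<Longrightarrow> AE x in Q. f x = g x"
  by (auto simp: qs_class_def)

lemma rep_qs_class:
  assumes "f \<in> borel_measurable M"
  shows "rep (qs_class M P f) \<in> qs_class M P f"
  unfolding rep_def using self_mem_qs_class[OF assms] by (rule someI[where P="\<lambda>f'. f' \<in> _"])

lemma rep_qs_class_measurable: "f \<in> borel_measurable M \<Longrightarrow> rep (qs_class M P f) \<in> borel_measurable M"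
  and rep_qs_class_AE: "f \<in> borel_measurable M \<Longrightarrow> Q \<in> P \<Longrightarrow> AE x in Q. rep (qs_class M P f) x = f x"
  using rep_qs_class[of f M P] by (auto simp: qs_class_def elim: eventually_mono)

lemma qs_class_eq_iff:
  assumes "f \<in> borel_measurable M" "g \<in> borel_measurable M"
  shows "qs_class M P f = qs_class M P g \<longleftrightarrow> (\<forall>Q\<in>P. AE x in Q. f x = g x)"
  using qs_class_cong[of P f g M] self_mem_qs_class[OF assms(2), of P] qs_classD(2)[of g M P f] by auto

lemma L0E:
  assumes "X \<in> L0 M P"
  obtains f where "f \<in> borel_measurable M" "X = qs_class M P f"
  using assms by (auto simp: L0_def)

lemma qs_class_in_L0: "f \<in> borel_measurable M \<Longrightarrow> qs_class M P f \<in> L0 M P"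
  by (auto simp: L0_def)

lemma qs_class_of_mem:
  assumes "X \<in> L0 M P" "f \<in> X"
  shows "f \<in> borel_measurable M" "X = qs_class M P f"
  using assms by (auto elim!: L0E dest: qs_classD intro!: qs_class_cong)

lemma qs_class_rep:
  assumes "X \<in> L0 M P"
  shows "rep X \<in> borel_measurable M" "qs_class M P (rep X) = X"
  using assms by (auto elim!: L0E intro!: rep_qs_class_measurable qs_class_cong rep_qs_class_AE)

text \<open>The choice made by \<open>rep\<close> is immaterial, so operations on classes may be
  computed on any measurable representative.\<close>

lemma qs_map_class:
  assumes "f \<in> borel_measurable M"
  shows "qs_map M P h (qs_class M P f) = qs_class M P (\<lambda>x. h (f x))"
  unfolding qs_map_def
proof (rule qs_class_cong)
  fix Q assume "Q \<in> P"
  from rep_qs_class_AE[OF assms this] show "AE x in Q. h (rep (qs_class M P f) x) = h (f x)"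
    by eventually_elim simp
qed

lemma qs_map2_class:
  assumes "f \<in> borel_measurable M" "g \<in> borel_measurable M"
  shows "qs_map2 M P h (qs_class M P f) (qs_class M P g) = qs_class M P (\<lambda>x. h (f x) (g x))"
  unfolding qs_map2_def
proof (rule qs_class_cong)
  fix Q assume Q: "Q \<in> P"
  from rep_qs_class_AE[OF assms(1) Q] rep_qs_class_AE[OF assms(2) Q]
  show "AE x in Q. h (rep (qs_class M P f) x) (rep (qs_class M P g) x) = h (f x) (g x)"
    by eventually_elim simp
qed

lemma qs_le_class:
  assumes "f \<in> borel_measurable M" "g \<in> borel_measurable M"
  shows "qs_le P (qs_class M P f) (qs_class M P g) \<longleftrightarrow> (\<forall>Q\<in>P. AE x in Q. f x \<le> g x)"
proof
  assume "\<forall>Q\<in>P. AE x in Q. f x \<le> g x"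
  then have fg: "AE x in Q. f x \<le> g x" if "Q \<in> P" for Q using that by auto
  show "qs_le P (qs_class M P f) (qs_class M P g)"
    unfolding qs_le_def
  proof (intro ballI)
    fix f' g' Q assume *: "f' \<in> qs_class M P f" "g' \<in> qs_class M P g" "Q \<in> P"
    from fg[OF *(3)] qs_classD(2)[OF *(1,3)] qs_classD(2)[OF *(2,3)]
    show "AE x in Q. f' x \<le> g' x" by eventually_elim simp
  qed
qed (use assms in \<open>auto simp: qs_le_def intro: self_mem_qs_class\<close>)

context orlicz_family
begin

abbreviation "cls \<equiv> qs_class M P"

lemma Orlicz_norm_class:
  assumes "f \<in> borel_measurable M"
  shows "Orlicz_norm P \<Phi> (cls f) = N f"
  unfolding Orlicz_norm_eq_Luxemburg by (rule N_cong, rule rep_qs_class_AE[OF assms])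

lemma class_in_LPhi_iff: "f \<in> borel_measurable M \<Longrightarrow> cls f \<in> LPhi M P \<Phi> \<longleftrightarrow> N f < \<infinity>"
  by (simp add: LPhi_def qs_class_in_L0 Orlicz_norm_class)

lemma LPhiE:
  assumes "X \<in> LPhi M P \<Phi>"
  obtains f where "f \<in> borel_measurable M" "X = cls f" "N f < \<infinity>"
proof -
  obtain f where "f \<in> borel_measurable M" "X = cls f"
    using assms by (auto simp: LPhi_def elim: L0E)
  with assms that class_in_LPhi_iff show thesis by blast
qed

lemma Orlicz_norm_diff_class:
  "f \<in> borel_measurable M \<Longrightarrow> g \<in> borel_measurable M \<Longrightarrow>
    Orlicz_norm P \<Phi> (qs_diff M P (cls f) (cls g)) = N (\<lambda>x. f x - g x)"
  by (simp add: qs_map2_class Orlicz_norm_class)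

lemma N_scale_finite: "N f < \<infinity> \<Longrightarrow> N (\<lambda>x. c * f x) < \<infinity>"
  by (metis N_scale ennreal_less_realE ennreal_less_top infinity_ennreal_def order_le_less_trans)

lemma N_add_finite:
  "f \<in> borel_measurable M \<Longrightarrow> g \<in> borel_measurable M \<Longrightarrow> N f < \<infinity> \<Longrightarrow> N g < \<infinity> \<Longrightarrow> N (\<lambda>x. f x + g x) < \<infinity>"
  using N_triangle[of f g] by (auto simp: less_top[symmetric] top_unique)

lemma N_minus_commute: "N (\<lambda>x. f x - g x) = N (\<lambda>x. g x - f x)"
  by (intro antisym N_mono) (auto simp: abs_minus_commute)

lemma N_diff_triangle:
  assumes "f \<in> borel_measurable M" "g \<in> borel_measurable M" "h \<in> borel_measurable M"
  shows "N (\<lambda>x. f x - h x) \<le> N (\<lambda>x. f x - g x) + N (\<lambda>x. g x - h x)"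
  using N_triangle[of "\<lambda>x. f x - g x" "\<lambda>x. g x - h x"] assms by simp

end

section \<open>Separable closed ideals containing the constants\<close>

text \<open>Isolates what is used of the closed option space. The countable set \<open>D\<close> in
  \<open>separable\<close> consists of measurable functions approximating the representatives of
  \<open>C\<close>; in the application they are rational option combinations.\<close>

locale orlicz_ideal = orlicz_family M P \<Phi> for M :: "'a measure" and P \<Phi> +
  fixes C :: "'a rclass set"
  assumes ideal: "is_ideal M P (LPhi M P \<Phi>) C"
    and one: "cls (\<lambda>x. 1) \<in> C"
    and closed: "Orlicz_closure M P \<Phi> C \<subseteq> C"
    and separable: "\<exists>D. countable D \<and> D \<subseteq> borel_measurable M
       \<and> (\<forall>f\<in>borel_measurable M. cls f \<in> C \<longrightarrow> (\<forall>e>0. \<exists>d\<in>D. N (\<lambda>x. f x - d x) < ennreal e))"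
begin

definition CF :: "('a \<Rightarrow> real) set" where
  "CF = {f \<in> borel_measurable M. cls f \<in> C}"

lemma CF_measurable [measurable_dest]: "f \<in> CF \<Longrightarrow> f \<in> borel_measurable M"
  by (simp add: CF_def)

lemma class_CF: "f \<in> CF \<Longrightarrow> cls f \<in> C"
  by (simp add: CF_def)

lemma C_subset_LPhi: "C \<subseteq> LPhi M P \<Phi>"
  using ideal by (simp add: is_ideal_def)

lemma C_subset_L0: "C \<subseteq> L0 M P"
  using C_subset_LPhi by (auto simp: LPhi_def)

lemma mem_CE:
  assumes "Y \<in> C"
  obtains f where "f \<in> CF" "Y = cls f"
  using assms C_subset_L0 that by (auto simp: CF_def elim!: L0E)

lemma mem_class_in_CF: "Y \<in> C \<Longrightarrow> f \<in> Y \<Longrightarrow> f \<in> CF"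
  using C_subset_L0 qs_class_of_mem[of Y M P f] by (auto simp: CF_def)

lemma rep_in_CF: "Y \<in> C \<Longrightarrow> rep Y \<in> CF"
  using C_subset_L0 qs_class_rep[of Y M P] by (auto simp: CF_def)

lemma CF_finite: "f \<in> CF \<Longrightarrow> N f < \<infinity>"
  using C_subset_LPhi class_in_LPhi_iff by (auto simp: CF_def)

lemma CF_add: "f \<in> CF \<Longrightarrow> g \<in> CF \<Longrightarrow> (\<lambda>x. f x + g x) \<in> CF"
  using ideal by (auto simp: CF_def is_ideal_def qs_subspace_def qs_map2_class[symmetric])

lemma CF_scale: "f \<in> CF \<Longrightarrow> (\<lambda>x. c * f x) \<in> CF"
  using ideal by (auto simp: CF_def is_ideal_def qs_subspace_def qs_map_class[where h="(*) c", symmetric])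

lemma CF_solid:
  assumes f: "f \<in> borel_measurable M" and g: "g \<in> CF" and le: "\<And>Q. Q \<in> P \<Longrightarrow> AE x in Q. \<bar>f x\<bar> \<le> \<bar>g x\<bar>"
  shows "f \<in> CF"
proof -
  have "N f \<le> N g" by (rule N_mono) (rule le)
  then have "cls f \<in> LPhi M P \<Phi>"
    using CF_finite[OF g] by (simp add: class_in_LPhi_iff[OF f])
  moreover have "qs_le P (qs_abs M P (cls f)) (qs_abs M P (cls g))"
    using le f CF_measurable[OF g] by (auto simp: qs_map_class intro!: qs_le_class[THEN iffD2])
  ultimately show ?thesis
    using ideal f g by (auto simp: CF_def is_ideal_def)
qed

lemma CF_const: "(\<lambda>x. c) \<in> CF"
  using CF_scale[of "\<lambda>x. 1" c] one by (simp add: CF_def)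

lemma CF_bounded:
  assumes "f \<in> borel_measurable M" "\<And>x. x \<in> space M \<Longrightarrow> \<bar>f x\<bar> \<le> c"
  shows "f \<in> CF"
proof (rule CF_solid[OF assms(1) CF_const[of c]])
  fix Q assume "Q \<in> P"
  then show "AE x in Q. \<bar>f x\<bar> \<le> \<bar>c\<bar>"
    using assms(2) space_P by (intro AE_I2) (auto intro: order_trans[OF _ abs_ge_self])
qed

lemma CF_indicator: "A \<in> sets M \<Longrightarrow> indicator A \<in> CF"
  by (rule CF_bounded[of _ 1]) (auto simp: indicator_def)

lemma CF_diff: "f \<in> CF \<Longrightarrow> g \<in> CF \<Longrightarrow> (\<lambda>x. f x - g x) \<in> CF"
  using CF_add[of f "\<lambda>x. - g x"] CF_scale[of g "-1"] by simp

text \<open>A failure of order continuity yields disjoint sets \<open>B k\<close> on which \<open>w\<close> has norm bounded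
  below; against a countable dense family one then selects, by diagonalisation, a union of
  some of the \<open>B k\<close> such that the restriction of \<open>w\<close> to it stays away from the whole family.\<close>

lemma order_continuous:
  assumes w: "w \<in> CF" and A: "\<And>n::nat. A n \<in> sets M" "decseq A" "(\<Inter>n. A n) = {}" and e: "0 < e"
  shows "\<exists>n. N (\<lambda>x. w x * indicator (A n) x) < ennreal e"
proof (rule ccontr)
  assume "\<not> ?thesis"
  then have big: "ennreal e \<le> N (\<lambda>x. w x * indicator (A n) x)" for n by (simp add: not_less)
  note [measurable] = CF_measurable[OF w] A(1)
  \<comment> \<open>The sets \<open>A n - A m\<close> exhaust \<open>A n\<close> as \<open>m\<close>
    grows. Norms below \<open>e / 2\<close> on all of them would bound the norm on
    \<open>A n\<close> by \<open>e / 2\<close>, by lower semicontinuity along an exhaustion.\<close>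
  have "\<exists>m>n. ennreal (e / 2) \<le> N (\<lambda>x. w x * indicator (A n - A m) x)" for n
  proof (rule ccontr)
    assume "\<not> ?thesis"
    then have small: "N (\<lambda>x. w x * indicator (A n - A m) x) < ennreal (e / 2)" if "m > n" for m
      using that by (auto simp: not_le)
    have "N (\<lambda>x. w x * indicator (A n) x) \<le> ennreal (e / 2)"
    proof (rule N_exhaustion)
      show "incseq (\<lambda>k. space M - A (Suc (n + k)))"
        using decseq_SucD[OF A(2)] by (intro incseq_SucI) auto
      have "x \<in> (\<Union>k. space M - A (Suc (n + k)))" if x: "x \<in> space M" for x
      proof -
        obtain j where "x \<notin> A j" using A(3) by auto
        then have "x \<notin> A (Suc (n + j))" using decseqD[OF A(2), of j "Suc (n + j)"] by auto
        with x show ?thesis by auto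
      qed
      then show "(\<Union>k. space M - A (Suc (n + k))) = space M" by blast
      fix k
      have "(\<lambda>x. w x * indicator (A n) x * indicator (space M - A (Suc (n + k))) x)
          = (\<lambda>x. w x * indicator (A n - A (Suc (n + k))) x)"
        using sets.sets_into_space[OF A(1)] by (auto simp: fun_eq_iff split: split_indicator)
      then show "N (\<lambda>x. w x * indicator (A n) x * indicator (space M - A (Suc (n + k))) x) < ennreal (e / 2)"
        using small[of "Suc (n + k)"] by simp
    qed (use e in auto)
    also have "\<dots> < ennreal e" using e by (simp add: ennreal_less_iff)
    finally show False using big[of n] by simp
  qed
  then obtain s where s: "\<And>n. n < s n" "\<And>n. ennreal (e / 2) \<le> N (\<lambda>x. w x * indicator (A n - A (s n)) x)"
    by metis
  define r where "r k = (s ^^ k) 0" for k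
  define B where "B k = A (r k) - A (r (Suc k))" for k
  have B_meas [measurable]: "B k \<in> sets M" for k unfolding B_def by measurable
  have "strict_mono r" unfolding strict_mono_Suc_iff by (simp add: r_def s(1))
  then have r: "j < k \<Longrightarrow> r (Suc j) \<le> r k" for j k by (simp add: strict_mono_less_eq)
  have lower: "ennreal (e / 2) \<le> N (\<lambda>x. w x * indicator (B k) x)" for k
    using s(2)[of "r k"] by (simp add: B_def r_def)
  have disj: "j = k" if "x \<in> B j" "x \<in> B k" for x j k
    using that r[of j k] r[of k j] decseqD[OF A(2)] unfolding B_def
    by (metis DiffE in_mono linorder_neqE_nat)
  obtain D where D: "countable D" "D \<subseteq> borel_measurable M"
    "\<And>f e. f \<in> CF \<Longrightarrow> 0 < e \<Longrightarrow> \<exists>d\<in>D. N (\<lambda>x. f x - d x) < ennreal e"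
    using separable by (auto simp: CF_def)
  then have "D \<noteq> {}" using D(3)[OF w e] by auto
  define d where "d = from_nat_into D"
  have d: "range d = D" unfolding d_def using \<open>D \<noteq> {}\<close> D(1) by (rule range_from_nat_into)
  have dm [measurable]: "d k \<in> borel_measurable M" for k using d D(2) by auto
  \<comment> \<open>On \<open>B k\<close> the function \<open>d k\<close> cannot be within
    \<open>e / 4\<close> of both 0 and \<open>w\<close>, as \<open>w\<close> has norm at least
    \<open>e / 2\<close> there. The bit \<open>b k\<close> records a choice that \<open>d k\<close>
    misses.\<close>
  have "\<exists>b::bool. ennreal (e / 4) \<le> N (\<lambda>x. (d k x - of_bool b * w x) * indicator (B k) x)" for k
  proof (rule ccontr)
    assume "\<not> ?thesis"
    then have 0: "N (\<lambda>x. (d k x - of_bool b * w x) * indicator (B k) x) < ennreal (e / 4)" for b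
      by (auto simp: not_le)
    have "N (\<lambda>x. w x * indicator (B k) x) = N (\<lambda>x. d k x * indicator (B k) x - (d k x - w x) * indicator (B k) x)"
      by (simp add: left_diff_distrib)
    also have "\<dots> \<le> N (\<lambda>x. d k x * indicator (B k) x - 0) + N (\<lambda>x. 0 - (d k x - w x) * indicator (B k) x)"
      by (rule N_diff_triangle) auto
    also have "N (\<lambda>x. 0 - (d k x - w x) * indicator (B k) x) = N (\<lambda>x. (d k x - w x) * indicator (B k) x - 0)"
      by (rule N_minus_commute)
    also have "N (\<lambda>x. d k x * indicator (B k) x - 0) + N (\<lambda>x. (d k x - w x) * indicator (B k) x - 0) < ennreal (e / 4 + e / 4)"
      using 0[of False] 0[of True] by (intro add_mono_ennreal) auto
    finally show False using lower[of k] by simp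
  qed
  then obtain b :: "nat \<Rightarrow> bool"
    where b: "\<And>k. ennreal (e / 4) \<le> N (\<lambda>x. (d k x - of_bool (b k) * w x) * indicator (B k) x)"
    by metis
  define Z where "Z x = w x * indicator (\<Union>k\<in>{k. b k}. B k) x" for x
  have "Z \<in> CF"
  proof (rule CF_solid[OF _ w])
    show "Z \<in> borel_measurable M" unfolding Z_def by measurable
  qed (auto simp: Z_def indicator_def)
  from D(3)[OF this, of "e / 4"] e d obtain k where k: "N (\<lambda>x. Z x - d k x) < ennreal (e / 4)" by auto
  have "N (\<lambda>x. (d k x - of_bool (b k) * w x) * indicator (B k) x) \<le> N (\<lambda>x. Z x - d k x)"
  proof (rule N_mono, rule AE_I2)
    fix x
    have "Z x = of_bool (b k) * w x" if "x \<in> B k"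
      using that disj by (auto simp: Z_def indicator_def)
    then show "\<bar>(d k x - of_bool (b k) * w x) * indicator (B k) x\<bar> \<le> \<bar>Z x - d k x\<bar>"
      by (auto simp: indicator_def)
  qed
  then show False using b[of k] k by simp
qed

end

section \<open>Domination between families of probability measures\<close>

lemma ex_of_rat_near: "0 < e \<Longrightarrow> \<exists>q. \<bar>c - of_rat q\<bar> < e" for c e :: real
proof -
  assume "0 < e"
  then obtain q where "c < of_rat q" "of_rat q < c + e" using of_rat_dense[of c "c + e"] by auto
  then show ?thesis by (intro exI[of _ q]) auto
qed

text \<open>A probability measure is its own variation, and a supremum in \<open>ennreal\<close> is
  0 only if all its terms are.\<close>

lemma ca_dominated_probs_iff:
  assumes "\<And>Q. Q \<in> P \<Longrightarrow> prob_space Q \<and> sets Q = sets M" "\<And>Q. Q \<in> P' \<Longrightarrow> prob_space Q \<and> sets Q = sets M"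
  shows "ca_dominated M (measure ` P) (measure ` P') \<longleftrightarrow>
    (\<forall>A\<in>sets M. (\<forall>Q\<in>P'. emeasure Q A = 0) \<longrightarrow> (\<forall>Q\<in>P. emeasure Q A = 0))"
proof -
  have v: "variation M (measure Q) = Q" if "Q \<in> P \<or> Q \<in> P'" for Q
    using that assms by (intro variation_finite_measure) (auto dest: prob_space.finite_measure)
  have S: "(SUP \<nu>\<in>measure ` R. emeasure (variation M \<nu>) A) = 0 \<longleftrightarrow> (\<forall>Q\<in>R. emeasure Q A = 0)"
    if "R \<subseteq> P \<union> P'" for R A
  proof -
    have "(SUP \<nu>\<in>measure ` R. emeasure (variation M \<nu>) A) = 0 \<longleftrightarrow> (\<forall>Q\<in>R. emeasure (variation M (measure Q)) A = 0)"
      unfolding le_zero_eq[symmetric] SUP_le_iff by simp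
    also have "\<dots> \<longleftrightarrow> (\<forall>Q\<in>R. emeasure Q A = 0)"
      using that by (intro ball_cong refl) (auto simp: v)
    finally show ?thesis .
  qed
  show ?thesis by (simp add: ca_dominated_def S)
qed

text \<open>All geometric weights are positive, so a null set of the mixture is null for every
  component. The enumeration of \<open>P\<close> may repeat elements, which also covers finite
  families; \<open>bind\<close> supplies the mixture as a probability measure.\<close>

lemma countable_mixture:
  assumes P: "countable P" "P \<noteq> {}" "\<And>Q. Q \<in> P \<Longrightarrow> prob_space Q \<and> sets Q = sets M"
  shows "\<exists>R. prob_space R \<and> sets R = sets M \<and> (\<forall>A\<in>sets M. emeasure R A = 0 \<longrightarrow> (\<forall>Q\<in>P. emeasure Q A = 0))"
proof -
  define p where "p = measure_pmf (geometric_pmf (1 / 2))"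
  define K where "K = from_nat_into P"
  have K: "range K = P" unfolding K_def using P by (intro range_from_nat_into)
  then have KP: "prob_space (K n)" "sets (K n) = sets M" for n using P(3)[of "K n"] by auto
  have meas: "K \<in> measurable p (subprob_algebra M)"
    unfolding p_def using KP by (auto simp: space_subprob_algebra prob_space_imp_subprob_space)
  interpret p: prob_space p unfolding p_def by (rule measure_pmf.prob_space_axioms)
  have prob: "prob_space (p \<bind> K)"
    by (rule p.prob_space_bind[OF _ meas]) (simp add: KP)
  interpret R: prob_space "p \<bind> K" by fact
  have sets: "sets (p \<bind> K) = sets M"
    by (rule sets_bind[of _ _ M]) (auto simp: KP p_def)
  have "emeasure Q A = 0" if A: "A \<in> sets M" "emeasure (p \<bind> K) A = 0" and Q: "Q \<in> P" for A Q
  proof -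
    have "AE x in p \<bind> K. x \<notin> A" using A sets by (intro AE_not_in) (auto simp: null_sets_def)
    moreover have "Measurable.pred M (\<lambda>x. x \<notin> A)" using A(1) by simp
    ultimately have "AE n in p. AE x in K n. x \<notin> A" by (subst (asm) AE_bind[OF meas]) auto
    then have "AE x in K n. x \<notin> A" for n
      unfolding p_def AE_measure_pmf_iff by (simp add: set_pmf_geometric)
    then have "AE x in Q. x \<notin> A" using Q K by auto
    moreover have "A \<in> sets Q" using P(3)[OF Q] A(1) by simp
    ultimately have "A \<in> null_sets Q" using AE_iff_null_sets by blast
    then show ?thesis by auto
  qed
  with prob sets show ?thesis by blast
qed

section \<open>Truncation and domination in a separable closed ideal\<close>

context orlicz_ideal
begin

lemma closure_Linf: "Orlicz_closure M P \<Phi> (Linf M P) = C"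
proof
  have "Linf M P \<subseteq> C"
  proof
    fix Y assume "Y \<in> Linf M P"
    then obtain f c where Y: "Y \<in> L0 M P" "f \<in> Y" and c: "\<And>x. x \<in> space M \<Longrightarrow> \<bar>f x\<bar> \<le> c"
      by (auto simp: Linf_def)
    note f = qs_class_of_mem[OF Y]
    show "Y \<in> C" using CF_bounded[OF f(1) c] f(2) by (simp add: CF_def)
  qed
  then have "Orlicz_closure M P \<Phi> (Linf M P) \<subseteq> Orlicz_closure M P \<Phi> C"
    unfolding Orlicz_closure_def by blast
  with closed show "Orlicz_closure M P \<Phi> (Linf M P) \<subseteq> C" by blast
  show "C \<subseteq> Orlicz_closure M P \<Phi> (Linf M P)"
  proof
    fix Y assume Y: "Y \<in> C"
    then obtain f where f: "f \<in> CF" "Y = cls f" by (rule mem_CE)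
    note [measurable] = CF_measurable[OF f(1)]
    \<comment> \<open>\<open>f\<close> is real-valued, so the sets where it exceeds \<open>n\<close>
      in modulus decrease to the empty set.\<close>
    define A where "A n = {x \<in> space M. \<bar>f x\<bar> > real n}" for n
    have A [measurable]: "A n \<in> sets M" for n unfolding A_def by measurable
    have dec: "decseq A" by (rule decseq_SucI) (auto simp: A_def)
    have "x \<notin> A (nat \<lceil>\<bar>f x\<bar>\<rceil>)" for x by (simp add: A_def) linarith
    then have "(\<Inter>n. A n) = {}" by blast
    note small = order_continuous[OF f(1) A dec this]
    have "\<exists>Z\<in>Linf M P. Orlicz_norm P \<Phi> (qs_diff M P Y Z) < ennreal e" if e: "0 < e" for e
    proof -
      obtain n where n: "N (\<lambda>x. f x * indicator (A n) x) < ennreal e" using small[OF e] by blast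
      let ?z = "\<lambda>x. f x * indicator (space M - A n) x"
      have "cls ?z \<in> Linf M P"
        unfolding Linf_def
      proof (intro CollectI conjI bexI exI ballI)
        show "\<bar>?z x\<bar> \<le> real n" for x by (auto simp: A_def indicator_def)
        show "?z \<in> cls ?z" by (rule self_mem_qs_class) measurable
        show "cls ?z \<in> L0 M P" by (rule qs_class_in_L0) measurable
      qed
      moreover have "Orlicz_norm P \<Phi> (qs_diff M P Y (cls ?z)) = N (\<lambda>x. f x - ?z x)"
        unfolding f(2) by (rule Orlicz_norm_diff_class) auto
      moreover have "N (\<lambda>x. f x - ?z x) = N (\<lambda>x. f x * indicator (A n) x)"
        by (rule N_cong, rule AE_I2) (auto simp: space_P indicator_def)
      ultimately show ?thesis using n by (intro bexI[of _ "cls ?z"]) simp_all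
    qed
    then show "Y \<in> Orlicz_closure M P \<Phi> (Linf M P)"
      using Y C_subset_LPhi by (auto simp: Orlicz_closure_def)
  qed
qed

text \<open>A countable subfamily that norms a countable dense set norms all of \<open>C\<close>, hence detects
  every non-polar event.\<close>

lemma dominated_family:
  assumes "P \<noteq> {}"
  shows "dominated M P"
proof -
  obtain Q0 where Q0: "Q0 \<in> P" using assms by auto
  obtain D where D: "countable D" "D \<subseteq> borel_measurable M"
    "\<And>f e. f \<in> CF \<Longrightarrow> 0 < e \<Longrightarrow> \<exists>d\<in>D. N (\<lambda>x. f x - d x) < ennreal e"
    using separable by (auto simp: CF_def)
  obtain W where W: "\<And>d. W d \<subseteq> P" "\<And>d. countable (W d)" "\<And>d. Luxemburg (W d) \<Phi> d = N d"
    using countable_norming_subfamily by metis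
  \<comment> \<open>The norming subfamilies may all be empty; \<open>Q0\<close> guarantees that
    there is something to mix.\<close>
  define P' where "P' = insert Q0 (\<Union>d\<in>D. W d)"
  have P': "P' \<subseteq> P" "countable P'" "P' \<noteq> {}" using Q0 W D(1) by (auto simp: P'_def)
  interpret P': orlicz_family M P' \<Phi>
    using P_prob Orlicz P'(1) by unfold_locales auto
  have norming: "N d \<le> P'.N d" if "d \<in> D" for d
    using that W(3)[of d] by (metis Luxemburg_mono_family P'_def UN_upper subset_insertI2)
  have polar: "emeasure Q A = 0" if A: "A \<in> sets M" and null: "\<And>Q. Q \<in> P' \<Longrightarrow> emeasure Q A = 0" and Q: "Q \<in> P" for A Q
  proof (rule N_indicator_eq_0D[OF A _ Q], rule ennreal_eq_0I)
    fix e :: real assume e: "0 < e"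
    obtain d where d: "d \<in> D" "N (\<lambda>x. indicator A x - d x) < ennreal (e / 2)"
      using D(3)[OF CF_indicator[OF A], of "e / 2"] e by auto
    have dm [measurable]: "d \<in> borel_measurable M" using d D by auto
    note [measurable] = A
    have 0: "P'.N (indicator A) = 0"
    proof (rule P'.N_eq_0)
      fix R assume R: "R \<in> P'"
      then have "A \<in> null_sets R" using null A P'.sets_P by auto
      then have "AE x in R. x \<notin> A" by (rule AE_not_in)
      then show "AE x in R. indicator A x = (0::real)" by eventually_elim simp
    qed
    \<comment> \<open>\<open>d\<close> is close to the indicator in the full norm, hence in the
      smaller norm of \<open>P'\<close>, where the indicator vanishes. So \<open>d\<close> is small
      for \<open>P'\<close>, and, since \<open>P'\<close> norms \<open>D\<close>, small in the full
      norm as well.\<close>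
    have "N d \<le> P'.N d" by (rule norming[OF d(1)])
    also have "\<dots> = P'.N (\<lambda>x. 0 + d x)" by simp
    also have "\<dots> = P'.N (\<lambda>x. d x - 0)" by simp
    also have "\<dots> \<le> P'.N (\<lambda>x. d x - indicator A x) + P'.N (\<lambda>x. indicator A x - 0)"
      by (rule P'.N_diff_triangle) auto
    also have "\<dots> = P'.N (\<lambda>x. indicator A x - d x)" using 0 by (simp add: P'.N_minus_commute[of d])
    also have "\<dots> \<le> N (\<lambda>x. indicator A x - d x)" by (rule Luxemburg_mono_family[OF P'(1)])
    finally have "N d < ennreal (e / 2)" using d(2) by simp
    have "N (\<lambda>x. indicator A x - 0) \<le> N (\<lambda>x. indicator A x - d x) + N (\<lambda>x. d x - 0)"
      by (rule N_diff_triangle) auto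
    also have "\<dots> < ennreal (e / 2 + e / 2)"
      using d(2) \<open>N d < ennreal (e / 2)\<close> by (intro add_mono_ennreal) auto
    finally show "N (indicator A) \<le> ennreal e" by simp
  qed
  obtain R where R: "prob_space R" "sets R = sets M"
    "\<And>A Q. A \<in> sets M \<Longrightarrow> emeasure R A = 0 \<Longrightarrow> Q \<in> P' \<Longrightarrow> emeasure Q A = 0"
    using countable_mixture[OF P'(2,3), of M] P'.P_prob by blast
  have "\<forall>A\<in>sets M. (\<forall>Q\<in>{R}. emeasure Q A = 0) \<longrightarrow> (\<forall>Q\<in>P. emeasure Q A = 0)"
    using R(3) polar by blast
  then have "ca_dominated M (measure ` P) (measure ` {R})"
    using P_prob R(1,2) by (intro ca_dominated_probs_iff[THEN iffD2]) blast+
  with R(1,2) show ?thesis by (auto simp: dominated_def)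
qed

end

section \<open>Option spaces\<close>

context orlicz_family
begin

lemma subset_Orlicz_closure:
  assumes "A \<subseteq> LPhi M P \<Phi>"
  shows "A \<subseteq> Orlicz_closure M P \<Phi> A"
proof
  fix Y assume Y: "Y \<in> A"
  then obtain f where f: "f \<in> borel_measurable M" "Y = cls f" using assms by (auto elim: LPhiE)
  have "Orlicz_norm P \<Phi> (qs_diff M P Y Y) = 0"
    unfolding f(2) Orlicz_norm_diff_class[OF f(1) f(1)] by (simp add: N_eq_0)
  then show "Y \<in> Orlicz_closure M P \<Phi> A"
    using Y assms unfolding Orlicz_closure_def by (auto intro!: bexI[of _ Y])
qed

lemma Orlicz_closure_idem:
  assumes A: "A \<subseteq> LPhi M P \<Phi>"
  shows "Orlicz_closure M P \<Phi> (Orlicz_closure M P \<Phi> A) \<subseteq> Orlicz_closure M P \<Phi> A"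
proof
  fix Y assume Y: "Y \<in> Orlicz_closure M P \<Phi> (Orlicz_closure M P \<Phi> A)"
  then have YL: "Y \<in> LPhi M P \<Phi>" by (simp add: Orlicz_closure_def)
  then obtain f where f: "f \<in> borel_measurable M" "Y = cls f" by (rule LPhiE)
  have "\<exists>Z\<in>A. Orlicz_norm P \<Phi> (qs_diff M P Y Z) < ennreal e" if e: "0 < e" for e
  proof -
    obtain W where W: "W \<in> Orlicz_closure M P \<Phi> A" "Orlicz_norm P \<Phi> (qs_diff M P Y W) < ennreal (e / 2)"
      using Y e by (auto simp: Orlicz_closure_def dest: spec[of _ "e / 2"])
    obtain g where g: "g \<in> borel_measurable M" "W = cls g"
      using W(1) by (auto simp: Orlicz_closure_def elim: LPhiE)
    obtain Z where Z: "Z \<in> A" "Orlicz_norm P \<Phi> (qs_diff M P W Z) < ennreal (e / 2)"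
      using W(1) e by (auto simp: Orlicz_closure_def dest: spec[of _ "e / 2"])
    obtain h where h: "h \<in> borel_measurable M" "Z = cls h" using Z(1) A by (auto elim: LPhiE)
    have "N (\<lambda>x. f x - h x) \<le> N (\<lambda>x. f x - g x) + N (\<lambda>x. g x - h x)"
      by (rule N_diff_triangle[OF f(1) g(1) h(1)])
    also have "\<dots> < ennreal (e / 2 + e / 2)"
      using W(2) Z(2) f g h by (intro add_mono_ennreal) (simp_all add: Orlicz_norm_diff_class)
    finally show ?thesis using Z(1) f h by (intro bexI[of _ Z]) (simp_all add: Orlicz_norm_diff_class)
  qed
  with YL show "Y \<in> Orlicz_closure M P \<Phi> A" by (auto simp: Orlicz_closure_def)
qed

text \<open>Portfolios with rational weights and rational strikes, \<open>None\<close> standing for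
  the constant claim 1. The type of the lists is countable, so the range over all lists is a
  countable candidate for a dense set.\<close>

definition option_combination :: "('a \<Rightarrow> real) \<Rightarrow> (rat \<times> rat option) list \<Rightarrow> 'a \<Rightarrow> real" where
  "option_combination f L x =
     (\<Sum>(a, k)\<leftarrow>L. of_rat a * (case k of None \<Rightarrow> 1 | Some k \<Rightarrow> max (f x - of_rat k) 0))"

lemma option_combination_append:
  "option_combination f (L @ L') x = option_combination f L x + option_combination f L' x"
  by (simp add: option_combination_def)

lemma option_combination_scale:
  "option_combination f (map (\<lambda>(a, k). (q * a, k)) L) x = of_rat q * option_combination f L x"
  by (induction L) (auto simp: option_combination_def of_rat_mult algebra_simps)

lemma option_combination_measurable:
  assumes [measurable]: "f \<in> borel_measurable M"
  shows "option_combination f L \<in> borel_measurable M"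
proof (induction L)
  case Nil
  then show ?case by (simp add: option_combination_def[abs_def])
next
  case (Cons p L)
  note [measurable] = Cons
  obtain a k where p: "p = (a, k)" by (cases p)
  have "option_combination f (p # L) = (\<lambda>x. of_rat a * (case k of None \<Rightarrow> 1 | Some k \<Rightarrow> max (f x - of_rat k) 0) + option_combination f L x)"
    by (simp add: option_combination_def fun_eq_iff p)
  also have "\<dots> \<in> borel_measurable M" by (cases k) auto
  finally show ?case .
qed

text \<open>The right-hand side contains the generators and is a subspace, hence contains their
  span. A generator with real strike is approximated by rounding the strike, at a cost measured by
  the finite norm of the constant 1; a real multiple is approximated by rounding the factor and
  rescaling the portfolio.\<close>

lemma option_space_approximation:
  assumes one: "N (\<lambda>x. 1) < \<infinity>" and f: "f \<in> borel_measurable M" and f_fin: "N f < \<infinity>"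
  shows "option_space M P (cls f) \<subseteq>
    {cls g | g. g \<in> borel_measurable M \<and> N g < \<infinity> \<and> (\<forall>e>0. \<exists>L. N (\<lambda>x. g x - option_combination f L x) < ennreal e)}"
    (is "_ \<subseteq> ?V")
  unfolding option_space_def qs_span_def
proof (rule hull_minimal)
  note [measurable] = f option_combination_measurable[OF f]
  obtain K where K: "0 < K" "N (\<lambda>x. 1) < ennreal K" using one by (rule ennreal_less_realE)
  have VI: "cls g \<in> ?V" if "g \<in> borel_measurable M" "N g < \<infinity>"
    "\<And>e. 0 < e \<Longrightarrow> \<exists>L. N (\<lambda>x. g x - option_combination f L x) < ennreal e" for g
    using that by blast
  show "{qs_const M P 1} \<union> range (\<lambda>k. qs_map M P (\<lambda>x. max (x - k) 0) (cls f)) \<subseteq> ?V"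
  proof (intro Un_least image_subsetI insert_subsetI empty_subsetI)
    show "qs_const M P 1 \<in> ?V"
      unfolding qs_const_def
    proof (rule VI[OF _ one])
      fix e :: real assume "0 < e"
      then show "\<exists>L. N (\<lambda>x. 1 - option_combination f L x) < ennreal e"
        by (intro exI[of _ "[(1, None)]"]) (simp add: option_combination_def N_eq_0)
    qed simp
  next
    fix k :: real
    have "cls (\<lambda>x. max (f x - k) 0) \<in> ?V"
    proof (rule VI)
      have "N (\<lambda>x. max (f x - k) 0) \<le> N (\<lambda>x. \<bar>f x\<bar> + \<bar>k\<bar> * 1)" by (rule N_mono) auto
      also have "\<dots> < \<infinity>"
      proof (rule N_add_finite)
        have "N (\<lambda>x. \<bar>f x\<bar>) \<le> N f" by (rule N_mono) auto
        then show "N (\<lambda>x. \<bar>f x\<bar>) < \<infinity>" using f_fin by simp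
      qed (use N_scale_finite[OF one] in auto)
      finally show "N (\<lambda>x. max (f x - k) 0) < \<infinity>" .
      fix e :: real assume e: "0 < e"
      then obtain q where q: "\<bar>k - of_rat q\<bar> < e / K" using ex_of_rat_near[of "e / K" k] K(1) by auto
      have "N (\<lambda>x. max (f x - k) 0 - option_combination f [(1, Some q)] x) \<le> N (\<lambda>x. \<bar>k - of_rat q\<bar> * 1)"
        by (rule N_mono, rule AE_I2) (auto simp: option_combination_def)
      also have "\<dots> \<le> ennreal (\<bar>\<bar>k - of_rat q\<bar>\<bar> * K)" by (rule N_scale[OF K(2,1)])
      also have "\<dots> < ennreal e" using q K(1) e by (auto intro!: ennreal_lessI simp: field_simps)
      finally show "\<exists>L. N (\<lambda>x. max (f x - k) 0 - option_combination f L x) < ennreal e" by blast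
    qed simp
    then show "qs_map M P (\<lambda>x. max (x - k) 0) (cls f) \<in> ?V" by (simp add: qs_map_class[OF f])
  qed
  show "qs_subspace M P ?V"
    unfolding qs_subspace_def
  proof (intro conjI ballI allI)
    show "?V \<subseteq> L0 M P" by (auto intro: qs_class_in_L0)
    show "qs_const M P 0 \<in> ?V"
      unfolding qs_const_def
    proof (rule VI)
      fix e :: real assume "0 < e"
      then show "\<exists>L. N (\<lambda>x. 0 - option_combination f L x) < ennreal e"
        by (intro exI[of _ "[]"]) (simp add: option_combination_def N_eq_0)
    qed (auto simp: N_eq_0)
  next
    fix Y Z assume "Y \<in> ?V" "Z \<in> ?V"
    then obtain g h where g: "Y = cls g" "g \<in> borel_measurable M" "N g < \<infinity>"
        "\<And>e. 0 < e \<Longrightarrow> \<exists>L. N (\<lambda>x. g x - option_combination f L x) < ennreal e"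
      and h: "Z = cls h" "h \<in> borel_measurable M" "N h < \<infinity>"
        "\<And>e. 0 < e \<Longrightarrow> \<exists>L. N (\<lambda>x. h x - option_combination f L x) < ennreal e"
      by blast
    note [measurable] = g(2) h(2)
    have "cls (\<lambda>x. g x + h x) \<in> ?V"
    proof (rule VI)
      fix e :: real assume e: "0 < e"
      obtain L where L: "N (\<lambda>x. g x - option_combination f L x) < ennreal (e / 2)" using g(4)[of "e / 2"] e by auto
      obtain L' where L': "N (\<lambda>x. h x - option_combination f L' x) < ennreal (e / 2)" using h(4)[of "e / 2"] e by auto
      have "N (\<lambda>x. g x + h x - option_combination f (L @ L') x)
        = N (\<lambda>x. (g x - option_combination f L x) + (h x - option_combination f L' x))"
        by (simp add: option_combination_append algebra_simps)
      also have "\<dots> \<le> N (\<lambda>x. g x - option_combination f L x) + N (\<lambda>x. h x - option_combination f L' x)"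
        by (rule N_triangle) auto
      also have "\<dots> < ennreal (e / 2 + e / 2)" using L L' by (intro add_mono_ennreal)
      finally show "\<exists>L. N (\<lambda>x. g x + h x - option_combination f L x) < ennreal e" by auto
    qed (use N_add_finite[OF g(2) h(2) g(3) h(3)] in auto)
    then show "qs_add M P Y Z \<in> ?V" by (simp add: g(1) h(1) qs_map2_class[OF g(2) h(2)])
  next
    fix c Y assume "Y \<in> ?V"
    then obtain g where g: "Y = cls g" "g \<in> borel_measurable M" "N g < \<infinity>"
        "\<And>e. 0 < e \<Longrightarrow> \<exists>L. N (\<lambda>x. g x - option_combination f L x) < ennreal e"
      by blast
    note [measurable] = g(2)
    obtain l where l: "0 < l" "N g < ennreal l" using g(3) by (rule ennreal_less_realE)
    have "cls (\<lambda>x. c * g x) \<in> ?V"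
    proof (rule VI)
      fix e :: real assume e: "0 < e"
      obtain q where q: "\<bar>c - of_rat q\<bar> < e / (2 * l)" using ex_of_rat_near[of "e / (2 * l)" c] e l by auto
      \<comment> \<open>The summand 1 admits \<open>q = 0\<close> and makes
        \<open>|q| * \<delta>\<close> strictly smaller than \<open>e / 2\<close>.\<close>
      define \<delta> where "\<delta> = e / (2 * (\<bar>of_rat q\<bar> + 1))"
      have "0 < e / (2 * (r + 1)) \<and> r * (e / (2 * (r + 1))) < e / 2" if "0 \<le> r" for r :: real
        using e that by (auto simp: field_simps)
      then have \<delta>: "0 < \<delta>" "\<bar>of_rat q\<bar> * \<delta> < e / 2"
        by (simp_all only: \<delta>_def abs_ge_zero)
      obtain L where L: "N (\<lambda>x. g x - option_combination f L x) < ennreal \<delta>" using g(4)[OF \<delta>(1)] by auto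
      let ?L = "map (\<lambda>(a, k). (q * a, k)) L"
      have "N (\<lambda>x. c * g x - option_combination f ?L x)
        = N (\<lambda>x. (c - of_rat q) * g x + of_rat q * (g x - option_combination f L x))"
        unfolding option_combination_scale by (simp add: algebra_simps)
      also have "\<dots> \<le> N (\<lambda>x. (c - of_rat q) * g x) + N (\<lambda>x. of_rat q * (g x - option_combination f L x))"
        by (rule N_triangle) auto
      also have "\<dots> < ennreal (e / 2 + e / 2)"
      proof (rule add_mono_ennreal)
        show "N (\<lambda>x. (c - of_rat q) * g x) < ennreal (e / 2)"
          by (rule le_less_trans[OF N_scale[OF l(2,1)]]) (use q l e in \<open>auto intro!: ennreal_lessI simp: field_simps\<close>)
        show "N (\<lambda>x. of_rat q * (g x - option_combination f L x)) < ennreal (e / 2)"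
          by (rule le_less_trans[OF N_scale[OF L \<delta>(1)]]) (use \<delta> e in \<open>auto intro!: ennreal_lessI\<close>)
      qed
      finally show "\<exists>L. N (\<lambda>x. c * g x - option_combination f L x) < ennreal e" by auto
    qed (use N_scale_finite[OF g(3)] in auto)
    then show "qs_scale M P c Y \<in> ?V" by (simp add: g(1) qs_map_class[OF g(2)])
  qed
qed

text \<open>Closedness is idempotence of the closure; the countable approximating set is formed by
  the rational option combinations of a representative of \<open>X\<close>.\<close>

lemma orlicz_ideal_option_closure:
  assumes one: "N (\<lambda>x. 1) < \<infinity>" and X: "X \<in> LPhi M P \<Phi>"
    and ideal: "is_ideal M P (LPhi M P \<Phi>) (option_closure M P \<Phi> X)"
  shows "orlicz_ideal M P \<Phi> (option_closure M P \<Phi> X)"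
proof -
  obtain f where f: "f \<in> borel_measurable M" "X = cls f" "N f < \<infinity>" using X by (rule LPhiE)
  note approx = option_space_approximation[OF one f(1,3)]
  have H: "option_space M P X \<subseteq> LPhi M P \<Phi>"
    using approx unfolding f(2) by (auto simp: class_in_LPhi_iff)
  have HC: "option_space M P X \<subseteq> option_closure M P \<Phi> X"
    unfolding option_closure_def by (rule subset_Orlicz_closure[OF H])
  have "qs_const M P 1 \<in> option_space M P X"
    unfolding option_space_def qs_span_def by (rule subsetD[OF hull_subset]) simp
  then have "cls (\<lambda>x. 1) \<in> option_closure M P \<Phi> X" using HC by (auto simp: qs_const_def)
  moreover have "Orlicz_closure M P \<Phi> (option_closure M P \<Phi> X) \<subseteq> option_closure M P \<Phi> X"
    unfolding option_closure_def by (rule Orlicz_closure_idem[OF H])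
  moreover have "\<exists>d\<in>range (option_combination f). N (\<lambda>x. g x - d x) < ennreal e"
    if g: "g \<in> borel_measurable M" "cls g \<in> option_closure M P \<Phi> X" and e: "0 < e" for g e
  proof -
    obtain Z where Z: "Z \<in> option_space M P X" "Orlicz_norm P \<Phi> (qs_diff M P (cls g) Z) < ennreal (e / 2)"
      using g(2) e by (auto simp: option_closure_def Orlicz_closure_def dest: spec[of _ "e / 2"])
    obtain h where h: "Z = cls h" "h \<in> borel_measurable M"
        "\<And>e. 0 < e \<Longrightarrow> \<exists>L. N (\<lambda>x. h x - option_combination f L x) < ennreal e"
      using approx Z(1) unfolding f(2) by blast
    obtain L where L: "N (\<lambda>x. h x - option_combination f L x) < ennreal (e / 2)" using h(3)[of "e / 2"] e by auto
    have "N (\<lambda>x. g x - option_combination f L x) \<le> N (\<lambda>x. g x - h x) + N (\<lambda>x. h x - option_combination f L x)"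
      by (rule N_diff_triangle[OF g(1) h(2) option_combination_measurable[OF f(1)]])
    also have "\<dots> < ennreal (e / 2 + e / 2)"
      using Z(2) L by (intro add_mono_ennreal) (simp_all add: h(1) Orlicz_norm_diff_class[OF g(1) h(2)])
    finally show ?thesis by auto
  qed
  then have "\<exists>D. countable D \<and> D \<subseteq> borel_measurable M
       \<and> (\<forall>g\<in>borel_measurable M. cls g \<in> option_closure M P \<Phi> X \<longrightarrow> (\<forall>e>0. \<exists>d\<in>D. N (\<lambda>x. g x - d x) < ennreal e))"
    using option_combination_measurable[OF f(1)]
    by (intro exI[of _ "range (option_combination f)"]) auto
  ultimately show ?thesis using ideal by unfold_locales auto
qed

text \<open>A nonnegative claim is its own call option with strike 0.\<close>

lemma mem_option_closure:
  assumes one: "N (\<lambda>x. 1) < \<infinity>" and X: "X \<in> LPhi M P \<Phi>" and pos: "qs_le P (qs_const M P 0) X"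
  shows "X \<in> option_closure M P \<Phi> X"
proof -
  obtain f where f: "f \<in> borel_measurable M" "X = cls f" "N f < \<infinity>" using X by (rule LPhiE)
  have H: "option_space M P X \<subseteq> LPhi M P \<Phi>"
    using option_space_approximation[OF one f(1,3)] unfolding f(2) by (auto simp: class_in_LPhi_iff)
  have "AE x in Q. max (f x - 0) 0 = f x" if Q: "Q \<in> P" for Q
  proof -
    have "AE x in Q. 0 \<le> f x" using pos Q f by (simp add: qs_const_def qs_le_class)
    then show ?thesis by eventually_elim simp
  qed
  then have "qs_map M P (\<lambda>x. max (x - 0) 0) X = X"
    unfolding f(2) qs_map_class[OF f(1)] by (rule qs_class_cong)
  moreover have "qs_map M P (\<lambda>x. max (x - 0) 0) X \<in> option_space M P X"
    unfolding option_space_def qs_span_def by (rule subsetD[OF hull_subset]) blast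
  ultimately show ?thesis
    using subset_Orlicz_closure[OF H] by (auto simp: option_closure_def)
qed

end

section \<open>Order structure under a strictly positive measure\<close>

text \<open>The essential supremum: among countable subsets choose one whose transformed pointwise
  supremum has maximal integral. Adding a further \<open>f\<close> cannot increase this integral, so
  the supremum is unchanged almost everywhere.\<close>

lemma countable_dominating_subset:
  fixes R :: "'a measure"
  assumes R: "finite_measure R" and F: "F \<subseteq> borel_measurable R"
  shows "\<exists>B\<subseteq>F. countable B \<and> (\<forall>t. (\<forall>b\<in>B. AE x in R. b x \<le> t x) \<longrightarrow> (\<forall>f\<in>F. AE x in R. f x \<le> (t x :: real)))"
proof -
  interpret finite_measure R by fact
  \<comment> \<open>A strictly increasing bounded transform keeps \<open>J\<close> finite without
    integrability of the members of \<open>F\<close>. Since \<open>arctan\<close> lies above -2 and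
    below 2, the value stays positive, so \<open>ennreal\<close> does not truncate, and below
    4.\<close>
  define \<psi> :: "real \<Rightarrow> ennreal" where "\<psi> y = ennreal (2 + arctan y)" for y
  have \<psi>_le: "\<psi> y \<le> \<psi> z \<longleftrightarrow> y \<le> z" for y z
    using arctan_bounded[of z] pi_less_4 by (auto simp: \<psi>_def ennreal_le_iff arctan_le_iff)
  have \<psi>_le4: "\<psi> y \<le> 4" for y
  proof -
    have "\<psi> y \<le> ennreal 4" unfolding \<psi>_def using arctan_bounded[of y] pi_less_4 by (intro ennreal_leI) auto
    then show ?thesis by simp
  qed
  have \<psi>_meas [measurable]: "\<psi> \<in> borel_measurable borel"
    by (rule mono_real_borel_measurable) (simp add: mono_def \<psi>_le)
  define J where "J B = (\<integral>\<^sup>+x. (SUP b\<in>B. \<psi> (b x)) \<partial>R)" for B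
  have J_fin: "J B < \<infinity>" for B
  proof -
    have "J B \<le> (\<integral>\<^sup>+x. 4 \<partial>R)" unfolding J_def by (intro nn_integral_mono SUP_least \<psi>_le4)
    moreover have "emeasure R (space R) < top" by (metis emeasure_finite infinity_ennreal_def less_top)
    then have "(\<integral>\<^sup>+x. 4 \<partial>R) < \<infinity>" by (simp add: ennreal_mult_less_top)
    ultimately show ?thesis by simp
  qed
  let ?\<B> = "{B. B \<subseteq> F \<and> countable B}"
  have "J ` ?\<B> \<noteq> {}" by auto
  from ennreal_Sup_countable_SUP[OF this]
  obtain j where j: "range j \<subseteq> J ` ?\<B>" "(SUP B\<in>?\<B>. J B) = (SUP i::nat. j i)" by auto
  have "\<exists>B. B \<in> ?\<B> \<and> j i = J B" for i using j(1) by (auto simp: image_subset_iff)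
  then obtain b where b: "\<And>i. b i \<in> ?\<B>" "\<And>i. j i = J (b i)" by metis
  define B where "B = (\<Union>i. b i)"
  have B: "B \<subseteq> F" "countable B" using b(1) by (auto simp: B_def)
  have J_max: "J B' \<le> J B" if "B' \<in> ?\<B>" for B'
  proof -
    have "J B' \<le> (SUP i. j i)" unfolding j(2)[symmetric] using that by (rule SUP_upper)
    also have "\<dots> \<le> J B"
      unfolding b(2) J_def B_def by (intro SUP_least nn_integral_mono SUP_subset_mono) auto
    finally show ?thesis .
  qed
  show ?thesis
  proof (intro exI[of _ B] conjI allI impI ballI B)
    fix t f assume t: "\<forall>b\<in>B. AE x in R. b x \<le> t x" and f: "f \<in> F"
    define s where "s B' x = (SUP b\<in>B'. \<psi> (b x))" for B' :: "('a \<Rightarrow> real) set" and x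
    have meas: "s B' \<in> borel_measurable R" if "B' \<in> ?\<B>" for B'
      unfolding s_def using that F by (intro borel_measurable_SUP measurable_compose[OF _ \<psi>_meas]) auto
    have B1: "B \<in> ?\<B>" "insert f B \<in> ?\<B>" using B f by auto
    note [measurable] = meas[OF B1(1)] meas[OF B1(2)]
    have le: "s B x \<le> s (insert f B) x" for x unfolding s_def by (rule SUP_subset_mono) auto
    have J_s: "J B' = (\<integral>\<^sup>+x. s B' x \<partial>R)" for B' by (simp add: J_def s_def)
    have "(\<integral>\<^sup>+x. s (insert f B) x - s B x \<partial>R) = J (insert f B) - J B"
      unfolding J_s using J_fin[of B] le by (intro nn_integral_diff) (auto simp: J_s)
    also have "\<dots> = 0" using J_max[OF B1(2)] J_fin[of B] by (simp add: diff_eq_0_iff_ennreal)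
    finally have "AE x in R. s (insert f B) x - s B x = 0"
      by (subst (asm) nn_integral_0_iff_AE) auto
    moreover have "AE x in R. \<forall>b\<in>B. b x \<le> t x" using t B(2) by (simp add: AE_ball_countable)
    ultimately show "AE x in R. f x \<le> t x"
    proof eventually_elim
      fix x assume x: "s (insert f B) x - s B x = 0" "\<forall>b\<in>B. b x \<le> t x"
      have "\<psi> (f x) \<le> s (insert f B) x" unfolding s_def by (rule SUP_upper) simp
      also have "\<dots> \<le> s B x" using x(1) by (simp add: diff_eq_0_iff_ennreal)
      also have "\<dots> \<le> \<psi> (t x)" using x(2) by (auto intro!: SUP_least simp: s_def \<psi>_le)
      finally show "f x \<le> t x" by (simp add: \<psi>_le)
    qed
  qed
qed

lemma qs_le_antisym:
  assumes "X \<in> L0 M P" "Y \<in> L0 M P" "qs_le P X Y" "qs_le P Y X"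
  shows "X = Y"
  using assms
proof (elim L0E)
  fix f g assume *: "f \<in> borel_measurable M" "X = qs_class M P f" "g \<in> borel_measurable M" "Y = qs_class M P g"
  have "AE x in Q. f x = g x" if "Q \<in> P" for Q
  proof -
    have "AE x in Q. f x \<le> g x" "AE x in Q. g x \<le> f x" using assms(3,4) * that by (simp_all add: qs_le_class)
    then show ?thesis by eventually_elim simp
  qed
  then show "X = Y" unfolding * by (rule qs_class_cong)
qed

section \<open>Null sets, classes and suprema under the strictly positive measure\<close>

locale represented_ideal = orlicz_ideal M P \<Phi> C for M :: "'a measure" and P \<Phi> C +
  fixes R :: "'a measure"
  assumes R_ca: "R \<in> ca_prob M P \<Phi>" and inj: "inj_on (canonical_projection M R) C"
begin

lemma R_prob: "prob_space R" and sets_R: "sets R = sets M" and measure_R_ca_on: "measure R \<in> ca_on M P \<Phi> (LPhi M P \<Phi>)"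
  using R_ca by (auto simp: ca_prob_def)

sublocale R: prob_space R by (rule R_prob)

lemma space_R: "space R = space M"
  by (rule sets_eq_imp_space_eq[OF sets_R])

lemma measurable_R: "borel_measurable R = borel_measurable M"
  by (rule measurable_cong_sets) (simp_all add: sets_R)

lemma variation_R: "variation M (measure R) = R"
  by (rule variation_finite_measure[OF R.finite_measure_axioms sets_R])

lemma polar_imp_R_null:
  assumes "A \<in> sets M" "\<And>Q. Q \<in> P \<Longrightarrow> emeasure Q A = 0"
  shows "emeasure R A = 0"
proof -
  have "ca_dominated M (measure ` {R}) (measure ` P)" using measure_R_ca_on by (simp add: ca_on_def)
  then have "\<forall>A\<in>sets M. (\<forall>Q\<in>P. emeasure Q A = 0) \<longrightarrow> (\<forall>Q\<in>{R}. emeasure Q A = 0)"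
    using P_prob R_prob sets_R by (intro ca_dominated_probs_iff[THEN iffD1]) blast+
  with assms show ?thesis by blast
qed

lemma qs_imp_AE_R:
  assumes p: "{x \<in> space M. p x} \<in> sets M" and qs: "\<And>Q. Q \<in> P \<Longrightarrow> AE x in Q. p x"
  shows "AE x in R. p x"
proof -
  have N: "{x \<in> space M. \<not> p x} \<in> sets M" using p by (rule sets.sets_Collect_neg)
  have "emeasure R {x \<in> space M. \<not> p x} = 0"
  proof (rule polar_imp_R_null[OF N])
    fix Q assume Q: "Q \<in> P"
    then show "emeasure Q {x \<in> space M. \<not> p x} = 0"
      using qs[OF Q] N sets_P[OF Q] space_P[OF Q] by (subst (asm) AE_iff_measurable) auto
  qed
  then show ?thesis using N sets_R space_R by (subst AE_iff_measurable) auto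
qed

lemma R_null_imp_polar:
  assumes A: "A \<in> sets M" and null: "emeasure R A = 0" and Q: "Q \<in> P"
  shows "emeasure Q A = 0"
proof -
  note [measurable] = A
  \<comment> \<open>The projection is defined through the representative chosen by
    \<open>rep\<close>; polar sets being null for \<open>R\<close>, any other representative gives
    the same class.\<close>
  have proj: "canonical_projection M R (cls f) = qs_class M {R} f" if f: "f \<in> borel_measurable M" for f
    unfolding canonical_projection_def
  proof (rule qs_class_cong)
    note [measurable] = f rep_qs_class_measurable[OF f, of P]
    have "AE x in R. rep (cls f) x = f x"
      by (rule qs_imp_AE_R, measurable) (rule rep_qs_class_AE[OF f])
    then show "AE x in Q. rep (cls f) x = f x" if "Q \<in> {R}" for Q using that by (metis singletonD)
  qed
  have "A \<in> null_sets R" using null A sets_R by auto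
  then have "AE x in R. indicator A x = (0::real)" by (auto dest: AE_not_in elim: eventually_mono)
  then have "canonical_projection M R (cls (indicator A)) = canonical_projection M R (cls (\<lambda>x. 0))"
    by (subst (1 2) proj) (auto intro!: qs_class_cong)
  then have "cls (indicator A) = cls (\<lambda>x. 0)"
    using inj_onD[OF inj _ class_CF class_CF] CF_indicator[OF A] CF_const[of 0] by blast
  then have "AE x in Q. indicator A x = (0::real)"
    using Q by (subst (asm) qs_class_eq_iff) auto
  then have "AE x in Q. x \<notin> A" by eventually_elim (auto simp: indicator_def split: if_splits)
  then show ?thesis using A sets_P[OF Q] AE_iff_null_sets[of A Q] by auto
qed

lemma AE_R_imp_qs:
  assumes p: "{x \<in> space M. p x} \<in> sets M" and ae: "AE x in R. p x" and Q: "Q \<in> P"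
  shows "AE x in Q. p x"
proof -
  have N: "{x \<in> space M. \<not> p x} \<in> sets M" using p by (rule sets.sets_Collect_neg)
  have "emeasure R {x \<in> space M. \<not> p x} = 0"
    using ae N sets_R space_R by (subst (asm) AE_iff_measurable) auto
  from R_null_imp_polar[OF N this Q] show ?thesis
    using N sets_P[OF Q] space_P[OF Q] by (subst AE_iff_measurable) auto
qed

lemma AE_R_iff_qs:
  assumes "{x \<in> space M. p x} \<in> sets M"
  shows "(AE x in R. p x) \<longleftrightarrow> (\<forall>Q\<in>P. AE x in Q. p x)"
  using AE_R_imp_qs[OF assms] qs_imp_AE_R[OF assms] by blast

text \<open>Almost sure under \<open>R\<close> and quasi-sure are the same for measurable events, so
  both equivalence relations yield literally the same set of representatives.\<close>

lemma qs_class_R: "f \<in> borel_measurable M \<Longrightarrow> qs_class M {R} f = cls f"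
  unfolding qs_class_def by (intro Collect_cong conj_cong refl) (simp add: AE_R_iff_qs)

lemma L0_R: "L0 M {R} = L0 M P"
  unfolding L0_def by (rule image_cong) (auto simp: qs_class_R)

lemma qs_map_R:
  assumes "Y \<in> C" "h \<in> borel_measurable borel"
  shows "qs_map M {R} h Y = qs_map M P h Y"
proof -
  show ?thesis
    unfolding qs_map_def
    by (rule qs_class_R, rule measurable_compose[OF CF_measurable[OF rep_in_CF[OF assms(1)]] assms(2)])
qed

lemma qs_map2_R:
  assumes "Y \<in> C" "Z \<in> C" "(\<lambda>x. h (rep Y x) (rep Z x)) \<in> borel_measurable M"
  shows "qs_map2 M {R} h Y Z = qs_map2 M P h Y Z"
  unfolding qs_map2_def by (rule qs_class_R[OF assms(3)])

lemma C_subset_L1: "C \<subseteq> L1 M R"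
proof
  fix Y assume Y: "Y \<in> C"
  have "integrable R f" if "f \<in> Y" for f
  proof -
    have "integrable (variation M (measure R)) f"
      using measure_R_ca_on Y that C_subset_LPhi by (auto simp: ca_on_def)
    then show ?thesis by (simp add: variation_R)
  qed
  then show "Y \<in> L1 M R" using Y C_subset_L0 by (auto simp: L1_def L0_R)
qed

lemma ideal_in_L1: "is_ideal M {R} (L1 M R) C"
  unfolding is_ideal_def
proof (intro conjI ballI impI C_subset_L1)
  show "qs_subspace M {R} C"
    unfolding qs_subspace_def
  proof (intro conjI ballI allI)
    show "C \<subseteq> L0 M {R}" using C_subset_L0 by (simp add: L0_R)
    show "qs_const M {R} 0 \<in> C" using CF_const[of 0] by (simp add: qs_const_def qs_class_R CF_def)
    fix Y assume Y: "Y \<in> C"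
    show "qs_scale M {R} c Y \<in> C" for c
      using ideal Y by (simp add: qs_map_R is_ideal_def qs_subspace_def)
    fix Z assume Z: "Z \<in> C"
    have "(\<lambda>x. rep Y x + rep Z x) \<in> borel_measurable M" using rep_in_CF[OF Y] rep_in_CF[OF Z] by measurable
    then show "qs_add M {R} Y Z \<in> C"
      using ideal Y Z by (simp add: qs_map2_R is_ideal_def qs_subspace_def)
  qed
  fix Y Z assume Y: "Y \<in> L1 M R" and Z: "Z \<in> C" and le: "qs_le {R} (qs_abs M {R} Y) (qs_abs M {R} Z)"
  obtain f where f: "f \<in> borel_measurable M" "Y = qs_class M {R} f" using Y by (auto simp: L1_def elim: L0E)
  obtain g where g: "g \<in> CF" "Z = qs_class M {R} g"
    using Z by (elim mem_CE) (auto simp: qs_class_R CF_measurable)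
  note [measurable] = f(1) CF_measurable[OF g(1)]
  have ae: "AE x in R. \<bar>f x\<bar> \<le> \<bar>g x\<bar>"
    using le unfolding f(2) g(2) by (simp add: qs_map_class qs_le_class)
  have "f \<in> CF"
  proof (rule CF_solid[OF f(1) g(1)])
    show "AE x in Q. \<bar>f x\<bar> \<le> \<bar>g x\<bar>" if "Q \<in> P" for Q
      by (rule AE_R_imp_qs[OF _ ae that]) measurable
  qed
  then show "Y \<in> C" by (simp add: f qs_class_R class_CF)
qed

text \<open>The isomorphism is the identity, as elements of \<open>C\<close> are already classes
  modulo \<open>R\<close>-null sets; only the operations have to be matched.\<close>

lemma lattice_isomorphism_L1: "lattice_isomorphism M P C {R} C id"
proof -
  have "qs_map2 M P h Y Z = qs_map2 M {R} h Y Z"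
    if "Y \<in> C" "Z \<in> C" "(\<lambda>x. h (rep Y x) (rep Z x)) \<in> borel_measurable M" for Y Z h
    using that by (rule qs_map2_R[symmetric])
  moreover have "rep Y \<in> borel_measurable M" if "Y \<in> C" for Y using rep_in_CF[OF that] by measurable
  moreover have "qs_scale M P c Y = qs_scale M {R} c Y" if "Y \<in> C" for c Y
    by (rule qs_map_R[OF that, symmetric]) simp
  ultimately show ?thesis
    unfolding lattice_isomorphism_def id_apply by (intro conjI ballI allI) (simp_all add: bij_betw_def)
qed

lemma CF_abs:
  assumes "f \<in> CF"
  shows "(\<lambda>x. \<bar>f x\<bar>) \<in> CF"
  by (rule CF_solid[OF _ assms]) (use CF_measurable[OF assms] in auto)

text \<open>The pointwise supremum of a countable subset that dominates \<open>A\<close> almost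
  surely under \<open>R\<close> dominates it quasi-surely, by equality of the null sets. It belongs
  to \<open>C\<close> by solidity, being squeezed between \<open>min Y0 U\<close> and
  \<open>U\<close>.\<close>

lemma ex_countable_lub:
  assumes A: "A \<subseteq> C" "A \<noteq> {}" and U: "U \<in> C" "\<And>Y. Y \<in> A \<Longrightarrow> qs_le P Y U"
  shows "\<exists>B S. B \<subseteq> A \<and> countable B \<and> is_lub P C A S \<and> is_lub P C B S"
proof -
  have "rep ` A \<subseteq> borel_measurable R"
    using A(1) rep_in_CF CF_measurable unfolding measurable_R by blast
  from countable_dominating_subset[OF R.finite_measure_axioms this]
  obtain B0 where B0: "B0 \<subseteq> rep ` A" "countable B0"
    and B0_dom: "\<forall>t. (\<forall>b\<in>B0. AE x in R. b x \<le> t x) \<longrightarrow> (\<forall>f\<in>rep ` A. AE x in R. f x \<le> t x)"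
    by (elim exE conjE)
  obtain B1 where B1: "B1 \<subseteq> A" "countable B1" "B0 = rep ` B1"
    using countable_subset_image[of B0 rep A] B0(1,2) by auto
  obtain Y0 where Y0: "Y0 \<in> A" using A(2) by auto
  \<comment> \<open>\<open>Y0\<close> makes the index set of the supremum nonempty and provides the
    lower bound.\<close>
  define B where "B = insert Y0 B1"
  have B: "B \<subseteq> A" "countable B" "Y0 \<in> B" "B1 \<subseteq> B" using B1 Y0 by (auto simp: B_def)
  then have BC: "B \<subseteq> C" using A by auto
  have repB: "rep Y \<in> borel_measurable M" "cls (rep Y) = Y" if "Y \<in> C" for Y
    using rep_in_CF[OF that] qs_class_rep[of Y M P] that C_subset_L0 by (auto simp: CF_def)
  define u where "u = rep U"
  have u: "u \<in> CF" "cls u = U" using U(1) rep_in_CF repB by (auto simp: u_def)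
  note [measurable] = CF_measurable[OF u(1)]
  have le_iff: "qs_le P Y Z \<longleftrightarrow> (\<forall>Q\<in>P. AE x in Q. rep Y x \<le> rep Z x)" if "Y \<in> C" "Z \<in> C" for Y Z
    using qs_le_class[OF repB(1)[OF that(1)] repB(1)[OF that(2)], of P] that by (simp add: repB)
  have Bu: "AE x in Q. rep Y x \<le> u x" if "Y \<in> A" "Q \<in> P" for Y Q
    using U that A le_iff[of Y U] by (auto simp: u_def)
  \<comment> \<open>The bound by \<open>u\<close> holds almost surely only; cutting at
    \<open>u\<close> makes the supremum finite at every point and changes nothing off a polar
    set.\<close>
  define s where "s x = (SUP Y\<in>B. min (rep Y x) (u x))" for x
  have bdd: "bdd_above ((\<lambda>Y. min (rep Y x) (u x)) ` B)" for x by (rule bdd_aboveI2[of _ _ "u x"]) simp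
  have s_meas [measurable]: "s \<in> borel_measurable M"
    unfolding s_def using B(2) BC repB bdd by (intro borel_measurable_cSUP) auto
  have s_upper: "min (rep Y x) (u x) \<le> s x" if "Y \<in> B" for Y x
    unfolding s_def by (rule cSUP_upper[OF that bdd])
  have s_least: "s x \<le> y" if "\<And>Y. Y \<in> B \<Longrightarrow> min (rep Y x) (u x) \<le> y" for x y
    unfolding s_def using that B(3) by (intro cSUP_least) auto
  have s_CF: "s \<in> CF"
  proof (rule CF_solid[OF s_meas])
    have "rep Y0 \<in> CF" using Y0 A(1) by (intro rep_in_CF) blast
    then show "(\<lambda>x. \<bar>rep Y0 x\<bar> + \<bar>u x\<bar>) \<in> CF" by (rule CF_add[OF CF_abs CF_abs[OF u(1)]])
    show "AE x in Q. \<bar>s x\<bar> \<le> \<bar>\<bar>rep Y0 x\<bar> + \<bar>u x\<bar>\<bar>" for Q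
    proof (rule AE_I2)
      fix x
      have "s x \<le> u x" by (rule s_least) simp
      with s_upper[OF B(3), of x] show "\<bar>s x\<bar> \<le> \<bar>\<bar>rep Y0 x\<bar> + \<bar>u x\<bar>\<bar>" by linarith
    qed
  qed
  have B_le_s: "AE x in Q. rep Y x \<le> s x" if Y: "Y \<in> B" and Q: "Q \<in> P" for Y Q
  proof -
    have "AE x in Q. rep Y x \<le> u x" using Bu Y Q B(1) by auto
    then show ?thesis by eventually_elim (use s_upper[OF Y] in \<open>metis min.absorb1\<close>)
  qed
  have "AE x in R. rep Y x \<le> s x" if "Y \<in> B" for Y
  proof -
    note [measurable] = repB(1)[of Y]
    have "Y \<in> C" using that BC by auto
    then show ?thesis by (intro qs_imp_AE_R B_le_s that) auto
  qed
  then have A_le_s_R: "AE x in R. rep Y x \<le> s x" if "Y \<in> A" for Y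
    using B0_dom[rule_format, of s "rep Y"] B(4) that by (auto simp: B1(3))
  have A_le_s: "AE x in Q. rep Y x \<le> s x" if "Y \<in> A" "Q \<in> P" for Y Q
  proof -
    note [measurable] = repB(1)[of Y]
    have "Y \<in> C" using that A by auto
    then have m: "{x \<in> space M. rep Y x \<le> s x} \<in> sets M" by measurable
    show ?thesis by (rule AE_R_imp_qs[OF m A_le_s_R[OF that(1)] that(2)])
  qed
  have upper: "qs_le P Y (cls s)" if "Y \<in> A" for Y
    using qs_le_class[OF repB(1) s_meas, of Y P] A_le_s[OF that] that A repB(2) by auto
  have least: "qs_le P (cls s) T" if T: "T \<in> C" and TB: "\<And>Y. Y \<in> B \<Longrightarrow> qs_le P Y T" for T
  proof -
    have "AE x in Q. s x \<le> rep T x" if Q: "Q \<in> P" for Q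
    proof -
      have "AE x in Q. \<forall>Y\<in>B. rep Y x \<le> rep T x"
        using TB le_iff T BC Q B(2) by (subst AE_ball_countable) auto
      then show ?thesis by eventually_elim (auto intro!: s_least simp: min.coboundedI1)
    qed
    then show ?thesis
      using qs_le_class[OF s_meas repB(1)[OF T], of P] repB(2)[OF T] by simp
  qed
  have "is_lub P C A (cls s)" "is_lub P C B (cls s)"
    using class_CF[OF s_CF] upper least B(1) by (auto simp: is_lub_def)
  with B(1,2) show ?thesis by blast
qed

text \<open>A given supremum of \<open>A\<close> is itself an upper bound, so the construction
  applies with it, and by antisymmetry the two suprema agree. The empty set, which may have a
  supremum in principle, is its own countable subset.\<close>

lemma super_Dedekind_complete: "super_Dedekind_complete P C"
  unfolding super_Dedekind_complete_def Dedekind_complete_def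
proof (intro conjI allI impI)
  fix A assume "A \<subseteq> C" "A \<noteq> {} \<and> (\<exists>U\<in>C. \<forall>Y\<in>A. qs_le P Y U)"
  then show "\<exists>S. is_lub P C A S" using ex_countable_lub[of A] by blast
next
  fix A S assume A: "A \<subseteq> C" and S: "is_lub P C A S"
  show "\<exists>B\<subseteq>A. countable B \<and> is_lub P C B S"
  proof (cases "A = {}")
    case True
    with S show ?thesis by auto
  next
    case False
    have "S \<in> C" "\<And>Y. Y \<in> A \<Longrightarrow> qs_le P Y S" using S by (auto simp: is_lub_def)
    from ex_countable_lub[OF A False this] obtain B S' where
      B: "B \<subseteq> A" "countable B" "is_lub P C A S'" "is_lub P C B S'" by blast
    have "S' = S"
      using S B(3) C_subset_L0 by (intro qs_le_antisym[of _ M P]) (auto simp: is_lub_def)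
    with B show ?thesis by blast
  qed
qed

end

section \<open>Continuous functionals on the space of integrable classes\<close>

text \<open>Continuity at the empty set upgrades finite additivity: the tails \<open>E n\<close> of
  a disjoint union decrease to the empty set.\<close>

lemma signed_measureI:
  assumes out: "\<And>A. A \<notin> sets M \<Longrightarrow> \<mu> A = 0"
    and add: "\<And>A B. A \<in> sets M \<Longrightarrow> B \<in> sets M \<Longrightarrow> A \<inter> B = {} \<Longrightarrow> \<mu> (A \<union> B) = \<mu> A + \<mu> B"
    and cont: "\<And>E. (\<And>n::nat. E n \<in> sets M) \<Longrightarrow> decseq E \<Longrightarrow> (\<Inter>n. E n) = {} \<Longrightarrow> (\<lambda>n. \<mu> (E n)) \<longlonglongrightarrow> 0"
  shows "signed_measure M \<mu>"
  unfolding signed_measure_def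
proof (intro conjI allI impI)
  show "\<mu> A = 0" if "A \<notin> sets M" for A using that by (rule out)
  show empty: "\<mu> {} = 0" using add[of "{}" "{}"] by simp
  fix A :: "nat \<Rightarrow> 'a set" assume A: "range A \<subseteq> sets M \<and> disjoint_family A"
  then have Am [measurable]: "A i \<in> sets M" and disj: "i \<noteq> j \<Longrightarrow> A i \<inter> A j = {}" for i j
    by (auto simp: disjoint_family_on_def)
  define E where "E n = (\<Union>i\<in>{n..}. A i)" for n
  have E_meas [measurable]: "E n \<in> sets M" for n unfolding E_def by measurable
  have sum: "(\<Sum>i<n. \<mu> (A i)) + \<mu> (E n) = \<mu> (\<Union>i. A i)" for n
  proof (induction n)
    case 0
    then show ?case by (simp add: E_def atLeast_0)
  next
    case (Suc n)
    have "{n..} = insert n {Suc n..}" by auto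
    then have E_Suc: "E n = A n \<union> E (Suc n)" by (simp add: E_def)
    have "A n \<inter> A j = {}" if "Suc n \<le> j" for j using disj[of n j] that by simp
    then have "A n \<inter> E (Suc n) = {}" by (auto simp: E_def)
    then have "\<mu> (E n) = \<mu> (A n) + \<mu> (E (Suc n))"
      unfolding E_Suc by (intro add) auto
    with Suc show ?case by simp
  qed
  have "(\<lambda>n. \<mu> (E n)) \<longlonglongrightarrow> 0"
  proof (rule cont)
    show "decseq E" unfolding E_def by (intro decseq_SucI UN_mono) auto
    have "x \<notin> (\<Inter>n. E n)" for x
    proof
      assume x: "x \<in> (\<Inter>n. E n)"
      then have "x \<in> E 0" by blast
      then obtain i where i: "x \<in> A i" by (auto simp: E_def)
      from x have "x \<in> E (Suc i)" by blast
      then obtain j where "Suc i \<le> j" "x \<in> A j" by (auto simp: E_def)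
      with i disj[of i j] show False by auto
    qed
    then show "(\<Inter>n. E n) = {}" by blast
  qed auto
  then have "(\<lambda>n. \<mu> (\<Union>i. A i) - \<mu> (E n)) \<longlonglongrightarrow> \<mu> (\<Union>i. A i) - 0"
    by (intro tendsto_diff tendsto_const)
  moreover have "\<mu> (\<Union>i. A i) - \<mu> (E n) = (\<Sum>i<n. \<mu> (A i))" for n using sum[of n] by simp
  ultimately show "(\<lambda>i. \<mu> (A i)) sums \<mu> (\<Union>i. A i)" by (simp add: sums_def)
qed

text \<open>Testing with the set where \<open>g\<close> exceeds \<open>K\<close> gives a nonnegative
  integrand whose integral is at most 0.\<close>

lemma AE_le_of_set_integral_le:
  assumes R: "finite_measure R" and g: "integrable R g"
    and le: "\<And>A. A \<in> sets R \<Longrightarrow> (\<integral>x. indicator A x * g x \<partial>R) \<le> K * measure R A"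
  shows "AE x in R. g x \<le> (K::real)"
proof -
  interpret finite_measure R by fact
  note [measurable] = borel_measurable_integrable[OF g]
  define A where "A = {x \<in> space R. K < g x}"
  have A [measurable]: "A \<in> sets R" unfolding A_def by measurable
  have int: "integrable R (\<lambda>x. indicator A x * g x)"
    using integrable_mult_indicator[OF A g] by simp
  have int': "integrable R (\<lambda>x. indicator A x * K)"
    by (intro integrable_mult_left integrable_real_indicator A) (simp add: less_top[symmetric])
  have "(\<integral>x. indicator A x * g x - indicator A x * K \<partial>R) = (\<integral>x. indicator A x * g x \<partial>R) - (\<integral>x. indicator A x * K \<partial>R)"
    by (rule Bochner_Integration.integral_diff[OF int int'])
  also have "(\<integral>x. indicator A x * K \<partial>R) = measure R A * K" using A sets.sets_into_space[OF A] by (simp add: Int_absorb2)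
  finally have le0: "(\<integral>x. indicator A x * g x - indicator A x * K \<partial>R) \<le> 0"
    using le[OF A] by (simp add: mult.commute)
  have nn: "AE x in R. 0 \<le> indicator A x * g x - indicator A x * K"
    by (auto simp: A_def indicator_def)
  have "(\<integral>x. indicator A x * g x - indicator A x * K \<partial>R) = 0"
    using le0 integral_nonneg_AE[OF nn] by simp
  then have "AE x in R. indicator A x * g x - indicator A x * K = 0"
    using integral_nonneg_eq_0_iff_AE[OF Bochner_Integration.integrable_diff[OF int int'] nn] by simp
  moreover have "AE x in R. x \<in> space R" by (rule AE_space)
  ultimately show ?thesis by eventually_elim (auto simp: A_def indicator_def not_less split: if_splits)
qed

text \<open>The duality of integrable and bounded functions. On indicators \<open>l\<close> is a
  signed measure dominated by \<open>K\<close> times \<open>R\<close>; its density is bounded by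
  \<open>K\<close> almost everywhere, and agreement extends to integrable functions by
  approximation.\<close>

lemma bounded_functional_on_integrable:
  fixes l :: "('a \<Rightarrow> real) \<Rightarrow> real"
  assumes R: "finite_measure R"
    and add: "\<And>f g. integrable R f \<Longrightarrow> integrable R g \<Longrightarrow> l (\<lambda>x. f x + g x) = l f + l g"
    and scale: "\<And>f c. integrable R f \<Longrightarrow> l (\<lambda>x. c * f x) = c * l f"
    and bound: "\<And>f. integrable R f \<Longrightarrow> \<bar>l f\<bar> \<le> K * (\<integral>x. \<bar>f x\<bar> \<partial>R)"
  shows "\<exists>h\<in>borel_measurable R. (\<exists>c. \<forall>x. \<bar>h x\<bar> \<le> c) \<and> (\<forall>f. integrable R f \<longrightarrow> l f = (\<integral>x. f x * h x \<partial>R))"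
proof -
  interpret finite_measure R by fact
  define \<mu> where "\<mu> A = (if A \<in> sets R then l (indicator A) else 0)" for A
  have ind: "integrable R (indicator A :: 'a \<Rightarrow> real)" if "A \<in> sets R" for A
    using that by (rule integrable_real_indicator) (simp add: less_top[symmetric])
  have \<mu>_le: "\<bar>\<mu> A\<bar> \<le> K * measure R A" if A: "A \<in> sets R" for A
    using bound[OF ind[OF A]] A sets.sets_into_space[OF A] by (simp add: \<mu>_def Int_absorb2)
  have sm: "signed_measure R \<mu>"
  proof (rule signed_measureI)
    fix A B assume AB: "A \<in> sets R" "B \<in> sets R" "A \<inter> B = {}"
    then have "indicator (A \<union> B) = (\<lambda>x. indicator A x + indicator B x :: real)"
      by (auto simp: fun_eq_iff indicator_def)
    then show "\<mu> (A \<union> B) = \<mu> A + \<mu> B"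
      using AB add[OF ind[OF AB(1)] ind[OF AB(2)]] by (simp add: \<mu>_def)
  next
    fix E :: "nat \<Rightarrow> 'a set" assume E: "\<And>n. E n \<in> sets R" "decseq E" "(\<Inter>n. E n) = {}"
    have "(\<lambda>n. measure R (E n)) \<longlonglongrightarrow> measure R (\<Inter>n. E n)"
      using E by (intro finite_Lim_measure_decseq) auto
    then have "(\<lambda>n. K * measure R (E n)) \<longlonglongrightarrow> K * 0" using E(3) by (intro tendsto_mult tendsto_const) simp
    then have lim: "(\<lambda>n. K * measure R (E n)) \<longlonglongrightarrow> 0" by simp
    show "(\<lambda>n. \<mu> (E n)) \<longlonglongrightarrow> 0"
      by (rule Lim_null_comparison[OF always_eventually lim]) (simp add: \<mu>_le E(1))
  qed (simp add: \<mu>_def)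
  have K: "0 \<le> K * measure R A" if "A \<in> sets R" for A using \<mu>_le[OF that] by linarith
  have mono: "K * measure R B \<le> K * measure R A" if "A \<in> sets R" "B \<in> sets R" "B \<subseteq> A" for A B
  proof -
    have "measure R A = measure R B + measure R (A - B)"
      using that finite_measure_Diff[of A B] by simp
    then show ?thesis using K[of "A - B"] that by (simp add: distrib_left)
  qed
  have var: "emeasure (variation R \<mu>) A \<le> ennreal (K * measure R A) + ennreal (K * measure R A)" if A: "A \<in> sets R" for A
    by (rule variation_le_bound[OF sm A]) (use \<mu>_le mono[OF A] in \<open>meson order_trans\<close>)
  obtain g where g: "integrable R g" "\<And>A. A \<in> sets R \<Longrightarrow> \<mu> A = (\<integral>x. indicator A x * g x \<partial>R)"
  proof -
    have "emeasure (variation R \<mu>) (space R) < \<infinity>"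
      by (rule le_less_trans[OF var]) (auto simp: less_top[symmetric])
    moreover have "emeasure (variation R \<mu>) A = 0" if "A \<in> sets R" "emeasure R A = 0" for A
      using var[OF that(1)] that by (simp add: measure_def)
    ultimately show thesis
      using signed_Radon_Nikodym[OF sm _ R refl] that by blast
  qed
  have "AE x in R. g x \<le> K"
    by (rule AE_le_of_set_integral_le[OF R g(1)]) (use \<mu>_le g(2) in \<open>metis abs_le_D1\<close>)
  moreover have "AE x in R. - g x \<le> K"
    by (rule AE_le_of_set_integral_le[OF R]) (use g \<mu>_le in \<open>auto simp: abs_le_iff\<close>)
  ultimately have gK: "AE x in R. max (- K) (min K (g x)) = g x" by eventually_elim auto
  \<comment> \<open>Clipping changes \<open>g\<close> only on a null set and makes the bound hold at
    every point, so that \<open>h\<close> can serve as a bounded test function.\<close>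
  define h where "h x = max (- K) (min K (g x))" for x
  note [measurable] = borel_measurable_integrable[OF g(1)]
  have h [measurable]: "h \<in> borel_measurable R" unfolding h_def by measurable
  have h_le: "\<bar>h x\<bar> \<le> \<bar>K\<bar>" for x by (auto simp: h_def)
  have fh: "integrable R (\<lambda>x. f x * h x)" if "integrable R f" for f
  proof (rule Bochner_Integration.integrable_bound[of _ "\<lambda>x. \<bar>K\<bar> * \<bar>f x\<bar>"])
    show "AE x in R. norm (f x * h x) \<le> norm (\<bar>K\<bar> * \<bar>f x\<bar>)"
    proof (rule AE_I2)
      show "norm (f x * h x) \<le> norm (\<bar>K\<bar> * \<bar>f x\<bar>)" for x
        using mult_left_mono[OF h_le[of x], of "\<bar>f x\<bar>"] by (simp add: abs_mult mult.commute)
    qed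
  qed (use that in auto)
  have "l f = (\<integral>x. f x * h x \<partial>R)" if "integrable R f" for f
    using that
  proof (induction f)
    case (base A c)
    have "l (\<lambda>x. indicator A x *\<^sub>R c) = l (\<lambda>x. c * indicator A x)" by (simp add: mult.commute)
    also have "\<dots> = c * \<mu> A" using scale[OF ind[OF base(1)]] base(1) by (simp add: \<mu>_def)
    also have "\<mu> A = (\<integral>x. indicator A x * h x \<partial>R)"
      unfolding g(2)[OF base(1)]
      by (rule integral_cong_AE) (use gK base(1) in \<open>auto simp: h_def elim: eventually_mono\<close>)
    also have "c * (\<integral>x. indicator A x * h x \<partial>R) = (\<integral>x. (indicator A x *\<^sub>R c) * h x \<partial>R)"
      by (subst integral_mult_right_zero[symmetric]) (simp add: mult_ac)
    finally show ?case .
  next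
    case (add f g)
    then show ?case using fh by (simp add: assms(2) distrib_right)
  next
    case (lim f s)
    have diff: "l (s i) - l f = l (\<lambda>x. s i x + (-1) * f x)" for i
      using add[OF lim.hyps(1)[of i] integrable_mult_right[of "-1" R f]] scale[OF lim.hyps(4), of "-1"] lim.hyps(4) by simp
    \<comment> \<open>The approximants satisfy \<open>|s i x| \<le> 2 * |f x|\<close>, hence the
      dominating function \<open>3 * |f x|\<close>.\<close>
    have "(\<lambda>i. \<integral>x. \<bar>s i x - f x\<bar> \<partial>R) \<longlonglongrightarrow> (\<integral>x. 0 \<partial>R)"
    proof (rule integral_dominated_convergence[where w="\<lambda>x. 3 * \<bar>f x\<bar>"])
      show "AE x in R. (\<lambda>i. \<bar>s i x - f x\<bar>) \<longlonglongrightarrow> 0"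
        using lim.hyps(2) by (auto intro!: AE_I2 tendsto_rabs_zero simp: LIM_zero)
      show "AE x in R. norm \<bar>s i x - f x\<bar> \<le> 3 * \<bar>f x\<bar>" for i
      proof (rule AE_I2)
        fix x assume "x \<in> space R"
        from lim.hyps(3)[OF this, of i] show "norm \<bar>s i x - f x\<bar> \<le> 3 * \<bar>f x\<bar>" by simp
      qed
    qed (use lim.hyps(1,4) in auto)
    then have "(\<lambda>i. K * (\<integral>x. \<bar>s i x - f x\<bar> \<partial>R)) \<longlonglongrightarrow> K * 0"
      by (intro tendsto_mult tendsto_const) simp
    then have lim0: "(\<lambda>i. K * (\<integral>x. \<bar>s i x - f x\<bar> \<partial>R)) \<longlonglongrightarrow> 0" by simp
    have "(\<lambda>i. l (s i) - l f) \<longlonglongrightarrow> 0"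
    proof (rule Lim_null_comparison[OF always_eventually lim0], rule allI)
      fix i
      have "integrable R (\<lambda>x. s i x + (-1) * f x)" using lim.hyps(1,4) by auto
      from bound[OF this] show "norm (l (s i) - l f) \<le> K * (\<integral>x. \<bar>s i x - f x\<bar> \<partial>R)"
        unfolding diff by simp
    qed
    then have 1: "(\<lambda>i. l (s i)) \<longlonglongrightarrow> l f" by (rule LIM_zero_cancel)
    have 2: "(\<lambda>i. \<integral>x. s i x * h x \<partial>R) \<longlonglongrightarrow> (\<integral>x. f x * h x \<partial>R)"
    proof (rule integral_dominated_convergence[where w="\<lambda>x. 2 * \<bar>f x * h x\<bar>"])
      show "AE x in R. (\<lambda>i. s i x * h x) \<longlonglongrightarrow> f x * h x"
        using lim.hyps(2) by (auto intro!: AE_I2 tendsto_mult)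
      show "AE x in R. norm (s i x * h x) \<le> 2 * \<bar>f x * h x\<bar>" for i
      proof (rule AE_I2)
        fix x assume "x \<in> space R"
        from mult_right_mono[OF lim.hyps(3)[OF this, of i], of "\<bar>h x\<bar>"]
        show "norm (s i x * h x) \<le> 2 * \<bar>f x * h x\<bar>" by (simp add: abs_mult)
      qed
      show "integrable R (\<lambda>x. 2 * \<bar>f x * h x\<bar>)" using fh[OF lim.hyps(4)] by auto
    qed (use lim.hyps(1,4) in auto)
    from 1 2 lim.IH show ?case using LIMSEQ_unique by simp
  qed
  with h h_le show ?thesis by blast
qed

lemma mem_L1_class:
  assumes "sets R = sets M" "integrable R f"
  shows "qs_class M {R} f \<in> L1 M R"
proof -
  have f: "f \<in> borel_measurable M"
    using borel_measurable_integrable[OF assms(2)] assms(1) by (simp cong: measurable_cong_sets)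
  have "integrable R g" if "g \<in> qs_class M {R} f" for g
  proof -
    have "AE x in R. g x = f x" using qs_classD(2)[OF that] by (auto elim: eventually_mono)
    moreover have "g \<in> borel_measurable R"
      using qs_classD(1)[OF that] assms(1) by (simp cong: measurable_cong_sets)
    ultimately show ?thesis
      using integrable_cong_AE[of g R f] assms(2) by auto
  qed
  with f show ?thesis by (auto simp: L1_def qs_class_in_L0)
qed

text \<open>The functional is read on integrable functions instead of classes; continuity at 0,
  scaled, becomes the uniform bound that the representation by a bounded function requires.\<close>

lemma L1_dual_representation:
  assumes R: "finite_measure R" "sets R = sets M" and l: "l \<in> L1_dual M R"
  shows "\<exists>h\<in>borel_measurable M. (\<exists>c. \<forall>x. \<bar>h x\<bar> \<le> c)
    \<and> (\<forall>f. integrable R f \<longrightarrow> l (qs_class M {R} f) = (\<integral>x. f x * h x \<partial>R))"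
proof -
  have bm: "borel_measurable R = borel_measurable M" by (rule measurable_cong_sets) (simp_all add: R)
  have fm: "f \<in> borel_measurable M" if "integrable R f" for f :: "'a \<Rightarrow> real"
    using borel_measurable_integrable[OF that] by (simp add: bm)
  note L1 = mem_L1_class[OF R(2)]
  let ?l = "\<lambda>f. l (qs_class M {R} f)"
  have add: "?l (\<lambda>x. f x + g x) = ?l f + ?l g" if "integrable R f" "integrable R g" for f g
  proof -
    have "l (qs_add M {R} (qs_class M {R} f) (qs_class M {R} g)) = ?l f + ?l g"
      using l L1[OF that(1)] L1[OF that(2)] unfolding L1_dual_def by blast
    then show ?thesis by (simp only: qs_map2_class[OF fm[OF that(1)] fm[OF that(2)]])
  qed
  have scale: "?l (\<lambda>x. c * f x) = c * ?l f" if "integrable R f" for f c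
  proof -
    have "l (qs_scale M {R} c (qs_class M {R} f)) = c * ?l f"
      using l L1[OF that] unfolding L1_dual_def by blast
    then show ?thesis by (simp only: qs_map_class[OF fm[OF that]])
  qed
  have zero: "?l (\<lambda>x. 0) = 0" using scale[of "\<lambda>x. 0" 0] by simp
  have "norm_continuous M {R} (L1_norm R) (L1 M R) l" using l by (simp add: L1_dual_def)
  moreover have "qs_class M {R} (\<lambda>x. 0) \<in> L1 M R" by (rule L1) simp
  ultimately have "\<forall>e>0. \<exists>d>0. \<forall>Z\<in>L1 M R. L1_norm R (qs_diff M {R} Z (qs_class M {R} (\<lambda>x. 0))) < ennreal d
      \<longrightarrow> \<bar>l Z - l (qs_class M {R} (\<lambda>x. 0))\<bar> < e"
    unfolding norm_continuous_def by blast
  then obtain d where d: "0 < d" and cont: "\<And>Z. Z \<in> L1 M R \<Longrightarrow>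
      L1_norm R (qs_diff M {R} Z (qs_class M {R} (\<lambda>x. 0))) < ennreal d \<Longrightarrow> \<bar>l Z - l (qs_class M {R} (\<lambda>x. 0))\<bar> < 1"
    using zero_less_one by blast
  have small: "\<bar>?l f\<bar> < 1" if f: "integrable R f" "(\<integral>x. \<bar>f x\<bar> \<partial>R) < d" for f
  proof -
    have "L1_norm R (qs_diff M {R} (qs_class M {R} f) (qs_class M {R} (\<lambda>x. 0))) = L1_norm R (qs_class M {R} f)"
      by (simp add: qs_map2_class[OF fm[OF f(1)]])
    also have "\<dots> = (\<integral>\<^sup>+x. ennreal \<bar>f x\<bar> \<partial>R)"
      unfolding L1_norm_def
    proof (rule nn_integral_cong_AE)
      have "AE x in R. rep (qs_class M {R} f) x = f x" using rep_qs_class_AE[OF fm[OF f(1)], of R "{R}"] by simp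
      then show "AE x in R. ennreal \<bar>rep (qs_class M {R} f) x\<bar> = ennreal \<bar>f x\<bar>" by eventually_elim simp
    qed
    also have "\<dots> = ennreal (\<integral>x. \<bar>f x\<bar> \<partial>R)"
      using f(1) by (intro nn_integral_eq_integral) auto
    also have "\<dots> < ennreal d" using f(2) d by (intro ennreal_lessI)
    finally show ?thesis using cont[OF L1[OF f(1)]] zero by simp
  qed
  have bound: "\<bar>?l f\<bar> \<le> 2 / d * (\<integral>x. \<bar>f x\<bar> \<partial>R)" if f: "integrable R f" for f
  proof (rule field_le_epsilon)
    fix e :: real assume e: "0 < e"
    define a where "a = (\<integral>x. \<bar>f x\<bar> \<partial>R)"
    have a: "0 \<le> a" unfolding a_def by simp
    \<comment> \<open>Chosen so that \<open>1 / c\<close> equals \<open>2 / d * a + e\<close>. The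
      term \<open>d * e\<close> keeps the denominator positive when \<open>a = 0\<close>.\<close>
    define c where "c = d / (2 * a + d * e)"
    have de: "0 < d * e" using d e by simp
    then have den: "0 < 2 * a + d * e" using a by linarith
    have c: "0 < c" using d den by (simp add: c_def)
    have "c * a < d"
    proof -
      have "c * a = d * (a / (2 * a + d * e))" by (simp add: c_def)
      also have "a / (2 * a + d * e) < 1" unfolding pos_divide_less_eq[OF den] mult_1 using a de by linarith
      finally show ?thesis using d by (simp add: mult_strict_left_mono)
    qed
    moreover have "(\<integral>x. \<bar>c * f x\<bar> \<partial>R) = c * a" using c by (simp add: abs_mult a_def)
    ultimately have "\<bar>?l (\<lambda>x. c * f x)\<bar> < 1" using f by (intro small) auto
    then have "c * \<bar>?l f\<bar> < 1" using c by (simp add: scale[OF f] abs_mult)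
    then have "\<bar>?l f\<bar> < 1 / c" using c by (simp add: field_simps)
    also have "1 / c = 2 / d * a + e" using d by (simp add: c_def field_simps)
    finally show "\<bar>?l f\<bar> \<le> 2 / d * (\<integral>x. \<bar>f x\<bar> \<partial>R) + e" by (simp add: a_def)
  qed
  define L where "L f = l (qs_class M {R} f)" for f
  have "\<exists>h\<in>borel_measurable R. (\<exists>c. \<forall>x. \<bar>h x\<bar> \<le> c) \<and> (\<forall>f. integrable R f \<longrightarrow> L f = (\<integral>x. f x * h x \<partial>R))"
  proof (rule bounded_functional_on_integrable[OF R(1)])
    fix f g :: "'a \<Rightarrow> real" and c assume "integrable R f"
    then show "L (\<lambda>x. c * f x) = c * L f" "\<bar>L f\<bar> \<le> 2 / d * (\<integral>x. \<bar>f x\<bar> \<partial>R)"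
      unfolding L_def by (rule scale, rule bound)
    assume "integrable R g"
    with \<open>integrable R f\<close> show "L (\<lambda>x. f x + g x) = L f + L g"
      unfolding L_def by (rule add)
  qed
  then show ?thesis by (simp only: bm L_def)
qed

section \<open>Weak compactness of the dual unit ball\<close>

lemma norm_continuous_subset:
  assumes c: "norm_continuous M P n V l" and W: "W \<subseteq> V"
  shows "norm_continuous M P n W l"
  unfolding norm_continuous_def
proof (intro ballI allI impI)
  fix Y and e :: real assume "Y \<in> W" "0 < e"
  then have "Y \<in> V" using W by blast
  with c \<open>0 < e\<close> obtain d where "0 < d" "\<forall>Z\<in>V. n (qs_diff M P Z Y) < ennreal d \<longrightarrow> \<bar>l Z - l Y\<bar> < e"
    unfolding norm_continuous_def by blast
  with W show "\<exists>d>0. \<forall>Z\<in>W. n (qs_diff M P Z Y) < ennreal d \<longrightarrow> \<bar>l Z - l Y\<bar> < e" by blast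
qed

lemma ca_on_antimono:
  assumes "W \<subseteq> V"
  shows "ca_on M P \<Phi> V \<subseteq> ca_on M P \<Phi> W"
proof
  fix \<mu> assume "\<mu> \<in> ca_on M P \<Phi> V"
  then have \<mu>: "\<mu> \<in> ca M" "ca_dominated M {\<mu>} (measure ` P)" "\<forall>Y\<in>V. \<forall>f\<in>Y. integrable (variation M \<mu>) f"
    and c: "norm_continuous M P (Orlicz_norm P \<Phi>) V (\<lambda>Y. \<integral>x. rep Y x \<partial>variation M \<mu>)"
    by (simp_all add: ca_on_def)
  have "\<forall>Y\<in>W. \<forall>f\<in>Y. integrable (variation M \<mu>) f" using \<mu>(3) assms by blast
  with \<mu>(1,2) norm_continuous_subset[OF c assms] show "\<mu> \<in> ca_on M P \<Phi> W" by (simp add: ca_on_def)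
qed

section \<open>Functionals on bounded functions\<close>

context orlicz_ideal
begin

definition Bdd :: "('a \<Rightarrow> real) set" where
  "Bdd = {h \<in> borel_measurable M. \<exists>c. \<forall>x\<in>space M. \<bar>h x\<bar> \<le> c}"

lemma Bdd_measurable: "h \<in> Bdd \<Longrightarrow> h \<in> borel_measurable M"
  by (simp add: Bdd_def)

lemma BddI: "h \<in> borel_measurable M \<Longrightarrow> (\<And>x. x \<in> space M \<Longrightarrow> \<bar>h x\<bar> \<le> c) \<Longrightarrow> h \<in> Bdd"
  by (auto simp: Bdd_def)

lemma BddE:
  assumes "h \<in> Bdd"
  obtains c where "0 \<le> c" "\<And>x. x \<in> space M \<Longrightarrow> \<bar>h x\<bar> \<le> c"
proof -
  obtain c where "\<forall>x\<in>space M. \<bar>h x\<bar> \<le> c" using assms by (auto simp: Bdd_def)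
  then show thesis using that[of "\<bar>c\<bar>"] by (meson abs_ge_self abs_ge_zero order_trans)
qed

lemma Bdd_CF: "h \<in> Bdd \<Longrightarrow> h \<in> CF"
  by (auto simp: Bdd_def intro: CF_bounded)

lemma Bdd_add:
  assumes "h \<in> Bdd" "k \<in> Bdd"
  shows "(\<lambda>x. h x + k x) \<in> Bdd"
proof -
  obtain c d where c: "\<And>x. x \<in> space M \<Longrightarrow> \<bar>h x\<bar> \<le> c" and d: "\<And>x. x \<in> space M \<Longrightarrow> \<bar>k x\<bar> \<le> d"
    using assms by (elim BddE) blast
  show ?thesis
  proof (rule BddI[of _ "c + d"])
    show "\<bar>h x + k x\<bar> \<le> c + d" if "x \<in> space M" for x using c[OF that] d[OF that] by linarith
    show "(\<lambda>x. h x + k x) \<in> borel_measurable M"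
      using Bdd_measurable[OF assms(1)] Bdd_measurable[OF assms(2)] by (rule borel_measurable_add)
  qed
qed

lemma Bdd_scale:
  assumes "h \<in> Bdd"
  shows "(\<lambda>x. c * h x) \<in> Bdd"
proof -
  obtain d where d: "\<And>x. x \<in> space M \<Longrightarrow> \<bar>h x\<bar> \<le> d" using assms by (elim BddE) blast
  show ?thesis
    by (rule BddI[of _ "\<bar>c\<bar> * d"]) (use assms d in \<open>auto simp: abs_mult mult_left_mono dest: Bdd_measurable\<close>)
qed

lemma Bdd_indicator: "A \<in> sets M \<Longrightarrow> indicator A \<in> Bdd"
  by (rule BddI[of _ 1]) (auto simp: indicator_def)

text \<open>The dual unit ball, as a set of functionals on bounded functions. They are extended by
  \<open>0\<close> to all functions in order to apply Tychonoff's theorem in a product space.\<close>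

definition functionals :: "(('a \<Rightarrow> real) \<Rightarrow> real) set" where
  "functionals =
     {l. \<forall>h. l h \<in> (if h \<in> Bdd then {- enn2real (N h)..enn2real (N h)} else {0})}
     \<inter> {l. \<forall>h\<in>Bdd. \<forall>k\<in>Bdd. l (\<lambda>x. h x + k x) = l h + l k}
     \<inter> {l. \<forall>c. \<forall>h\<in>Bdd. l (\<lambda>x. c * h x) = c * l h}"

text \<open>The bounds cut out a product of compact intervals. Additivity and homogeneity are
  families of equations between finitely many coordinates each, hence closed in the product
  topology.\<close>

lemma compact_functionals: "compact functionals"
  unfolding functionals_def
proof (intro compact_Int_closed)
  let ?I = "\<lambda>h. if h \<in> Bdd then {- enn2real (N h)..enn2real (N h)} else {0}"
  have "compactin (product_topology (\<lambda>_. euclidean) UNIV) (PiE UNIV ?I)"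
    unfolding compactin_PiE by (auto simp: compact_Icc)
  then have "compact (PiE UNIV ?I)" unfolding euclidean_product_topology by simp
  moreover have "PiE UNIV ?I = {l. \<forall>h. l h \<in> ?I h}" by (simp only: PiE_UNIV_domain Pi_def UNIV_I simp_thms)
  ultimately show "compact {l. \<forall>h. l h \<in> ?I h}" by (simp only:)
  show "closed {l :: ('a \<Rightarrow> real) \<Rightarrow> real. \<forall>h\<in>Bdd. \<forall>k\<in>Bdd. l (\<lambda>x. h x + k x) = l h + l k}"
    unfolding Ball_def
    by (intro closed_Collect_all closed_Collect_imp closed_Collect_eq open_Collect_const
          continuous_on_add continuous_on_product_coordinates)
  show "closed {l :: ('a \<Rightarrow> real) \<Rightarrow> real. \<forall>c. \<forall>h\<in>Bdd. l (\<lambda>x. c * h x) = c * l h}"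
    unfolding Ball_def
    by (intro closed_Collect_all closed_Collect_imp closed_Collect_eq open_Collect_const
          continuous_on_mult_left continuous_on_product_coordinates)
qed

text \<open>Bounded functions have finite norm, so \<open>enn2real\<close> loses nothing in the
  intervals.\<close>

lemma functionals_iff:
  "l \<in> functionals \<longleftrightarrow> (\<forall>h\<in>Bdd. ennreal \<bar>l h\<bar> \<le> N h) \<and> (\<forall>h. h \<notin> Bdd \<longrightarrow> l h = 0)
     \<and> (\<forall>h\<in>Bdd. \<forall>k\<in>Bdd. l (\<lambda>x. h x + k x) = l h + l k) \<and> (\<forall>c. \<forall>h\<in>Bdd. l (\<lambda>x. c * h x) = c * l h)"
proof -
  have e: "ennreal \<bar>l h\<bar> \<le> N h \<longleftrightarrow> l h \<in> {- enn2real (N h)..enn2real (N h)}" if "h \<in> Bdd" for h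
  proof -
    have "N h < top" using CF_finite[OF Bdd_CF[OF that]] by simp
    then obtain r where "N h = ennreal r" "0 \<le> r" by (cases "N h") auto
    then show ?thesis by (auto simp: abs_le_iff)
  qed
  show ?thesis unfolding functionals_def by (auto simp: e)
qed

lemma functional_bound: "l \<in> functionals \<Longrightarrow> h \<in> Bdd \<Longrightarrow> ennreal \<bar>l h\<bar> \<le> N h"
  and functional_add: "l \<in> functionals \<Longrightarrow> h \<in> Bdd \<Longrightarrow> k \<in> Bdd \<Longrightarrow> l (\<lambda>x. h x + k x) = l h + l k"
  and functional_scale: "l \<in> functionals \<Longrightarrow> h \<in> Bdd \<Longrightarrow> l (\<lambda>x. c * h x) = c * l h"
  by (auto simp: functionals_iff)

definition charge :: "(('a \<Rightarrow> real) \<Rightarrow> real) \<Rightarrow> 'a set \<Rightarrow> real" where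
  "charge l A = (if A \<in> sets M then l (indicator A) else 0)"

text \<open>Order continuity, applied to the constant 1, makes the norms of indicators of sets
  decreasing to the empty set tend to 0; a functional of the ball is bounded by the norm.\<close>

lemma signed_measure_charge:
  assumes l: "l \<in> functionals"
  shows "signed_measure M (charge l)"
proof (rule signed_measureI)
  fix A B assume AB: "A \<in> sets M" "B \<in> sets M" "A \<inter> B = {}"
  then have "indicator (A \<union> B) = (\<lambda>x. indicator A x + indicator B x :: real)"
    by (auto simp: fun_eq_iff indicator_def)
  then show "charge l (A \<union> B) = charge l A + charge l B"
    using AB functional_add[OF l Bdd_indicator[OF AB(1)] Bdd_indicator[OF AB(2)]] by (simp add: charge_def)
next
  fix E :: "nat \<Rightarrow> 'a set" assume E: "\<And>n. E n \<in> sets M" "decseq E" "(\<Inter>n. E n) = {}"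
  show "(\<lambda>n. charge l (E n)) \<longlonglongrightarrow> 0"
  proof (rule LIMSEQ_I)
    fix r :: real assume r: "0 < r"
    obtain n where n: "N (\<lambda>x. 1 * indicator (E n) x) < ennreal r"
      using order_continuous[OF CF_const E r] by blast
    have "norm (charge l (E m) - 0) < r" if m: "n \<le> m" for m
    proof -
      have "ennreal \<bar>l (indicator (E m))\<bar> \<le> N (indicator (E m))"
        by (rule functional_bound[OF l Bdd_indicator[OF E(1)]])
      also have "\<dots> \<le> N (\<lambda>x. 1 * indicator (E n) x)"
        by (rule N_mono, rule AE_I2) (use decseqD[OF E(2) m] in \<open>auto simp: indicator_def\<close>)
      finally have "ennreal \<bar>l (indicator (E m))\<bar> < ennreal r" using n by (rule le_less_trans)
      then show ?thesis using E(1) by (simp add: charge_def ennreal_less_iff)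
    qed
    then show "\<exists>no. \<forall>m\<ge>no. norm (charge l (E m) - 0) < r" by blast
  qed
qed (simp add: charge_def)

end

section \<open>The unit ball through densities, and its weak compactness\<close>

context represented_ideal
begin

lemma ca_dominated_iff:
  "ca_dominated M {\<mu>} (measure ` P) \<longleftrightarrow> (\<forall>A\<in>sets M. emeasure R A = 0 \<longrightarrow> emeasure (variation M \<mu>) A = 0)"
proof -
  have "(SUP \<nu>\<in>measure ` P. emeasure (variation M \<nu>) A) = 0 \<longleftrightarrow> emeasure R A = 0" if A: "A \<in> sets M" for A
  proof -
    have v: "variation M (measure Q) = Q" if "Q \<in> P" for Q
      using that prob_P sets_P by (intro variation_finite_measure) (auto dest: prob_space.finite_measure)
    have "(SUP \<nu>\<in>measure ` P. emeasure (variation M \<nu>) A) = 0 \<longleftrightarrow> (\<forall>Q\<in>P. emeasure (variation M (measure Q)) A = 0)"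
      unfolding le_zero_eq[symmetric] SUP_le_iff by simp
    also have "\<dots> \<longleftrightarrow> (\<forall>Q\<in>P. emeasure Q A = 0)" by (intro ball_cong refl) (simp add: v)
    also have "\<dots> \<longleftrightarrow> emeasure R A = 0" using polar_imp_R_null[OF A] R_null_imp_polar[OF A] by blast
    finally show ?thesis .
  qed
  then show ?thesis by (auto simp: ca_dominated_def)
qed

definition has_density :: "('a set \<Rightarrow> real) \<Rightarrow> ('a \<Rightarrow> real) \<Rightarrow> bool" where
  "has_density \<mu> g \<longleftrightarrow> integrable R g \<and> (\<forall>A\<in>sets M. \<mu> A = (\<integral>x. indicator A x * g x \<partial>R)) \<and> (\<forall>A. A \<notin> sets M \<longrightarrow> \<mu> A = 0)"

lemma has_densityD:
  assumes "has_density \<mu> g"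
  shows "integrable R g" "A \<in> sets M \<Longrightarrow> \<mu> A = (\<integral>x. indicator A x * g x \<partial>R)" "A \<notin> sets M \<Longrightarrow> \<mu> A = 0"
    "g \<in> borel_measurable M"
  using assms borel_measurable_integrable[of R g] by (auto simp: has_density_def measurable_R)

lemma ex_density:
  assumes \<mu>: "\<mu> \<in> ca M" and dom: "ca_dominated M {\<mu>} (measure ` P)"
  shows "\<exists>g. has_density \<mu> g"
  using signed_Radon_Nikodym[of M \<mu> R] assms R.finite_measure_axioms sets_R
  by (auto simp: ca_iff ca_dominated_iff has_density_def signed_measure_def)

lemma integrable_Bdd_mult:
  assumes h: "h \<in> Bdd" and g: "integrable R g"
  shows "integrable R (\<lambda>x. h x * g x)"
proof -
  obtain c where c: "0 \<le> c" "\<And>x. x \<in> space M \<Longrightarrow> \<bar>h x\<bar> \<le> c" using h by (rule BddE) blast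
  have "h \<in> borel_measurable R" using Bdd_measurable[OF h] by (simp add: measurable_R)
  then show ?thesis
  proof (intro Bochner_Integration.integrable_bound[OF integrable_mult_right[OF g, of c]] AE_I2)
    fix x assume "x \<in> space R"
    then have "\<bar>h x\<bar> \<le> c" using c(2) space_R by simp
    from mult_right_mono[OF this, of "\<bar>g x\<bar>"] show "norm (h x * g x) \<le> norm (c * g x)"
      using c(1) by (simp add: abs_mult)
  qed (use g in auto)
qed

text \<open>Testing with \<open>|f|\<close> times the sign of \<open>g\<close>, restricted to the
  set where \<open>|f| \<le> n\<close>, turns a bound on signed integrals into one on the integral
  of \<open>|f * g|\<close>. Monotone convergence removes the truncation, so bounded tests control
  all of \<open>CF\<close>.\<close>

lemma nn_integral_density_le:
  assumes g: "integrable R g" and b: "\<And>h. h \<in> Bdd \<Longrightarrow> ennreal \<bar>\<integral>x. h x * g x \<partial>R\<bar> \<le> N h" and f: "f \<in> CF"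
  shows "(\<integral>\<^sup>+x. ennreal \<bar>f x * g x\<bar> \<partial>R) \<le> N f"
proof -
  have gm: "g \<in> borel_measurable M" using borel_measurable_integrable[OF g] by (simp add: measurable_R)
  note [measurable] = gm CF_measurable[OF f]
  define A where "A n = {x \<in> space M. \<bar>f x\<bar> \<le> real n}" for n
  have A [measurable]: "A n \<in> sets M" for n unfolding A_def by measurable
  define k where "k n x = \<bar>f x\<bar> * sgn (g x) * indicator (A n) x" for n x
  have k_meas: "k n \<in> borel_measurable M" for n unfolding k_def by measurable
  have k: "k n \<in> Bdd" for n
    by (rule BddI[of _ "real n", OF k_meas]) (auto simp: k_def A_def abs_mult abs_sgn_eq indicator_def)
  let ?F = "\<lambda>n x. ennreal (\<bar>f x * g x\<bar> * indicator (A n) x)"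
  have kg: "k n x * g x = \<bar>f x * g x\<bar> * indicator (A n) x" for n x
    by (simp add: k_def abs_mult abs_sgn[of "g x"])
  have le: "(\<integral>\<^sup>+x. ?F n x \<partial>R) \<le> N f" for n
  proof -
    have "(\<integral>\<^sup>+x. ?F n x \<partial>R) = ennreal (\<integral>x. k n x * g x \<partial>R)"
      unfolding kg[symmetric]
      by (rule nn_integral_eq_integral[OF integrable_Bdd_mult[OF k g]]) (simp add: kg)
    also have "\<dots> \<le> ennreal \<bar>\<integral>x. k n x * g x \<partial>R\<bar>" by (rule ennreal_leI) simp
    also have "\<dots> \<le> N (k n)" by (rule b[OF k])
    also have "\<dots> \<le> N f"
      by (rule N_mono, rule AE_I2) (auto simp: k_def abs_mult abs_sgn_eq indicator_def)
    finally show ?thesis .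
  qed
  have "(\<integral>\<^sup>+x. ennreal \<bar>f x * g x\<bar> \<partial>R) \<le> (\<integral>\<^sup>+x. (SUP n. ?F n x) \<partial>R)"
  proof (rule nn_integral_mono)
    fix x assume "x \<in> space R"
    then have "x \<in> A (nat \<lceil>\<bar>f x\<bar>\<rceil>)" using space_R by (simp add: A_def of_nat_ceiling)
    then show "ennreal \<bar>f x * g x\<bar> \<le> (SUP n. ?F n x)"
      by (intro SUP_upper2[of "nat \<lceil>\<bar>f x\<bar>\<rceil>"]) auto
  qed
  also have "\<dots> = (SUP n. \<integral>\<^sup>+x. ?F n x \<partial>R)"
  proof (rule nn_integral_monotone_convergence_SUP)
    show "incseq ?F"
    proof (rule incseq_SucI, rule le_funI)
      show "?F n x \<le> ?F (Suc n) x" for n x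
        by (intro ennreal_leI) (auto simp: A_def indicator_def)
    qed
    show "?F n \<in> borel_measurable R" for n unfolding measurable_R by measurable
  qed
  also have "\<dots> \<le> N f" by (rule SUP_least) (rule le)
  finally show ?thesis .
qed

lemma signed_integral_has_density:
  assumes d: "has_density \<mu> g" and f: "f \<in> borel_measurable M" "integrable R (\<lambda>x. f x * g x)"
  shows "signed_integral M \<mu> f = (\<integral>x. f x * g x \<partial>R)"
  by (rule signed_integral_density[OF sets_R]) (use has_densityD[OF d] f in auto)

text \<open>Once the test inequality covers absolute values and all of \<open>CF\<close>, it yields
  integrability of every representative, norm continuity and the dual norm bound.\<close>

lemma unit_ballI:
  assumes d: "has_density \<mu> g" and b: "\<And>h. h \<in> Bdd \<Longrightarrow> ennreal \<bar>\<integral>x. h x * g x \<partial>R\<bar> \<le> N h"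
  shows "\<mu> \<in> ca_unit_ball M P \<Phi> C"
proof -
  note g = has_densityD[OF d]
  note [measurable] = g(4)
  have gR [measurable]: "g \<in> borel_measurable R" using g(4) by (simp add: measurable_R)
  have v: "variation M \<mu> = density R (\<lambda>x. ennreal \<bar>g x\<bar>)"
    by (rule variation_density[OF sets_R g(1)]) (use g in auto)
  have ev: "emeasure (variation M \<mu>) A = (\<integral>\<^sup>+x. ennreal \<bar>g x\<bar> * indicator A x \<partial>R)" if "A \<in> sets M" for A
    unfolding v using that sets_R by (intro emeasure_density) auto
  have fin: "emeasure (variation M \<mu>) (space M) < \<infinity>"
  proof -
    have "emeasure (variation M \<mu>) (space M) = (\<integral>\<^sup>+x. ennreal (norm (g x)) \<partial>R)"
      unfolding ev[OF sets.top] by (rule nn_integral_cong) (simp add: space_R)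
    then show ?thesis using g(1) by (simp add: integrable_iff_bounded)
  qed
  have sm: "signed_measure M \<mu>" by (rule signed_measure_density[OF sets_R g(1)]) (use g in auto)
  have dom: "ca_dominated M {\<mu>} (measure ` P)"
    unfolding ca_dominated_iff
  proof (intro ballI impI)
    fix A assume A: "A \<in> sets M" "emeasure R A = 0"
    then have "A \<in> null_sets R" using sets_R by auto
    then have "AE x in R. ennreal \<bar>g x\<bar> * indicator A x = 0"
      by (auto dest!: AE_not_in elim!: eventually_mono)
    then show "emeasure (variation M \<mu>) A = 0"
      unfolding ev[OF A(1)] by (subst nn_integral_0_iff_AE) (use A sets_R in auto)
  qed
  have fg: "integrable R (\<lambda>x. f x * g x)" if f: "f \<in> CF" for f
  proof (rule integrableI_bounded)
    show "(\<lambda>x. f x * g x) \<in> borel_measurable R"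
      using CF_measurable[OF f] gR by (auto simp: measurable_R)
    have "(\<integral>\<^sup>+x. ennreal (norm (f x * g x)) \<partial>R) \<le> N f" using nn_integral_density_le[OF g(1) b f] by simp
    also have "\<dots> < \<infinity>" by (rule CF_finite[OF f])
    finally show "(\<integral>\<^sup>+x. ennreal (norm (f x * g x)) \<partial>R) < \<infinity>" .
  qed
  have fR: "f \<in> borel_measurable R" if "f \<in> CF" for f using CF_measurable[OF that] by (simp add: measurable_R)
  have fg': "integrable R (\<lambda>x. \<bar>g x\<bar> * f x)" if "f \<in> CF" for f
    by (rule Bochner_Integration.integrable_bound[OF fg[OF that]])
      (use fR[OF that] in \<open>auto simp: abs_mult mult.commute\<close>)
  have int_v: "integrable (variation M \<mu>) f" if f: "f \<in> CF" for f
    unfolding v using fg'[OF f] fR[OF f] by (subst integrable_density) auto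
  have lint_v: "(\<integral>x. f x \<partial>variation M \<mu>) = (\<integral>x. \<bar>g x\<bar> * f x \<partial>R)" if f: "f \<in> CF" for f
    unfolding v using fR[OF f] by (subst integral_density) auto
  have cont: "norm_continuous M P (Orlicz_norm P \<Phi>) C (\<lambda>Y. \<integral>x. rep Y x \<partial>variation M \<mu>)"
    unfolding norm_continuous_def
  proof (intro ballI allI impI)
    fix Y and e :: real assume Y: "Y \<in> C" and e: "0 < e"
    show "\<exists>d>0. \<forall>Z\<in>C. Orlicz_norm P \<Phi> (qs_diff M P Z Y) < ennreal d \<longrightarrow>
        \<bar>(\<integral>x. rep Z x \<partial>variation M \<mu>) - (\<integral>x. rep Y x \<partial>variation M \<mu>)\<bar> < e"
    \<comment> \<open>Integration against the variation is Lipschitz with constant 1, so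
      \<open>e\<close> itself serves as the radius.\<close>
    proof (intro exI[of _ e] conjI e ballI impI)
      fix Z assume Z: "Z \<in> C" and small: "Orlicz_norm P \<Phi> (qs_diff M P Z Y) < ennreal e"
      note rZ = rep_in_CF[OF Z] and rY = rep_in_CF[OF Y]
      have diff: "(\<lambda>x. rep Z x - rep Y x) \<in> CF" by (rule CF_diff[OF rZ rY])
      have "Orlicz_norm P \<Phi> (qs_diff M P Z Y) = N (\<lambda>x. rep Z x - rep Y x)"
        using Orlicz_norm_diff_class[OF CF_measurable[OF rZ] CF_measurable[OF rY]] Y Z C_subset_L0
        by (simp add: qs_class_rep subset_iff)
      with small have N_small: "N (\<lambda>x. rep Z x - rep Y x) < ennreal e" by simp
      have "(\<integral>x. rep Z x \<partial>variation M \<mu>) - (\<integral>x. rep Y x \<partial>variation M \<mu>) = (\<integral>x. \<bar>g x\<bar> * (rep Z x - rep Y x) \<partial>R)"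
        unfolding lint_v[OF rZ] lint_v[OF rY] right_diff_distrib
        by (rule Bochner_Integration.integral_diff[OF fg'[OF rZ] fg'[OF rY], symmetric])
      then have "ennreal \<bar>(\<integral>x. rep Z x \<partial>variation M \<mu>) - (\<integral>x. rep Y x \<partial>variation M \<mu>)\<bar>
          = ennreal (norm (\<integral>x. \<bar>g x\<bar> * (rep Z x - rep Y x) \<partial>R))" by simp
      also have "\<dots> \<le> (\<integral>\<^sup>+x. ennreal (norm (\<bar>g x\<bar> * (rep Z x - rep Y x))) \<partial>R)"
        by (rule integral_norm_bound_ennreal[OF fg'[OF diff]])
      also have "\<dots> = (\<integral>\<^sup>+x. ennreal \<bar>(rep Z x - rep Y x) * g x\<bar> \<partial>R)"
        by (simp add: abs_mult mult.commute)
      also have "\<dots> \<le> N (\<lambda>x. rep Z x - rep Y x)" by (rule nn_integral_density_le[OF g(1) b diff])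
      finally have "ennreal \<bar>(\<integral>x. rep Z x \<partial>variation M \<mu>) - (\<integral>x. rep Y x \<partial>variation M \<mu>)\<bar> < ennreal e"
        using N_small by (rule le_less_trans)
      then show "\<bar>(\<integral>x. rep Z x \<partial>variation M \<mu>) - (\<integral>x. rep Y x \<partial>variation M \<mu>)\<bar> < e"
        by (simp add: ennreal_less_iff)
    qed
  qed
  have "dual_norm M P \<Phi> C \<mu> \<le> 1"
    unfolding dual_norm_def
  proof (rule SUP_least)
    fix Y assume "Y \<in> {Y \<in> C. Orlicz_norm P \<Phi> Y \<le> 1}"
    then have Y: "Y \<in> C" "N (rep Y) \<le> 1" by (auto simp: Orlicz_norm_eq_Luxemburg)
    note rY = rep_in_CF[OF Y(1)]
    have "ennreal \<bar>signed_integral M \<mu> (rep Y)\<bar> = ennreal (norm (\<integral>x. rep Y x * g x \<partial>R))"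
      by (simp add: signed_integral_has_density[OF d CF_measurable[OF rY] fg[OF rY]])
    also have "\<dots> \<le> (\<integral>\<^sup>+x. ennreal (norm (rep Y x * g x)) \<partial>R)"
      by (rule integral_norm_bound_ennreal[OF fg[OF rY]])
    also have "\<dots> \<le> N (rep Y)" using nn_integral_density_le[OF g(1) b rY] by simp
    also have "\<dots> \<le> 1" by (rule Y(2))
    finally show "ennreal \<bar>signed_integral M \<mu> (rep Y)\<bar> \<le> 1" .
  qed
  then show ?thesis
    using sm fin dom cont int_v mem_class_in_CF by (auto simp: ca_unit_ball_def ca_on_def ca_iff)
qed

lemma unit_ball_bound:
  assumes \<mu>: "\<mu> \<in> ca_unit_ball M P \<Phi> C" and d: "has_density \<mu> g" and h: "h \<in> Bdd"
  shows "ennreal \<bar>\<integral>x. h x * g x \<partial>R\<bar> \<le> N h"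
proof -
  note g = has_densityD[OF d]
  obtain r where r: "N h = ennreal r" "0 \<le> r"
    using CF_finite[OF Bdd_CF[OF h]] by (cases "N h") auto
  have "ennreal \<bar>\<integral>x. h x * g x \<partial>R\<bar> \<le> ennreal r"
  \<comment> \<open>The norm \<open>r\<close> of \<open>h\<close> may be 0, so \<open>h\<close> is
    divided by an arbitrary \<open>s\<close> above it to obtain an admissible test element of the
    dual norm.\<close>
  proof (rule ennreal_le_of_forall_gt[OF _ r(2)])
    fix s assume s: "r < s"
    then have s0: "0 < s" using r(2) by simp
    let ?h = "\<lambda>x. inverse s * h x"
    have hB: "?h \<in> Bdd" by (rule Bdd_scale[OF h])
    note hm = Bdd_measurable[OF hB]
    have "N ?h \<le> ennreal (\<bar>inverse s\<bar> * s)"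
      using s r s0 by (intro N_scale) (auto simp: ennreal_less_iff)
    then have "Orlicz_norm P \<Phi> (cls ?h) \<le> 1" using s0 by (simp add: Orlicz_norm_class[OF hm])
    moreover have "cls ?h \<in> C" by (rule class_CF[OF Bdd_CF[OF hB]])
    ultimately have "ennreal \<bar>signed_integral M \<mu> (rep (cls ?h))\<bar> \<le> dual_norm M P \<Phi> C \<mu>"
      unfolding dual_norm_def by (intro SUP_upper) auto
    also have "\<dots> \<le> 1" using \<mu> by (simp add: ca_unit_ball_def)
    finally have le1: "ennreal \<bar>signed_integral M \<mu> (rep (cls ?h))\<bar> \<le> 1" .
    have rm: "rep (cls ?h) \<in> borel_measurable M" by (rule rep_qs_class_measurable[OF hm])
    have ae: "AE x in R. rep (cls ?h) x * g x = ?h x * g x"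
    proof -
      note [measurable] = rm hm
      have "AE x in R. rep (cls ?h) x = ?h x"
        by (rule qs_imp_AE_R, measurable) (rule rep_qs_class_AE[OF hm])
      then show ?thesis by eventually_elim simp
    qed
    have hg: "integrable R (\<lambda>x. ?h x * g x)" by (rule integrable_Bdd_mult[OF hB g(1)])
    have m: "(\<lambda>x. rep (cls ?h) x * g x) \<in> borel_measurable R" using rm g(4) by (simp add: measurable_R)
    have "signed_integral M \<mu> (rep (cls ?h)) = (\<integral>x. rep (cls ?h) x * g x \<partial>R)"
      by (rule signed_integral_has_density[OF d rm]) (use integrable_cong_AE[OF m _ ae] hg in auto)
    also have "\<dots> = (\<integral>x. ?h x * g x \<partial>R)" by (rule integral_cong_AE[OF m _ ae]) (use hg in auto)
    also have "\<dots> = inverse s * (\<integral>x. h x * g x \<partial>R)" by (simp add: mult.assoc)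
    finally have "\<bar>inverse s * (\<integral>x. h x * g x \<partial>R)\<bar> \<le> 1" using le1 by simp
    then have "\<bar>\<integral>x. h x * g x \<partial>R\<bar> \<le> s" using s0 by (simp add: abs_mult field_simps)
    then show "ennreal \<bar>\<integral>x. h x * g x \<partial>R\<bar> \<le> ennreal s" by (rule ennreal_leI)
  qed
  with r show ?thesis by simp
qed

text \<open>\<open>charge l\<close> only remembers \<open>l\<close> on indicators. The difference
  \<open>T\<close> between \<open>l\<close> and integration against the density vanishes there and
  is bounded by a multiple of the uniform norm, so approximation by simple functions makes it vanish
  on all bounded functions.\<close>

lemma functional_density:
  assumes l: "l \<in> functionals"
  shows "\<exists>g. has_density (charge l) g \<and> (\<forall>h\<in>Bdd. l h = (\<integral>x. h x * g x \<partial>R))"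
proof -
  note sm = signed_measure_charge[OF l]
  obtain L where L: "0 < L" "N (\<lambda>x. 1) < ennreal L" using CF_finite[OF CF_const[of 1]] by (rule ennreal_less_realE)
  have bound: "\<bar>l h\<bar> \<le> c * L" if h: "h \<in> Bdd" and c: "0 \<le> c" "\<And>x. x \<in> space M \<Longrightarrow> \<bar>h x\<bar> \<le> c" for h c
  proof -
    have "ennreal \<bar>l h\<bar> \<le> N h" by (rule functional_bound[OF l h])
    also have "\<dots> \<le> N (\<lambda>x. c * 1)" using c by (intro N_mono AE_I2) (auto simp: space_P)
    also have "\<dots> \<le> ennreal (\<bar>c\<bar> * L)" by (rule N_scale[OF L(2,1)])
    finally show ?thesis using c(1) L(1) by simp
  qed
  have cb: "\<bar>charge l B\<bar> \<le> 1 * L" if "B \<in> sets M" for B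
    using bound[OF Bdd_indicator[OF that], of 1] that by (auto simp: charge_def indicator_def)
  have "emeasure (variation M (charge l)) (space M) \<le> ennreal (1 * L) + ennreal (1 * L)"
    by (rule variation_le_bound[OF sm sets.top]) (rule cb)
  also have "\<dots> < \<infinity>" by (auto simp: less_top[symmetric])
  finally have "charge l \<in> ca M" using sm by (simp add: ca_iff)
  moreover have "ca_dominated M {charge l} (measure ` P)"
    unfolding ca_dominated_iff
  proof (intro ballI impI)
    fix A assume A: "A \<in> sets M" "emeasure R A = 0"
    \<comment> \<open>Subsets of an \<open>R\<close>-null set are null for the whole family; their
      indicators have norm 0 and \<open>l\<close> vanishes on them.\<close>
    have "emeasure (variation M (charge l)) A \<le> ennreal 0 + ennreal 0"
    proof (rule variation_le_bound[OF sm A(1)])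
      fix B assume B: "B \<in> sets M" "B \<subseteq> A"
      have "N (indicator B) = 0"
      proof (rule N_eq_0)
        fix Q assume Q: "Q \<in> P"
        have "A \<in> null_sets Q" using R_null_imp_polar[OF A Q] A(1) sets_P[OF Q] by auto
        then have "AE x in Q. x \<notin> A" by (rule AE_not_in)
        then show "AE x in Q. indicator B x = (0::real)" by eventually_elim (use B in \<open>auto simp: indicator_def\<close>)
      qed
      then show "\<bar>charge l B\<bar> \<le> 0" using functional_bound[OF l Bdd_indicator[OF B(1)]] B(1) by (simp add: charge_def)
    qed
    then show "emeasure (variation M (charge l)) A = 0" by simp
  qed
  ultimately obtain g where g: "has_density (charge l) g" using ex_density by blast
  note gD = has_densityD[OF g]
  define T where "T h = l h - (\<integral>x. h x * g x \<partial>R)" for h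
  have T_add: "T (\<lambda>x. h x + k x) = T h + T k" if "h \<in> Bdd" "k \<in> Bdd" for h k
    using functional_add[OF l that] integrable_Bdd_mult[OF that(1) gD(1)] integrable_Bdd_mult[OF that(2) gD(1)]
    by (simp add: T_def distrib_right)
  have T_scale: "T (\<lambda>x. c * h x) = c * T h" if "h \<in> Bdd" for h c
    using functional_scale[OF l that] by (simp add: T_def mult.assoc right_diff_distrib)
  have T_ind: "T (indicator A) = 0" if "A \<in> sets M" for A
    using gD(2)[OF that] that by (simp add: T_def charge_def)
  have T_zero: "T (\<lambda>x. 0) = 0" using T_scale[OF Bdd_indicator[OF sets.empty_sets], of 0] by simp
  have T_sum: "(\<lambda>x. \<Sum>j\<in>S. a j * indicator (A j) x) \<in> Bdd \<and> T (\<lambda>x. \<Sum>j\<in>S. a j * indicator (A j) x) = 0"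
    if "finite S" "\<And>j. A j \<in> sets M" for S and a :: "int \<Rightarrow> real" and A
    using that(1)
  proof (induction S)
    case empty
    then show ?case by (auto simp: T_zero intro!: BddI[of _ 0])
  next
    case (insert j S)
    note i = Bdd_scale[OF Bdd_indicator[OF that(2)[of j]], of "a j"]
    note k = conjunct1[OF insert.IH]
    show ?case
      unfolding sum.insert[OF insert.hyps] T_add[OF i k] T_scale[OF Bdd_indicator[OF that(2)]] T_ind[OF that(2)]
      using Bdd_add[OF i k] conjunct2[OF insert.IH] by (simp only: mult_zero_right add_0_left)
  qed
  define K where "K = L + (\<integral>x. \<bar>g x\<bar> \<partial>R)"
  have T_bound: "\<bar>T h\<bar> \<le> c * K" if h: "h \<in> Bdd" and c: "0 \<le> c" "\<And>x. x \<in> space M \<Longrightarrow> \<bar>h x\<bar> \<le> c" for h c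
  proof -
    have "\<bar>\<integral>x. h x * g x \<partial>R\<bar> \<le> (\<integral>x. \<bar>h x * g x\<bar> \<partial>R)" by (rule integral_abs_bound)
    also have "\<dots> \<le> (\<integral>x. c * \<bar>g x\<bar> \<partial>R)"
    proof (rule integral_mono)
      show "\<bar>h x * g x\<bar> \<le> c * \<bar>g x\<bar>" if "x \<in> space R" for x
        using c(2)[of x] that space_R by (simp add: abs_mult mult_right_mono)
    qed (use integrable_Bdd_mult[OF h gD(1)] gD(1) in auto)
    finally show ?thesis using bound[OF h c] by (simp add: T_def K_def distrib_left)
  qed
  have "l h = (\<integral>x. h x * g x \<partial>R)" if h: "h \<in> Bdd" for h
  proof -
    obtain c where c: "0 \<le> c" "\<And>x. x \<in> space M \<Longrightarrow> \<bar>h x\<bar> \<le> c" using h by (rule BddE) blast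
    note [measurable] = Bdd_measurable[OF h]
    have small: "\<bar>T h\<bar> \<le> K / real (Suc m)" for m
    proof -
      define n where "n = real (Suc m)"
      have n: "0 < n" by (simp add: n_def)
      \<comment> \<open>Layers of \<open>h\<close> of height \<open>1 / n\<close>: below,
        \<open>s\<close> rounds \<open>h\<close> down to a multiple of \<open>1 / n\<close>. As
        \<open>h\<close> is bounded, only layers with index in the finite set \<open>S\<close> can
        be nonempty.\<close>
      define A where "A j = {x \<in> space M. \<lfloor>n * h x\<rfloor> = j}" for j
      have A: "A j \<in> sets M" for j unfolding A_def by measurable
      define S where "S = {\<lfloor>- (n * c)\<rfloor>..\<lfloor>n * c\<rfloor>}"
      define s where "s x = (\<Sum>j\<in>S. (of_int j / n) * indicator (A j) x)" for x
      have s: "s \<in> Bdd" "T s = 0"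
        using T_sum[of S A "\<lambda>j. of_int j / n", OF _ A] by (auto simp: s_def[abs_def] S_def)
      have near: "\<bar>h x - s x\<bar> \<le> 1 / n" if x: "x \<in> space M" for x
      proof -
        have "- c \<le> h x" "h x \<le> c" using c(2)[OF x] by linarith+
        then have "n * - c \<le> n * h x" "n * h x \<le> n * c" using n by (simp_all only: mult_left_mono less_imp_le)
        then have "\<lfloor>n * h x\<rfloor> \<in> S" by (auto simp: S_def intro: floor_mono)
        have "s x = (\<Sum>j\<in>S. if j = \<lfloor>n * h x\<rfloor> then of_int j / n else 0)"
          unfolding s_def using x by (intro sum.cong) (auto simp: A_def indicator_def)
        also have "\<dots> = of_int \<lfloor>n * h x\<rfloor> / n" using \<open>\<lfloor>n * h x\<rfloor> \<in> S\<close> by (simp add: S_def)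
        finally have "h x - s x = (n * h x - of_int \<lfloor>n * h x\<rfloor>) / n" using n by (simp add: diff_divide_distrib)
        moreover have "0 \<le> n * h x - of_int \<lfloor>n * h x\<rfloor>" "n * h x - of_int \<lfloor>n * h x\<rfloor> \<le> 1" by linarith+
        ultimately show ?thesis using n by (simp add: divide_right_mono)
      qed
      have s': "(\<lambda>x. (-1) * s x) \<in> Bdd" by (rule Bdd_scale[OF s(1)])
      have "\<bar>T (\<lambda>x. h x + (-1) * s x)\<bar> \<le> (1 / n) * K"
        using near n by (intro T_bound[OF Bdd_add[OF h s']]) auto
      moreover have "T (\<lambda>x. h x + (-1) * s x) = T h"
        unfolding T_add[OF h s'] T_scale[OF s(1)] using s(2) by simp
      ultimately show ?thesis by (simp add: n_def)
    qed
    have "(\<lambda>m. K / real (Suc m)) \<longlonglongrightarrow> 0" by (rule LIMSEQ_Suc) (rule lim_const_over_n)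
    then have "\<bar>T h\<bar> \<le> 0" by (rule LIMSEQ_le_const) (use small in auto)
    then show ?thesis by (simp add: T_def)
  qed
  with g show ?thesis by blast
qed

text \<open>Identifies the abstract dual ball with the ball of signed measures: countable additivity
  of an abstract functional is automatic, and densities carry the bound from bounded functions back
  to all of \<open>C\<close>.\<close>

lemma charge_image_functionals: "charge ` functionals = ca_unit_ball M P \<Phi> C"
proof (intro equalityI subsetI)
  fix \<mu> assume "\<mu> \<in> charge ` functionals"
  then obtain l where l: "l \<in> functionals" "\<mu> = charge l" by auto
  obtain g where g: "has_density (charge l) g" "\<And>h. h \<in> Bdd \<Longrightarrow> l h = (\<integral>x. h x * g x \<partial>R)"
    using functional_density[OF l(1)] by blast
  show "\<mu> \<in> ca_unit_ball M P \<Phi> C"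
    unfolding l(2) by (rule unit_ballI[OF g(1)]) (use functional_bound[OF l(1)] g(2) in simp)
next
  fix \<mu> assume \<mu>: "\<mu> \<in> ca_unit_ball M P \<Phi> C"
  then have "\<mu> \<in> ca M" "ca_dominated M {\<mu>} (measure ` P)" by (simp_all add: ca_unit_ball_def ca_on_def)
  then obtain g where g: "has_density \<mu> g" using ex_density by blast
  note gD = has_densityD[OF g]
  define l where "l h = (if h \<in> Bdd then \<integral>x. h x * g x \<partial>R else 0)" for h
  have "l \<in> functionals"
    unfolding functionals_iff
  proof (intro conjI ballI allI impI)
    fix h assume h: "h \<in> Bdd"
    show "ennreal \<bar>l h\<bar> \<le> N h" using unit_ball_bound[OF \<mu> g h] h by (simp add: l_def)
    show "l (\<lambda>x. c * h x) = c * l h" for c using h Bdd_scale[OF h, of c] by (simp add: l_def mult.assoc)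
    show "l (\<lambda>x. h x + k x) = l h + l k" if k: "k \<in> Bdd" for k
      using h k Bdd_add[OF h k] integrable_Bdd_mult[OF h gD(1)] integrable_Bdd_mult[OF k gD(1)]
      by (simp add: l_def distrib_right)
  qed (simp add: l_def)
  moreover have "charge l = \<mu>"
  proof
    fix A
    show "charge l A = \<mu> A"
      using gD(2,3)[of A] Bdd_indicator[of A] by (simp add: charge_def l_def)
  qed
  ultimately show "\<mu> \<in> charge ` functionals" by blast
qed

text \<open>Densities are unique almost everywhere, so the set of all densities of a signed measure
  is a single class.\<close>

lemma density_class_eq:
  assumes d: "has_density \<mu> g"
  shows "density_class M R \<mu> = qs_class M {R} g"
proof (intro equalityI subsetI)
  note g = has_densityD[OF d]
  fix f assume "f \<in> density_class M R \<mu>"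
  then have f: "f \<in> borel_measurable M" "integrable R f" "\<And>A. A \<in> sets M \<Longrightarrow> \<mu> A = (\<integral>x. indicator A x * f x \<partial>R)"
    by (auto simp: density_class_def)
  have "AE x in R. g x = f x"
    using g(1) f(2)
  proof (rule density_unique_real)
    fix A assume "A \<in> sets R"
    then have "A \<in> sets M" using sets_R by simp
    from g(2)[OF this] f(3)[OF this] show "(\<integral>x\<in>A. g x \<partial>R) = (\<integral>x\<in>A. f x \<partial>R)"
      by (simp add: set_lebesgue_integral_def)
  qed
  with f(1) show "f \<in> qs_class M {R} g" by (simp add: qs_class_def)
next
  note g = has_densityD[OF d]
  fix f assume "f \<in> qs_class M {R} g"
  then have f: "f \<in> borel_measurable M" "AE x in R. g x = f x" by (auto simp: qs_class_def)
  have fR: "f \<in> borel_measurable R" "g \<in> borel_measurable R" using f(1) g(4) by (simp_all add: measurable_R)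
  have "\<mu> A = (\<integral>x. indicator A x * f x \<partial>R)" if A: "A \<in> sets M" for A
    unfolding g(2)[OF A]
  proof (rule integral_cong_AE)
    show "AE x in R. indicator A x * g x = indicator A x * f x" using f(2) by eventually_elim simp
  qed (use A fR sets_R in auto)
  moreover have "integrable R f" using integrable_cong_AE[OF fR(2,1) f(2)] g(1) by simp
  ultimately show "f \<in> density_class M R \<mu>" using f(1) by (auto simp: density_class_def)
qed

text \<open>A weak test functional is integration against a bounded \<open>h\<close>. Composed with
  the map from functionals to density classes it becomes the evaluation of \<open>l\<close> at
  \<open>h\<close>, a coordinate of the product space; the map is therefore continuous and carries
  the compact set of functionals onto the ball.\<close>

lemma weakly_compact_unit_ball:
  "compactin (L1_weak_topology M R) (density_class M R ` ca_unit_ball M P \<Phi> C)"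
proof -
  let ?D = "\<lambda>l. density_class M R (charge l)"
  have D_L1: "?D l \<in> L1 M R" if l: "l \<in> functionals" for l
  proof -
    obtain g where g: "has_density (charge l) g" using functional_density[OF l] by blast
    show ?thesis unfolding density_class_eq[OF g] by (rule mem_L1_class[OF sets_R has_densityD(1)[OF g]])
  qed
  have "continuous_map (subtopology euclidean functionals) (L1_weak_topology M R) ?D"
    unfolding L1_weak_topology_def continuous_on_generated_topo_iff
  proof (intro conjI allI impI)
    fix U assume "U \<in> {{Y \<in> L1 M R. k Y \<in> V} | k V. k \<in> L1_dual M R \<and> open V}"
    then obtain k V where k: "k \<in> L1_dual M R" "open V" and U: "U = {Y \<in> L1 M R. k Y \<in> V}" by auto
    obtain h c where h: "h \<in> borel_measurable M" "\<And>x. \<bar>h x\<bar> \<le> c"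
      and hk: "\<And>f. integrable R f \<Longrightarrow> k (qs_class M {R} f) = (\<integral>x. f x * h x \<partial>R)"
      using L1_dual_representation[OF R.finite_measure_axioms sets_R k(1)] by blast
    have hB: "h \<in> Bdd" using h by (intro BddI)
    have kD: "k (?D l) = l h" if l: "l \<in> functionals" for l
    proof -
      obtain g where g: "has_density (charge l) g" "\<And>h. h \<in> Bdd \<Longrightarrow> l h = (\<integral>x. h x * g x \<partial>R)"
        using functional_density[OF l] by blast
      show ?thesis
        unfolding density_class_eq[OF g(1)] hk[OF has_densityD(1)[OF g(1)]] g(2)[OF hB] by (simp add: mult.commute)
    qed
    have "?D -` U \<inter> topspace (subtopology euclidean functionals) = functionals \<inter> (\<lambda>l. l h) -` V"
      using D_L1 kD by (auto simp: U)
    moreover have "open ((\<lambda>l::('a \<Rightarrow> real) \<Rightarrow> real. l h) -` V)"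
      by (rule open_vimage[OF k(2) continuous_on_product_coordinates])
    ultimately show "openin (subtopology euclidean functionals) (?D -` U \<inter> topspace (subtopology euclidean functionals))"
      by (simp add: openin_open_Int)
  next
    \<comment> \<open>The zero functional with the full preimage shows that the generating sets
      cover \<open>L1 M R\<close>, as continuity into a generated topology demands.\<close>
    have "(\<lambda>_. 0) \<in> L1_dual M R"
      by (auto simp: L1_dual_def norm_continuous_def intro: exI[of _ 1])
    then have "L1 M R \<in> {{Y \<in> L1 M R. k Y \<in> V} | k V. k \<in> L1_dual M R \<and> open V}"
      by (intro CollectI exI[of _ "\<lambda>_. 0"] exI[of _ UNIV]) auto
    then show "?D ` topspace (subtopology euclidean functionals) \<subseteq> \<Union> {{Y \<in> L1 M R. k Y \<in> V} | k V. k \<in> L1_dual M R \<and> open V}"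
      using D_L1 by (intro subset_trans[OF _ Union_upper]) auto
  qed
  moreover have "compactin (subtopology euclidean functionals) functionals"
    using compact_functionals by (simp add: compactin_subtopology)
  ultimately have "compactin (L1_weak_topology M R) (?D ` functionals)" by (rule image_compactin[rotated])
  then show ?thesis by (simp only: charge_image_functionals[symmetric] image_image)
qed

text \<open>\<open>measure R\<close> itself belongs to \<open>ca_on M P \<Phi> C\<close>, so a set
  null for the latter is null for \<open>R\<close>, hence polar. The converse direction is built
  into the definition of \<open>ca_on\<close>.\<close>

lemma ca_on_equivalent: "ca_equivalent M (ca_on M P \<Phi> C) (measure ` P)"
  unfolding ca_equivalent_def
proof
  show "ca_dominated M (ca_on M P \<Phi> C) (measure ` P)"
  proof (unfold ca_dominated_def, intro ballI impI)
    fix A assume A: "A \<in> sets M" "(SUP \<nu>\<in>measure ` P. emeasure (variation M \<nu>) A) = 0"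
    have "emeasure (variation M \<mu>) A = 0" if "\<mu> \<in> ca_on M P \<Phi> C" for \<mu>
      using that A by (auto simp: ca_on_def ca_dominated_def)
    then show "(SUP \<mu>\<in>ca_on M P \<Phi> C. emeasure (variation M \<mu>) A) = 0"
      unfolding le_zero_eq[symmetric] by (intro SUP_least) simp
  qed
  have "measure R \<in> ca_on M P \<Phi> C" by (rule subsetD[OF ca_on_antimono[OF C_subset_LPhi] measure_R_ca_on])
  then have R: "emeasure R A \<le> (SUP \<mu>\<in>ca_on M P \<Phi> C. emeasure (variation M \<mu>) A)" for A
    using SUP_upper[of "measure R" "ca_on M P \<Phi> C" "\<lambda>\<mu>. emeasure (variation M \<mu>) A"] by (simp add: variation_R)
  show "ca_dominated M (measure ` P) (ca_on M P \<Phi> C)"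
  proof (unfold ca_dominated_def, intro ballI impI)
    fix A assume A: "A \<in> sets M" "(SUP \<mu>\<in>ca_on M P \<Phi> C. emeasure (variation M \<mu>) A) = 0"
    then have "emeasure R A = 0" using R[of A] by simp
    then have "emeasure Q A = 0" if "Q \<in> P" for Q using R_null_imp_polar[OF A(1) _ that] by simp
    moreover have "variation M (measure Q) = Q" if "Q \<in> P" for Q
      using that prob_P sets_P by (intro variation_finite_measure) (auto dest: prob_space.finite_measure)
    ultimately show "(SUP \<nu>\<in>measure ` P. emeasure (variation M \<nu>) A) = 0"
      unfolding le_zero_eq[symmetric] by (intro SUP_least) auto
  qed
qed

lemma family_equivalent: "ca_equivalent M (measure ` P) {measure R}"
proof -
  have "ca_dominated M (measure ` P) (measure ` {R})"
    using R_null_imp_polar P_prob R_prob sets_R by (intro ca_dominated_probs_iff[THEN iffD2]) blast+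
  moreover have "ca_dominated M {measure R} (measure ` P)"
    using measure_R_ca_on by (simp add: ca_on_def)
  ultimately show ?thesis by (simp add: ca_equivalent_def)
qed

end

section \<open>The claims for the closed option space of a limited liability claim\<close>

theorem corollary5p8:
  fixes M :: "'a measure"
    and P :: "'a measure set"
    and \<Phi> :: "'a measure \<Rightarrow> real \<Rightarrow> ennreal"
  assumes P_nonempty: "P \<noteq> {}"
    and P_prob: "\<forall>Q\<in>P. prob_space Q \<and> sets Q = sets M"
    and Orlicz: "\<forall>Q\<in>P. Orlicz_function (\<Phi> Q)"
    and Linf_LPhi: "Linf M P \<subseteq> LPhi M P \<Phi>"
  shows
    "(\<forall>X \<in> LPhi M P \<Phi>. \<forall>Pstar \<in> ca_prob M P \<Phi>.
        qs_le P (qs_const M P 0) X \<and>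
        generates_sigma_algebra M X \<and>
        is_ideal M P (LPhi M P \<Phi>) (option_closure M P \<Phi> X) \<and>
        inj_on (canonical_projection M Pstar) (option_closure M P \<Phi> X) \<longrightarrow>
        super_Dedekind_complete P (option_closure M P \<Phi> X) \<and>
        (ca_equivalent M (ca_on M P \<Phi> (option_closure M P \<Phi> X)) (measure ` P) \<and>
         ca_equivalent M (measure ` P) {measure Pstar} \<and>
         compactin (L1_weak_topology M Pstar)
           (density_class M Pstar ` ca_unit_ball M P \<Phi> (option_closure M P \<Phi> X))) \<and>
        (\<exists>I T. is_ideal M {Pstar} (L1 M Pstar) I \<and>
           lattice_isomorphism M P (option_closure M P \<Phi> X) {Pstar} I T) \<and>
        (X \<in> Orlicz_closure M P \<Phi> (Linf M P) \<and>
         Orlicz_closure M P \<Phi> (Linf M P) = option_closure M P \<Phi> X))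
     \<and> (\<not> dominated M P \<longrightarrow>
        (\<forall>X \<in> LPhi M P \<Phi>.
           qs_le P (qs_const M P 0) X \<and> generates_sigma_algebra M X \<longrightarrow>
           \<not> is_ideal M P (LPhi M P \<Phi>) (option_closure M P \<Phi> X)))"
proof -
  interpret orlicz_family M P \<Phi> using P_prob Orlicz by unfold_locales
  \<comment> \<open>The constant 1 is bounded, so the inclusion of bounded classes gives it finite
    norm; the rounding of strikes relies on this.\<close>
  have "cls (\<lambda>x. 1) \<in> Linf M P"
    unfolding Linf_def
    by (intro CollectI conjI qs_class_in_L0 bexI[of _ "\<lambda>x. 1"] exI[of _ 1] self_mem_qs_class) auto
  then have "cls (\<lambda>x. 1) \<in> LPhi M P \<Phi>" using Linf_LPhi by blast
  then have N_one: "N (\<lambda>x. 1) < \<infinity>" by (simp add: class_in_LPhi_iff)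
  show ?thesis
  proof (intro conjI impI ballI; (elim conjE)?)
    fix X Pstar
    assume X: "X \<in> LPhi M P \<Phi>" and Pstar: "Pstar \<in> ca_prob M P \<Phi>"
      and pos: "qs_le P (qs_const M P 0) X"
      and ideal: "is_ideal M P (LPhi M P \<Phi>) (option_closure M P \<Phi> X)"
      and inj: "inj_on (canonical_projection M Pstar) (option_closure M P \<Phi> X)"
    interpret orlicz_ideal M P \<Phi> "option_closure M P \<Phi> X"
      by (rule orlicz_ideal_option_closure[OF N_one X ideal])
    interpret represented_ideal M P \<Phi> "option_closure M P \<Phi> X" Pstar
      using Pstar inj by unfold_locales
    show "super_Dedekind_complete P (option_closure M P \<Phi> X)" by (rule super_Dedekind_complete)
    show "ca_equivalent M (ca_on M P \<Phi> (option_closure M P \<Phi> X)) (measure ` P)" by (rule ca_on_equivalent)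
    show "ca_equivalent M (measure ` P) {measure Pstar}" by (rule family_equivalent)
    show "compactin (L1_weak_topology M Pstar)
        (density_class M Pstar ` ca_unit_ball M P \<Phi> (option_closure M P \<Phi> X))"
      by (rule weakly_compact_unit_ball)
    show "\<exists>I T. is_ideal M {Pstar} (L1 M Pstar) I \<and>
        lattice_isomorphism M P (option_closure M P \<Phi> X) {Pstar} I T"
      using ideal_in_L1 lattice_isomorphism_L1 by blast
    show "Orlicz_closure M P \<Phi> (Linf M P) = option_closure M P \<Phi> X" by (rule closure_Linf)
    then show "X \<in> Orlicz_closure M P \<Phi> (Linf M P)"
      using mem_option_closure[OF N_one X pos] by simp
  next
    fix X
    assume nd: "\<not> dominated M P" and X: "X \<in> LPhi M P \<Phi>"
    show "\<not> is_ideal M P (LPhi M P \<Phi>) (option_closure M P \<Phi> X)"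
    proof
      assume "is_ideal M P (LPhi M P \<Phi>) (option_closure M P \<Phi> X)"
      then interpret orlicz_ideal M P \<Phi> "option_closure M P \<Phi> X"
        by (rule orlicz_ideal_option_closure[OF N_one X])
      show False using nd dominated_family[OF P_nonempty] by simp
    qed
  qed
qed

end
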